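(* Assume one of the following: (a) $p=\frac{10}3$, $\gamma,\beta>0$ and $c_*<c<c^*$; (b) $\frac{10}3<p<4$, $\gamma,\beta>0$ and $0<c<c^*$; (c) $4\le p<6$, $\gamma>0$, $\beta>2^{\frac{p-2}2}$ and $0<c<c^*$, with $c_*,c^*$ as defined in the context. Let $(\bar u,\bar v)\in\mathbf H$ be a vectorial energy ground state of system (S) of mass $c$ whose Lagrange multiplier $\bar\lambda$ is positive. Then $(\bar u,\bar v)$ has exponential decay: there are $C>0$ and $\zeta>0$ such that $$|\bar u(x)|\le Ce^{-\zeta|x|}\quad\text{and}\quad|\bar v(x)|\le Ce^{-\zeta|x|}\qquad\text{for every }x\in\mathbb R^3.$$
   Context: Functions are real-valued on $\mathbb R^3$. $\mathbf H:=H^1(\mathbb R^3)\times H^1(\mathbb R^3)$, $\phi_{u,v}(x):=\int_{\mathbb R^3}\frac{u^2(y)+v^2(y)}{|x-y|}\,dy$. System (S) is $$-\Delta u+\lambda u+\gamma\phi_{u,v}u=|u|^{p-2}u+\beta|v|^{\frac p2}|u|^{\frac p2-2}u,\qquad -\Delta v+\lambda v+\gamma\phi_{u,v}v=|v|^{p-2}v+\beta|u|^{\frac p2}|v|^{\frac p2-2}v\quad\text{in }\mathbb R^3.$$ Set $$A(u,v)=\int_{\mathbb R^3}(|\nabla u|^2+|\nabla v|^2)\,dx,\quad B(u,v)=\int_{\mathbb R^3}\phi_{u,v}(u^2+v^2)\,dx,\quad C(u,v)=\int_{\mathbb R^3}(|u|^p+|v|^p+2\beta|u|^{\frac p2}|v|^{\frac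 p2})\,dx,$$ $$I_{\gamma,\beta}(u,v)=\tfrac12A(u,v)+\tfrac\gamma4B(u,v)-\tfrac1pC(u,v),\qquad S_c=\Big\{(u,v)\in\mathbf H:\int_{\mathbb R^3}(u^2+v^2)\,dx=c\Big\}.$$ A pair $(u,v)\in S_c$ is an energy ground state of (S) of mass $c$ if it is a critical point of $I_{\gamma,\beta}|_{S_c}$ and $I_{\gamma,\beta}(u,v)$ is the infimum of $I_{\gamma,\beta}$ over all critical points of $I_{\gamma,\beta}|_{S_c}$; its Lagrange multiplier is the $\lambda\in\mathbb R$ for which it solves (S). A pair is vectorial if both $u\neq0$ and $v\neq0$. With $\mathcal R_p(u,v):=\Big[\frac{A(u,v)^{3p-8}(\gamma B(u,v))^{10-3p}}{C(u,v)^2}\Big]^{\frac1{4(p-3)}}$, $$c_*:=\Big(\frac53\Big)^{\frac32}\inf_{(u,v)\in S_1}\mathcal R_{10/3}(u,v)\ (\text{case }p=\tfrac{10}3),\qquad c^*:=\Big(\frac{2(6-p)}{5p-12}\Big)^{\frac{3p-10}{4(p-3)}}\Big(\frac{3p}{5p-12}\Big)^{\frac1{2(p-3)}}\inf_{(u,v)\in S_1}\mathcal R_p(u,v).$$ *)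

theory Defs
  imports "HOL-Analysis.Analysis" "HOL-Library.Extended_Real"
begin

type_synonym R3 = "real ^ 3"

definition pdiff :: "3 \<Rightarrow> (R3 \<Rightarrow> real) \<Rightarrow> R3 \<Rightarrow> real" where
  "pdiff i f = (\<lambda>x. frechet_derivative f (at x) (axis i 1))"

(* C^infinity: every iterated partial derivative (of order 0, 1, 2, ...) is
   differentiable everywhere; together with compact support. *)
definition test_function :: "(R3 \<Rightarrow> real) \<Rightarrow> bool" where
  "test_function \<eta> \<longleftrightarrow>
     (\<forall>is x. foldr pdiff is \<eta> differentiable (at x)) \<and>
     compact (closure {x. \<eta> x \<noteq> 0})"

(* g is square integrable and is the distributional gradient of u.  Square
   integrability makes all integrals below converge for u in L^2, and g is then
   unique up to a null set. *)
definition weak_gradient :: "(R3 \<Rightarrow> real) \<Rightarrow> (R3 \<Rightarrow> R3) \<Rightarrow> bool" where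
  "weak_gradient u g \<longleftrightarrow>
     g \<in> borel_measurable lborel \<and> integrable lborel (\<lambda>x. (norm (g x))\<^sup>2) \<and>
     (\<forall>\<eta> i. test_function \<eta> \<longrightarrow>
        (LINT x|lborel. u x * pdiff i \<eta> x) = - (LINT x|lborel. g x $ i * \<eta> x))"

(* Elements of H^1 are represented by Borel functions (every class has a Borel
   representative); equality in H^1 is equality almost everywhere. *)
definition H1 :: "(R3 \<Rightarrow> real) set" where
  "H1 = {u \<in> borel_measurable lborel.
           integrable lborel (\<lambda>x. (u x)\<^sup>2) \<and> (\<exists>g. weak_gradient u g)}"

(* A choice of weak gradient; only used on H1 and only under integrals. *)
definition grad :: "(R3 \<Rightarrow> real) \<Rightarrow> R3 \<Rightarrow> R3" where
  "grad u = (SOME g. weak_gradient u g)"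

definition coulomb :: "(R3 \<Rightarrow> real) \<Rightarrow> (R3 \<Rightarrow> real) \<Rightarrow> R3 \<Rightarrow> real" where
  "coulomb u v x = (LINT y|lborel. ((u y)\<^sup>2 + (v y)\<^sup>2) / norm (x - y))"

definition A_term :: "(R3 \<Rightarrow> real) \<Rightarrow> (R3 \<Rightarrow> real) \<Rightarrow> real" where
  "A_term u v = (LINT x|lborel. (norm (grad u x))\<^sup>2 + (norm (grad v x))\<^sup>2)"

definition B_term :: "(R3 \<Rightarrow> real) \<Rightarrow> (R3 \<Rightarrow> real) \<Rightarrow> real" where
  "B_term u v = (LINT x|lborel. coulomb u v x * ((u x)\<^sup>2 + (v x)\<^sup>2))"

definition C_term :: "real \<Rightarrow> real \<Rightarrow> (R3 \<Rightarrow> real) \<Rightarrow> (R3 \<Rightarrow> real) \<Rightarrow> real" where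
  "C_term p \<beta> u v =
     (LINT x|lborel. \<bar>u x\<bar> powr p + \<bar>v x\<bar> powr p
        + 2 * \<beta> * (\<bar>u x\<bar> powr (p / 2)) * (\<bar>v x\<bar> powr (p / 2)))"

definition energy :: "real \<Rightarrow> real \<Rightarrow> real \<Rightarrow> (R3 \<Rightarrow> real) \<Rightarrow> (R3 \<Rightarrow> real) \<Rightarrow> real" where
  "energy p \<gamma> \<beta> u v =
     1 / 2 * A_term u v + \<gamma> / 4 * B_term u v - 1 / p * C_term p \<beta> u v"

definition S :: "real \<Rightarrow> ((R3 \<Rightarrow> real) \<times> (R3 \<Rightarrow> real)) set" where
  "S c = {(u, v). u \<in> H1 \<and> v \<in> H1 \<and> (LINT x|lborel. (u x)\<^sup>2 + (v x)\<^sup>2) = c}"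

(* Critical points of the C^1 functional energy restricted to S c: the
   derivative of the energy vanishes on the tangent space
   {(h, k) in H^1 x H^1. LINT (u h + v k) = 0} of S c at (u, v). *)
definition critical_points ::
    "real \<Rightarrow> real \<Rightarrow> real \<Rightarrow> real \<Rightarrow> ((R3 \<Rightarrow> real) \<times> (R3 \<Rightarrow> real)) set" where
  "critical_points p \<gamma> \<beta> c =
     {(u, v) \<in> S c. \<forall>h\<in>H1. \<forall>k\<in>H1.
        (LINT x|lborel. u x * h x + v x * k x) = 0 \<longrightarrow>
        ((\<lambda>t. energy p \<gamma> \<beta> (\<lambda>x. u x + t * h x) (\<lambda>x. v x + t * k x))
           has_real_derivative 0) (at 0)}"

(* The infimum is taken in the extended reals, so that it is the genuine one
   without a separate boundedness argument. *)
definition energy_ground_state ::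
    "real \<Rightarrow> real \<Rightarrow> real \<Rightarrow> real \<Rightarrow> (R3 \<Rightarrow> real) \<Rightarrow> (R3 \<Rightarrow> real) \<Rightarrow> bool" where
  "energy_ground_state p \<gamma> \<beta> c u v \<longleftrightarrow>
     (u, v) \<in> critical_points p \<gamma> \<beta> c \<and>
     ereal (energy p \<gamma> \<beta> u v)
       = (INF (u', v')\<in>critical_points p \<gamma> \<beta> c. ereal (energy p \<gamma> \<beta> u' v'))"

(* Both equations of the system in the weak sense, with test functions in H^1.
   For p < 4 the exponent p / 2 - 2 is negative; 0 powr a = 0 gives the factor
   |s|^(p/2-2) s its continuous value 0 at s = 0. *)
definition weak_solution ::
    "real \<Rightarrow> real \<Rightarrow> real \<Rightarrow> real \<Rightarrow> (R3 \<Rightarrow> real) \<Rightarrow> (R3 \<Rightarrow> real) \<Rightarrow> bool" where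
  "weak_solution p \<gamma> \<beta> lam u v \<longleftrightarrow> u \<in> H1 \<and> v \<in> H1 \<and>
     (\<forall>\<eta>\<in>H1.
        (LINT x|lborel. grad u x \<bullet> grad \<eta> x + lam * u x * \<eta> x + \<gamma> * coulomb u v x * u x * \<eta> x)
        = (LINT x|lborel. (\<bar>u x\<bar> powr (p - 2) * u x
             + \<beta> * \<bar>v x\<bar> powr (p / 2) * \<bar>u x\<bar> powr (p / 2 - 2) * u x) * \<eta> x)) \<and>
     (\<forall>\<eta>\<in>H1.
        (LINT x|lborel. grad v x \<bullet> grad \<eta> x + lam * v x * \<eta> x + \<gamma> * coulomb u v x * v x * \<eta> x)
        = (LINT x|lborel. (\<bar>v x\<bar> powr (p - 2) * v x
             + \<beta> * \<bar>u x\<bar> powr (p / 2) * \<bar>v x\<bar> powr (p / 2 - 2) * v x) * \<eta> x))"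

definition vectorial :: "(R3 \<Rightarrow> real) \<Rightarrow> (R3 \<Rightarrow> real) \<Rightarrow> bool" where
  "vectorial u v \<longleftrightarrow>
     \<not> (AE x in lborel. u x = 0) \<and> \<not> (AE x in lborel. v x = 0)"

definition R_quot ::
    "real \<Rightarrow> real \<Rightarrow> real \<Rightarrow> (R3 \<Rightarrow> real) \<Rightarrow> (R3 \<Rightarrow> real) \<Rightarrow> real" where
  "R_quot p \<gamma> \<beta> u v =
     (A_term u v powr (3 * p - 8) * (\<gamma> * B_term u v) powr (10 - 3 * p)
        / (C_term p \<beta> u v)\<^sup>2) powr (1 / (4 * (p - 3)))"

definition c_lower :: "real \<Rightarrow> real \<Rightarrow> real" where
  "c_lower \<gamma> \<beta> = (5 / 3) powr (3 / 2) * (INF (u, v)\<in>S 1. R_quot (10 / 3) \<gamma> \<beta> u v)"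

definition c_upper :: "real \<Rightarrow> real \<Rightarrow> real \<Rightarrow> real" where
  "c_upper p \<gamma> \<beta> =
     (2 * (6 - p) / (5 * p - 12)) powr ((3 * p - 10) / (4 * (p - 3)))
     * (3 * p / (5 * p - 12)) powr (1 / (2 * (p - 3)))
     * (INF (u, v)\<in>S 1. R_quot p \<gamma> \<beta> u v)"

(* Pointwise bound for a pair of almost-everywhere classes: it is asserted at
   every point for the continuous representatives. *)
definition exponential_decay :: "(R3 \<Rightarrow> real) \<Rightarrow> (R3 \<Rightarrow> real) \<Rightarrow> bool" where
  "exponential_decay u v \<longleftrightarrow>
     (\<exists>u' v'. continuous_on UNIV u' \<and> (AE x in lborel. u' x = u x) \<and>
              continuous_on UNIV v' \<and> (AE x in lborel. v' x = v x) \<and>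
              (\<exists>C>0. \<exists>\<zeta>>0. \<forall>x. \<bar>u' x\<bar> \<le> C * exp (- \<zeta> * norm x) \<and>
                                \<bar>v' x\<bar> \<le> C * exp (- \<zeta> * norm x)))"

end

theory Submission
  imports Defs
begin

text \<open>
  No regularity theory is needed: everything is read off from convolutions with the Yukawa kernel
  \<open>G z = exp (- k * norm z) / norm z\<close>. Replacing \<open>norm z\<close> by \<open>sqrt (\<epsilon>\<^sup>2 + (norm z)\<^sup>2)\<close> makes \<open>G\<close> smooth, and
  \<open>k\<^sup>2 - \<Delta>\<close> maps the regularized kernel to an explicit approximate identity. Inserting its translates into the
  definition of the weak gradient (with \<open>k = 1\<close>) and letting \<open>\<epsilon>\<close> tend to 0 bounds \<open>\<bar>u\<bar>\<close> by the convolution of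
  \<open>\<bar>u\<bar> + norm (grad u)\<close> with a multiple of \<open>norm z powr - 2\<close>, which gives \<open>u \<in> L\<^sup>q\<close> for \<open>2 \<le> q < 6\<close>. Inserting
  them into the weak equation (with \<open>k = sqrt lam\<close>) expresses \<open>u\<close> and \<open>v\<close> as convolutions of \<open>G\<close> with the remaining
  terms, so that \<open>w = \<bar>u\<bar> + \<bar>v\<bar>\<close> satisfies \<open>w \<le> G * (V w)\<close> with \<open>V\<close> a combination of \<open>w powr (p - 2)\<close> and the
  Coulomb potential. Where \<open>w\<close> or \<open>norm x\<close> is large, \<open>V\<close> is so small in the sense of convolutions with \<open>G\<close> that
  the right-hand side is a contraction, also for the weight \<open>exp (- (k / 2) * norm x)\<close>; on the remaining bounded
  set \<open>V w\<close> is bounded. Hence boundedness and exponential decay of \<open>w\<close> follow in one step, and \<open>u\<close>, \<open>v\<close> are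
  continuous as convolutions of \<open>G\<close> with bounded functions.
\<close>

section \<open>Smooth functions and test functions\<close>

text \<open>The only source of decay is \<open>lam > 0\<close>: the Coulomb term, although of
  favourable sign, is moved to the right-hand side in absolute value. The two parts of
  \<open>V\<close> are small for different reasons: the power of \<open>w\<close> only in an
  integrated sense, the Coulomb potential because it is bounded and tends to 0 at infinity. The
  exponent \<open>p < 6\<close> enters by duality. In dimension 3 the singularity
  \<open>1 / norm z\<close> is integrable to powers below 3, so \<open>w powr (p - 2)\<close> is
  needed in \<open>L\<^sup>m\<close> for some \<open>m > 3 / 2\<close>, that is, \<open>w\<close> in
  \<open>L\<^sup>q\<close> for some \<open>q > 3 / 2 * (p - 2)\<close>. For \<open>p < 6\<close>
  such a \<open>q < 6\<close> exists, and a weak \<open>L\<^sup>6\<close> bound replaces the sharp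
  Sobolev inequality. The rate is \<open>k / 2\<close> because half of the exponential in
  \<open>G\<close> carries the weight across the convolution while the other half keeps the kernel
  integrable at infinity. What shapes the contraction step is that \<open>w\<close> is not known
  beforehand to be bounded by any multiple of the weight, so no weighted supremum can be absorbed.
  Instead the excess over the weight is absorbed in an integral norm known to be finite.\<close>

definition smooth :: "(R3 \<Rightarrow> real) \<Rightarrow> bool" where
  "smooth f \<longleftrightarrow> (\<forall>is x. foldr pdiff is f differentiable (at x))"

inductive alg :: "(R3 \<Rightarrow> real) set \<Rightarrow> (R3 \<Rightarrow> real) \<Rightarrow> bool" for A where
  alg_gen: "f \<in> A \<Longrightarrow> alg A f"
| alg_const: "alg A (\<lambda>_. c)"
| alg_add: "alg A f \<Longrightarrow> alg A g \<Longrightarrow> alg A (\<lambda>x. f x + g x)"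
| alg_mult: "alg A f \<Longrightarrow> alg A g \<Longrightarrow> alg A (\<lambda>x. f x * g x)"

lemma pdiff_eqI: "(f has_derivative f') (at x) \<Longrightarrow> pdiff i f x = f' (axis i 1)"
  by (simp add: pdiff_def frechet_derivative_at[symmetric])

lemma pdiff_const [simp]: "pdiff i (\<lambda>_. c) = (\<lambda>_. 0)"
  by (rule ext) (simp add: pdiff_eqI[OF has_derivative_const])

lemma pdiff_add:
  assumes "f differentiable (at x)" "g differentiable (at x)"
  shows "pdiff i (\<lambda>x. f x + g x) x = pdiff i f x + pdiff i g x"
  using pdiff_eqI[OF has_derivative_add[OF assms[THEN frechet_derivative_works[THEN iffD1]]]]
  by (simp add: pdiff_def)

lemma pdiff_mult:
  assumes "f differentiable (at x)" "g differentiable (at x)"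
  shows "pdiff i (\<lambda>x. f x * g x) x = f x * pdiff i g x + pdiff i f x * g x"
  using pdiff_eqI[OF has_derivative_mult[OF assms[THEN frechet_derivative_works[THEN iffD1]]]]
  by (simp add: pdiff_def)

text \<open>Smoothness concerns all iterated derivatives at once. By the sum and product rules the
  algebra generated by \<open>A\<close> is stable under \<open>pdiff\<close> once the derivatives of
  the generators lie in it, so a first-order check on the generators yields every order.\<close>

lemma smooth_algI:
  assumes "\<And>f x. f \<in> A \<Longrightarrow> f differentiable (at x)"
    and "\<And>f i. f \<in> A \<Longrightarrow> alg A (pdiff i f)"
    and "alg A f"
  shows "smooth f"
proof -
  have diff: "f differentiable (at x)" if "alg A f" for f x
    using that by induction (auto intro: assms(1))
  have closed: "alg A (pdiff i f)" if "alg A f" for f i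
    using that
  proof induction
    case (alg_add f g)
    then have "pdiff i (\<lambda>x. f x + g x) = (\<lambda>x. pdiff i f x + pdiff i g x)"
      by (auto simp: fun_eq_iff intro!: pdiff_add diff)
    with alg_add show ?case by (auto intro: alg.alg_add)
  next
    case (alg_mult f g)
    then have "pdiff i (\<lambda>x. f x * g x) = (\<lambda>x. f x * pdiff i g x + pdiff i f x * g x)"
      by (auto simp: fun_eq_iff intro!: pdiff_mult diff)
    with alg_mult show ?case by (auto intro!: alg.alg_add alg.alg_mult)
  qed (auto intro: assms(2) alg.alg_const)
  have "alg A (foldr pdiff is f)" for "is"
    by (induction "is") (auto intro: closed assms(3))
  then show ?thesis
    unfolding smooth_def by (auto intro: diff)
qed

lemma smooth_differentiable: "smooth f \<Longrightarrow> f differentiable (at x)"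
  unfolding smooth_def by (metis foldr_Nil id_apply)

lemma smooth_pdiff: "smooth f \<Longrightarrow> smooth (pdiff i f)"
  unfolding smooth_def
proof (intro allI)
  fix "is" x assume "\<forall>is x. foldr pdiff is f differentiable at x"
  \<comment> \<open>\<open>foldr\<close> applies the last entry of the list first, so appending
    \<open>i\<close> differentiates in direction \<open>i\<close> before everything else.\<close>
  then have "foldr pdiff (is @ [i]) f differentiable at x" by blast
  then show "foldr pdiff is (pdiff i f) differentiable at x" by simp
qed

lemma smooth_alg_smooth: "alg (Collect smooth) f \<Longrightarrow> smooth f"
  by (rule smooth_algI[of "Collect smooth"])
    (auto intro: smooth_differentiable smooth_pdiff alg_gen)

lemma smooth_const [simp]: "smooth (\<lambda>_. c)"
  by (intro smooth_alg_smooth alg_const)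

lemma smooth_add: "smooth f \<Longrightarrow> smooth g \<Longrightarrow> smooth (\<lambda>x. f x + g x)"
  by (intro smooth_alg_smooth alg_add alg_gen) auto

lemma smooth_mult: "smooth f \<Longrightarrow> smooth g \<Longrightarrow> smooth (\<lambda>x. f x * g x)"
  by (intro smooth_alg_smooth alg_mult alg_gen) auto

lemma smooth_minus: "smooth f \<Longrightarrow> smooth (\<lambda>x. - f x)"
  using smooth_mult[OF smooth_const[of "-1"], of f] by simp

lemma smooth_prod: "(\<And>i. i \<in> I \<Longrightarrow> smooth (f i)) \<Longrightarrow> smooth (\<lambda>x. \<Prod>i\<in>I. f i x)"
  by (induction I rule: infinite_finite_induct) (auto intro: smooth_mult)

lemma smooth_sum: "(\<And>i. i \<in> I \<Longrightarrow> smooth (f i)) \<Longrightarrow> smooth (\<lambda>x. \<Sum>i\<in>I. f i x)"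
  by (induction I rule: infinite_finite_induct) (auto intro: smooth_add)

lemma smooth_continuous: "smooth f \<Longrightarrow> continuous_on X f"
  by (intro continuous_at_imp_continuous_on ballI differentiable_imp_continuous_within smooth_differentiable)

lemma smooth_measurable [measurable_dest]: "smooth f \<Longrightarrow> f \<in> borel_measurable borel"
  by (intro borel_measurable_continuous_onI smooth_continuous)

lemma pdiff_coord: "pdiff i (\<lambda>x. x $ j) = (\<lambda>_. if i = j then 1 else 0)"
proof
  fix x :: R3
  have "((\<lambda>x. x $ j) has_derivative (\<lambda>x. x $ j)) (at x)"
    by (rule bounded_linear_imp_has_derivative) (rule bounded_linear_vec_nth)
  from pdiff_eqI[OF this] show "pdiff i (\<lambda>x. x $ j) x = (if i = j then 1 else 0)"
    by (simp add: axis_def)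
qed

lemma smooth_coord: "smooth (\<lambda>x. x $ j)"
proof (rule smooth_algI[of "{\<lambda>x. x $ j}"])
  show "f differentiable at x" if "f \<in> {\<lambda>x. x $ j}" for f x
    using that bounded_linear_imp_differentiable[OF bounded_linear_vec_nth] by auto
  show "alg {\<lambda>x. x $ j} (pdiff i f)" if "f \<in> {\<lambda>x. x $ j}" for f i
    using that by (auto simp: pdiff_coord intro!: alg_const)
qed (auto intro: alg_gen)

text \<open>The classical flat function \<open>exp (- (1 / s))\<close> with an extra pole of order
  \<open>m\<close>. Without the pole the family would not be closed under differentiation, which
  turns order \<open>m\<close> into the orders \<open>m + 2\<close> and
  \<open>m + 1\<close>.\<close>

definition bump :: "nat \<Rightarrow> real \<Rightarrow> real" where
  "bump m s = (if s > 0 then exp (- (1 / s)) / s ^ m else 0)"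

lemma bump_nonneg [simp]: "0 \<le> bump m s"
  by (simp add: bump_def)

text \<open>The single term of index \<open>m + k\<close> in the series of
  \<open>exp (1 / s)\<close> absorbs the pole and leaves \<open>k\<close> powers of
  \<open>s\<close>. Both the flatness at 0 and, with \<open>k = 0\<close>, plain boundedness come
  from this.\<close>

lemma bump_bound:
  assumes "s > 0" shows "bump m s \<le> fact (m + k) * s ^ k"
proof -
  have "(\<Sum>i\<in>{m + k}. (1 / s) ^ i /\<^sub>R fact i) \<le> (\<Sum>i. (1 / s) ^ i /\<^sub>R fact i)"
    using assms by (intro sum_le_suminf summable_exp_generic) auto
  then have "(1 / s) ^ (m + k) / fact (m + k) \<le> exp (1 / s)"
    by (simp add: exp_def divide_inverse mult.commute)
  then show ?thesis
    using assms by (simp add: bump_def exp_minus field_simps power_add)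
qed

lemma bump_has_derivative:
  "(bump m has_real_derivative (bump (m + 2) s - m * bump (m + 1) s)) (at s)"
proof -
  consider "s > 0" | "s < 0" | "s = 0" by linarith
  then show ?thesis
  proof cases
    case 1
    have "((\<lambda>s. exp (- (1 / s)) / s ^ m) has_real_derivative (bump (m + 2) s - m * bump (m + 1) s)) (at s)"
      using 1 by (auto intro!: derivative_eq_intros simp: bump_def field_simps power2_eq_square)
        (cases m; simp add: field_simps)
    then show ?thesis
      by (rule has_field_derivative_transform_within_open[where S = "{0<..}"])
        (use 1 in \<open>auto simp: bump_def\<close>)
  next
    case 2
    have "((\<lambda>s. 0) has_real_derivative (bump (m + 2) s - m * bump (m + 1) s)) (at s)"
      using 2 by (auto simp: bump_def)
    then show ?thesis
      by (rule has_field_derivative_transform_within_open[where S = "{..<0}"])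
        (use 2 in \<open>auto simp: bump_def\<close>)
  next
    case 3
    \<comment> \<open>The derivative at the origin must be 0. Two spare powers of \<open>h\<close>
      leave one after the division, so the difference quotient is of order
      \<open>\<bar>h\<bar>\<close>.\<close>
    have "((\<lambda>h. bump m h / h) \<longlongrightarrow> 0) (at 0)"
    proof (rule Lim_null_comparison)
      show "\<forall>\<^sub>F h in at 0. norm (bump m h / h) \<le> fact (m + 2) * \<bar>h\<bar>"
      proof (intro eventuallyI)
        fix h :: real
        show "norm (bump m h / h) \<le> fact (m + 2) * \<bar>h\<bar>"
        proof (cases "h > 0")
          case True
          with bump_bound[OF True, of m 2] show ?thesis
            by (simp add: field_simps power2_eq_square)
        next
          case False
          then have "norm (bump m h / h) = 0" by (simp add: bump_def)
          also have "\<dots> \<le> fact (m + 2) * \<bar>h\<bar>" by (intro mult_nonneg_nonneg) auto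
          finally show ?thesis .
        qed
      qed
      show "((\<lambda>h::real. fact (m + 2) * \<bar>h\<bar>) \<longlongrightarrow> 0) (at 0)"
        by (auto intro!: tendsto_eq_intros)
    qed
    then show ?thesis
      using 3 by (simp add: has_field_derivative_iff bump_def)
  qed
qed

lemma pdiff_bump:
  assumes "f differentiable (at x)"
  shows "pdiff i (\<lambda>x. bump m (f x)) x = (bump (m + 2) (f x) - m * bump (m + 1) (f x)) * pdiff i f x"
    and "(\<lambda>x. bump m (f x)) differentiable (at x)"
proof -
  have *: "((\<lambda>x. bump m (f x)) has_derivative
     (\<lambda>h. frechet_derivative f (at x) h *\<^sub>R (bump (m + 2) (f x) - m * bump (m + 1) (f x)))) (at x)"
    using has_derivative_compose[OF frechet_derivative_works[THEN iffD1, OF assms]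
      bump_has_derivative[of m "f x", unfolded has_field_derivative_def]]
    by (simp add: mult.commute)
  show "(\<lambda>x. bump m (f x)) differentiable (at x)"
    using * by (auto simp: differentiable_def)
  show "pdiff i (\<lambda>x. bump m (f x)) x = (bump (m + 2) (f x) - m * bump (m + 1) (f x)) * pdiff i f x"
    using pdiff_eqI[OF *] by (simp add: pdiff_def)
qed

text \<open>The generators include the bumps of all orders, since each differentiation raises the
  order.\<close>

lemma smooth_bump:
  assumes "smooth f" shows "smooth (\<lambda>x. bump m (f x))"
proof (rule smooth_algI[of "Collect smooth \<union> range (\<lambda>m x. bump m (f x))"])
  let ?A = "Collect smooth \<union> range (\<lambda>m x. bump m (f x))"
  note f = smooth_differentiable[OF assms]
  show "g differentiable at x" if "g \<in> ?A" for g x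
    using that by (auto intro: smooth_differentiable pdiff_bump(2)[OF f])
  show "alg ?A (pdiff i g)" if "g \<in> ?A" for g i
    using that
  proof
    assume "g \<in> range (\<lambda>m x. bump m (f x))"
    then obtain k where g: "g = (\<lambda>x. bump k (f x))" by auto
    have "pdiff i g = (\<lambda>x. (bump (k + 2) (f x) + (- k) * bump (k + 1) (f x)) * pdiff i f x)"
      unfolding g by (auto simp: pdiff_bump(1)[OF f])
    moreover have "alg ?A (\<lambda>x. (bump (k + 2) (f x) + (- k) * bump (k + 1) (f x)) * pdiff i f x)"
      by (intro alg_mult alg_add alg_const alg_gen) (use smooth_pdiff[OF assms] in auto)
    ultimately show ?thesis by simp
  qed (auto intro: alg_gen smooth_pdiff)
qed (auto intro: alg_gen)

section \<open>Test functions: supports, bounds, integrability\<close>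

lemma test_function_iff: "test_function \<eta> \<longleftrightarrow> smooth \<eta> \<and> compact (closure {x. \<eta> x \<noteq> 0})"
  by (simp add: test_function_def smooth_def)

lemma test_functionI:
  assumes "smooth \<eta>" "bounded {x. \<eta> x \<noteq> 0}" shows "test_function \<eta>"
  using assms by (simp add: test_function_iff compact_closure)

lemma test_function_mult:
  assumes "test_function \<eta>" "smooth f" shows "test_function (\<lambda>x. f x * \<eta> x)"
proof (rule test_functionI)
  show "bounded {x. f x * \<eta> x \<noteq> 0}"
    using assms(1) by (rule_tac bounded_subset[of "{x. \<eta> x \<noteq> 0}"])
      (auto simp: test_function_iff compact_closure)
qed (use assms in \<open>auto simp: test_function_iff intro: smooth_mult\<close>)

lemma test_function_bounded:
  assumes "test_function \<eta>"
  obtains B where "B > 0" "\<And>x. \<bar>\<eta> x\<bar> \<le> B"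
proof -
  let ?K = "closure {x. \<eta> x \<noteq> 0}"
  have "compact (\<eta> ` ?K)"
    using assms by (intro compact_continuous_image smooth_continuous) (auto simp: test_function_iff)
  then obtain B where B: "B > 0" "\<And>x. x \<in> ?K \<Longrightarrow> \<bar>\<eta> x\<bar> \<le> B"
    using compact_imp_bounded[THEN bounded_pos[THEN iffD1], of "\<eta> ` ?K"] by auto
  show thesis
  proof (rule that[OF B(1)])
    fix x show "\<bar>\<eta> x\<bar> \<le> B"
      using B(2)[of x] B(1) closure_subset[of "{x. \<eta> x \<noteq> 0}"] by (cases "\<eta> x = 0") auto
  qed
qed

lemma test_function_support:
  assumes "test_function \<eta>"
  obtains R where "R > 0" "\<And>x. norm x > R \<Longrightarrow> \<eta> x = 0"
proof -
  obtain R where R: "R > 0" "\<And>x. \<eta> x \<noteq> 0 \<Longrightarrow> norm x \<le> R"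
    using assms unfolding test_function_iff compact_closure bounded_pos by auto
  then show thesis by (intro that[of R]) (auto simp: linorder_not_le[symmetric])
qed

lemma test_function_pdiff: assumes "test_function \<eta>" shows "test_function (pdiff i \<eta>)"
proof -
  obtain R where R: "R > 0" "\<And>x. norm x > R \<Longrightarrow> \<eta> x = 0"
    using test_function_support[OF assms] by blast
  have "pdiff i \<eta> x = 0" if "norm x > R" for x
  proof -
    have "((\<lambda>_. 0) has_derivative (\<lambda>_. 0)) (at x)" by simp
    moreover have "open {x::R3. norm x > R}"
      by (intro open_Collect_less continuous_intros)
    ultimately have "(\<eta> has_derivative (\<lambda>_. 0)) (at x)"
      by (rule has_derivative_transform_within_open) (use that R in auto)
    from pdiff_eqI[OF this] show ?thesis by simp
  qed
  then have "bounded {x. pdiff i \<eta> x \<noteq> 0}"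
    by (intro boundedI[of _ R]) (auto simp: linorder_not_le[symmetric])
  then show ?thesis
    using assms by (intro test_functionI smooth_pdiff) (auto simp: test_function_iff)
qed

lemma test_function_integrable_mult:
  fixes f :: "R3 \<Rightarrow> real"
  assumes "test_function \<eta>" "\<And>a b. set_integrable lborel (cbox a b) f" "f \<in> borel_measurable borel"
  shows "integrable lborel (\<lambda>x. f x * \<eta> x)"
proof -
  obtain B where B: "B > 0" "\<And>x. \<bar>\<eta> x\<bar> \<le> B" using test_function_bounded[OF assms(1)] by blast
  have "bounded {x. \<eta> x \<noteq> 0}" using assms(1) by (simp add: test_function_iff compact_closure)
  then obtain a where a: "{x. \<eta> x \<noteq> 0} \<subseteq> cbox (-a) a"
    using bounded_subset_cbox_symmetric by blast
  have "integrable lborel (\<lambda>x. B * (indicator (cbox (-a) a) x *\<^sub>R f x))"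
    using assms(2)[unfolded set_integrable_def] by (rule integrable_mult_right)
  then show ?thesis
  proof (rule Bochner_Integration.integrable_bound)
    show "AE x in lborel. norm (f x * \<eta> x) \<le> norm (B * indicator (cbox (- a) a) x *\<^sub>R f x)"
    proof (intro AE_I2)
      fix x
      show "norm (f x * \<eta> x) \<le> norm (B * indicator (cbox (- a) a) x *\<^sub>R f x)"
      proof (cases "\<eta> x = 0")
        case False
        then have "x \<in> cbox (-a) a" using a by auto
        then show ?thesis using B by (auto simp: abs_mult mult.commute intro: mult_right_mono)
      qed auto
    qed
  qed (use assms smooth_measurable in \<open>auto simp: test_function_iff\<close>)
qed

lemma test_function_integrable:
  assumes "test_function \<eta>" shows "integrable lborel \<eta>"
proof -
  have "set_integrable lborel (cbox a b) (\<lambda>_. 1::real)" for a b :: R3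
    unfolding set_integrable_def using emeasure_lborel_cbox_finite[of a b] by simp
  from test_function_integrable_mult[OF assms this] show ?thesis by simp
qed

text \<open>Each factor sees \<open>n\<close> times the signed distance to one face of the box. As
  \<open>bump 0\<close> tends to 1 at infinity and vanishes on the nonpositive half-line, the
  product increases to 1 inside the open box and stays 0 outside.\<close>

definition box_bump :: "R3 \<Rightarrow> R3 \<Rightarrow> nat \<Rightarrow> R3 \<Rightarrow> real" where
  "box_bump a b n x = (\<Prod>i\<in>UNIV. bump 0 (real n * (x $ i - a $ i)) * bump 0 (real n * (b $ i - x $ i)))"

lemma box_bump_le_1: "\<bar>box_bump a b n x\<bar> \<le> 1"
  unfolding box_bump_def abs_prod abs_mult
  by (intro prod_le_1) (auto intro!: mult_le_one simp: bump_def)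

lemma box_bump_outside: "x \<notin> box a b \<Longrightarrow> box_bump a b n x = 0"
proof -
  assume "x \<notin> box a b"
  then obtain i where "x $ i \<le> a $ i \<or> b $ i \<le> x $ i" by (auto simp: mem_box_cart not_less)
  then have "bump 0 (real n * (x $ i - a $ i)) * bump 0 (real n * (b $ i - x $ i)) = 0"
    by (auto simp: bump_def zero_less_mult_iff)
  then show ?thesis
    unfolding box_bump_def by (intro prod_zero) auto
qed

lemma test_function_box_bump: "test_function (box_bump a b n)"
proof (rule test_functionI)
  have "smooth (\<lambda>x. box_bump a b n x)"
    unfolding box_bump_def diff_conv_add_uminus
    by (intro smooth_prod smooth_mult smooth_bump smooth_add smooth_minus smooth_const smooth_coord)
  then show "smooth (box_bump a b n)" .
  show "bounded {x. box_bump a b n x \<noteq> 0}"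
    by (rule bounded_subset[OF bounded_box[of a b]]) (use box_bump_outside in blast)
qed

lemma bump_tendsto_1:
  assumes "filterlim f at_top F" shows "((\<lambda>n. bump 0 (f n)) \<longlongrightarrow> 1) F"
proof -
  have "((\<lambda>n. exp (- (1 / f n))) \<longlongrightarrow> exp (- 0)) F"
    by (intro tendsto_intros real_tendsto_divide_at_top[OF tendsto_const assms])
  moreover have "\<forall>\<^sub>F n in F. exp (- (1 / f n)) = bump 0 (f n)"
    using filterlim_at_top_dense[THEN iffD1, OF assms, rule_format, of 0]
    by eventually_elim (simp add: bump_def)
  ultimately show ?thesis
    using Lim_transform_eventually[of "\<lambda>n. exp (- (1 / f n))" "exp (- 0)" F "\<lambda>n. bump 0 (f n)"] by simp
qed

lemma box_bump_tendsto: "(\<lambda>n. box_bump a b n x) \<longlonglongrightarrow> indicator (box a b) x"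
proof (cases "x \<in> box a b")
  case True
  then have pos: "a $ i < x $ i" "x $ i < b $ i" for i by (auto simp: mem_box_cart)
  have lim: "(\<lambda>n. bump 0 (real n * c)) \<longlonglongrightarrow> 1" if "c > 0" for c
    using filterlim_tendsto_pos_mult_at_top[OF tendsto_const that filterlim_real_sequentially]
    by (intro bump_tendsto_1) (simp add: mult.commute)
  have "(\<lambda>n. box_bump a b n x) \<longlonglongrightarrow> (\<Prod>i\<in>(UNIV::3 set). 1 * 1)"
    unfolding box_bump_def
  proof (rule tendsto_prod)
    fix i :: 3
    show "(\<lambda>n. bump 0 (real n * (x $ i - a $ i)) * bump 0 (real n * (b $ i - x $ i))) \<longlonglongrightarrow> 1 * 1"
      by (rule tendsto_mult; rule lim) (simp_all add: pos)
  qed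
  with True show ?thesis by simp
next
  case False
  then show ?thesis by (simp add: box_bump_outside)
qed

lemma AE_if_AE_boxes:
  assumes "\<And>n. AE x in lborel. x \<in> box (- (\<chi> i. real n)) (\<chi> i. real n) \<longrightarrow> P (x :: R3)"
  shows "AE x in lborel. P x"
proof -
  from assms have "AE x in lborel. \<forall>n. x \<in> box (- (\<chi> i. real n)) (\<chi> i. real n) \<longrightarrow> P (x :: R3)"
    by (simp only: AE_all_countable) blast
  then show ?thesis
  proof eventually_elim
    case (elim x)
    obtain n where "norm x < real n" using reals_Archimedean2 by blast
    then have "\<bar>x $ i\<bar> < real n" for i
      using component_le_norm_cart[of x i] by linarith
    then have "x \<in> box (- (\<chi> i. real n)) (\<chi> i. real n)"
      unfolding mem_box_cart by (simp add: abs_less_iff minus_less_iff)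
    with elim show ?case by blast
  qed
qed

text \<open>The boxes generate the Borel sets, and the indicator of a box is a pointwise limit of test
  functions.\<close>

lemma AE_zero_if_test_integrals_zero:
  fixes h :: "R3 \<Rightarrow> real"
  assumes loc: "\<And>a b. set_integrable lborel (cbox a b) h"
    and meas [measurable]: "h \<in> borel_measurable borel"
    and zero: "\<And>\<eta>. test_function \<eta> \<Longrightarrow> (LINT x|lborel. h x * \<eta> x) = 0"
  shows "AE x in lborel. h x = 0"
proof -
  have box0: "(LINT x|lborel. h x * indicator (box a b) x) = 0" for a b
  proof -
    have "(\<lambda>n. LINT x|lborel. h x * box_bump a b n x) \<longlonglongrightarrow> (LINT x|lborel. h x * indicator (box a b) x)"
    proof (rule integral_dominated_convergence)
      show "integrable lborel (\<lambda>x. indicator (cbox a b) x *\<^sub>R norm (h x))"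
        using loc[of a b] unfolding set_integrable_def
        by (rule Bochner_Integration.integrable_bound) (auto simp: indicator_def)
      show "AE x in lborel. norm (h x * box_bump a b n x) \<le> indicator (cbox a b) x *\<^sub>R norm (h x)" for n
      proof (intro AE_I2)
        fix x
        show "norm (h x * box_bump a b n x) \<le> indicator (cbox a b) x *\<^sub>R norm (h x)"
          using box_bump_le_1[of a b n x] box_bump_outside[of x a b n] box_subset_cbox[of a b]
          by (cases "x \<in> box a b") (auto simp: abs_mult mult_left_le)
      qed
      show "AE x in lborel. (\<lambda>n. h x * box_bump a b n x) \<longlonglongrightarrow> h x * indicator (box a b) x"
        by (intro AE_I2 tendsto_mult tendsto_const box_bump_tendsto)
      show "(\<lambda>x. h x * box_bump a b n x) \<in> borel_measurable lborel" for n
        using smooth_measurable[of "box_bump a b n"] test_function_box_bump[of a b n]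
        by (auto simp: test_function_iff)
    qed simp
    then show ?thesis
      by (simp add: zero test_function_box_bump LIMSEQ_const_iff)
  qed
  \<comment> \<open>\<open>h\<close> is only locally integrable, whereas the complement step of the
    induction over Borel sets subtracts from the integral over the whole space. Restriction to the
    cube \<open>Q n\<close> makes that integral finite, and \<open>box0\<close> shows that it
    vanishes.\<close>
  define Q :: "nat \<Rightarrow> R3 set" where "Q n = box (- (\<chi> i. real n)) (\<chi> i. real n)" for n
  have Qi: "integrable lborel (\<lambda>x. h x * indicator (Q n) x)" for n
    using loc[of "- (\<chi> i. real n)" "\<chi> i. real n"] unfolding set_integrable_def
    by (rule Bochner_Integration.integrable_bound)
      (auto simp: indicator_def Q_def dest: subsetD[OF box_subset_cbox])
  have QB: "integrable lborel (\<lambda>x. h x * indicator (Q n) x * indicator B x)" if [measurable]: "B \<in> sets borel" for n B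
    using Qi[of n] by (rule Bochner_Integration.integrable_bound) (auto simp: indicator_def Q_def)
  have *: "(LINT x|lborel. h x * indicator (Q n) x * indicator B x) = 0" if "B \<in> sets borel" for n B
  proof -
    have B: "B \<in> sigma_sets UNIV (range (\<lambda>(a, b). box a b))"
      using that by (simp add: borel_eq_box)
    have G: "Int_stable (range (\<lambda>(a, b). box a b :: R3 set))" "range (\<lambda>(a, b). box a b :: R3 set) \<subseteq> Pow UNIV"
      by (force simp: Int_stable_def box_Int_box)+
    from G B show ?thesis
    proof (induction rule: sigma_sets_induct_disjoint)
      case (basic A)
      then obtain a b where A: "A = box a b" by auto
      obtain c d where "Q n \<inter> A = box c d" unfolding A Q_def box_Int_box by blast
      then show ?case
        using box0[of c d] by (simp add: mult.assoc flip: indicator_inter_arith)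
    next
      case (compl A)
      then have A[measurable]: "A \<in> sets borel" by (simp add: borel_eq_box)
      have "(LINT x|lborel. h x * indicator (Q n) x * indicator (UNIV - A) x) =
        (LINT x|lborel. h x * indicator (Q n) x - h x * indicator (Q n) x * indicator A x)"
        by (intro Bochner_Integration.integral_cong) (auto simp: indicator_def)
      also have "\<dots> = (LINT x|lborel. h x * indicator (Q n) x) - (LINT x|lborel. h x * indicator (Q n) x * indicator A x)"
        by (intro Bochner_Integration.integral_diff Qi QB A)
      finally show ?case using box0 compl by (simp add: Q_def)
    next
      case (union A)
      then have A[measurable]: "A i \<in> sets borel" for i by (auto simp: borel_eq_box)
      let ?f = "\<lambda>x. h x * indicator (Q n) x"
      have "(LINT x:(\<Union>i. A i)|lborel. ?f x) = (\<Sum>i. (LINT x:(A i)|lborel. ?f x))"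
        by (rule lebesgue_integral_countable_add)
          (use union QB[of "\<Union>i. A i" n] in \<open>auto simp: disjoint_family_on_def set_integrable_def mult.commute\<close>)
      then show ?case using union by (simp add: set_lebesgue_integral_def mult.commute)
    qed simp
  qed
  have "AE x in lborel. x \<in> Q n \<longrightarrow> h x = 0" for n
  proof -
    \<comment> \<open>The Borel sets where \<open>h\<close> is positive and where it is negative
      recover the integral of \<open>\<bar>h\<bar>\<close> over the cube.\<close>
    have "(LINT x|lborel. \<bar>h x\<bar> * indicator (Q n) x) =
      (LINT x|lborel. h x * indicator (Q n) x * indicator {x. h x > 0} x - h x * indicator (Q n) x * indicator {x. h x < 0} x)"
      by (intro Bochner_Integration.integral_cong) (auto simp: indicator_def)
    also have "\<dots> = (LINT x|lborel. h x * indicator (Q n) x * indicator {x. h x > 0} x) -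
       (LINT x|lborel. h x * indicator (Q n) x * indicator {x. h x < 0} x)"
      by (intro Bochner_Integration.integral_diff QB) auto
    also have "\<dots> = 0" by (subst (1 2) *) auto
    finally have "AE x in lborel. \<bar>h x\<bar> * indicator (Q n) x = 0"
      by (subst (asm) integral_nonneg_eq_0_iff_AE)
        (use integrable_norm[OF Qi[of n]] in \<open>auto simp: abs_mult\<close>)
    then show ?thesis by eventually_elim (auto simp: indicator_def)
  qed
  then show ?thesis unfolding Q_def by (rule AE_if_AE_boxes)
qed

section \<open>Weak gradients\<close>

lemma lborel_nn_integral_shift:
  fixes f :: "'a::euclidean_space \<Rightarrow> ennreal"
  assumes [measurable]: "f \<in> borel_measurable borel"
  shows "(\<integral>\<^sup>+x. f (c + x) \<partial>lborel) = (\<integral>\<^sup>+x. f x \<partial>lborel)"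
  by (subst (2) lborel_distr_plus[of c, symmetric]) (simp add: nn_integral_distr)

lemma lborel_nn_integral_reflect:
  fixes f :: "'a::euclidean_space \<Rightarrow> ennreal"
  assumes [measurable]: "f \<in> borel_measurable borel"
  shows "(\<integral>\<^sup>+x. f (c - x) \<partial>lborel) = (\<integral>\<^sup>+x. f x \<partial>lborel)"
  by (subst (2) lborel_affine[of "-1" c]) (simp_all add: nn_integral_distr nn_integral_density)

lemma lborel_integral_shift:
  fixes f :: "'a::euclidean_space \<Rightarrow> real"
  assumes [measurable]: "f \<in> borel_measurable borel"
  shows "(LINT x|lborel. f (c + x)) = (LINT x|lborel. f x)"
  by (subst (2) lborel_distr_plus[of c, symmetric]) (simp add: integral_distr)

lemma lborel_integrable_shift:
  fixes f :: "'a::euclidean_space \<Rightarrow> real"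
  assumes "integrable lborel f"
  shows "integrable lborel (\<lambda>x. f (c + x))"
proof -
  have [measurable]: "f \<in> borel_measurable borel" using borel_measurable_integrable[OF assms] by simp
  show ?thesis using assms by (subst (asm) lborel_distr_plus[of c, symmetric]) (simp add: integrable_distr_eq)
qed

lemma lborel_integral_affine:
  fixes f :: "'a::euclidean_space \<Rightarrow> real"
  assumes [measurable]: "f \<in> borel_measurable borel" and c: "c \<noteq> 0"
  shows "(LINT x|lborel. f x) = \<bar>c\<bar> ^ DIM('a) * (LINT x|lborel. f (t + c *\<^sub>R x))"
  by (subst lborel_affine[OF c, of t]) (simp add: integral_density integral_distr)

lemma has_derivative_line:
  assumes "f differentiable (at (x + s *\<^sub>R axis i 1))"
  shows "((\<lambda>s. f (x + s *\<^sub>R axis i (1::real))) has_real_derivative pdiff i f (x + s *\<^sub>R axis i 1)) (at s)"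
proof -
  let ?D = "frechet_derivative f (at (x + s *\<^sub>R axis i 1))"
  have lin: "linear ?D"
    using assms by (rule linear_frechet_derivative)
  have "((\<lambda>s. x + s *\<^sub>R axis i (1::real)) has_derivative (\<lambda>h. h *\<^sub>R axis i 1)) (at s)"
    by (auto intro!: derivative_eq_intros)
  from has_derivative_compose[OF this assms[unfolded frechet_derivative_works]]
  have "((\<lambda>s. f (x + s *\<^sub>R axis i (1::real))) has_derivative (\<lambda>h. ?D (h *\<^sub>R axis i 1))) (at s)" .
  moreover have "(\<lambda>h. ?D (h *\<^sub>R axis i 1)) = (*) (pdiff i f (x + s *\<^sub>R axis i 1))"
    by (auto simp: pdiff_def linear_scale[OF lin] mult.commute)
  ultimately show ?thesis by (simp add: has_field_derivative_def)
qed

text \<open>By translation invariance the integral of every difference quotient vanishes.\<close>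

lemma integral_pdiff_test_function:
  assumes "test_function \<eta>" shows "(LINT x|lborel. pdiff i \<eta> x) = 0"
proof -
  let ?e = "axis i (1::real) :: R3"
  have sm: "smooth \<eta>" using assms by (simp add: test_function_iff)
  note [measurable] = smooth_measurable[OF sm] smooth_measurable[OF smooth_pdiff[OF sm]]
  obtain B where B: "B > 0" "\<And>x. \<bar>pdiff i \<eta> x\<bar> \<le> B"
    using test_function_bounded[OF test_function_pdiff[OF assms]] by blast
  obtain R where R: "R > 0" "\<And>x. norm x > R \<Longrightarrow> \<eta> x = 0"
    using test_function_support[OF assms] by blast
  define t where "t n = inverse (real (Suc n))" for n
  have t: "0 < t n" "t n \<le> 1" for n
    unfolding t_def by (auto simp: field_simps)
  have t0: "t \<longlonglongrightarrow> 0" unfolding t_def by (rule LIMSEQ_inverse_real_of_nat)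
  define q where "q n x = (\<eta> (x + t n *\<^sub>R ?e) - \<eta> x) / t n" for n x
  note line = has_derivative_line[OF smooth_differentiable[OF sm]]
  have "(\<lambda>n. LINT x|lborel. q n x) \<longlonglongrightarrow> (LINT x|lborel. pdiff i \<eta> x)"
  proof (rule integral_dominated_convergence)
    \<comment> \<open>The mean value theorem bounds every difference quotient by \<open>B\<close>;
      the radius is \<open>R + 1\<close> because the steps \<open>t n\<close> are at most 1.\<close>
    show "integrable lborel (\<lambda>x::R3. B * indicator (cball 0 (R + 1)) x)"
      using emeasure_lborel_cball_finite by (intro integrable_mult_right integrable_real_indicator) auto
    show "AE x in lborel. norm (q n x) \<le> B * indicator (cball 0 (R + 1)) x" for n
    proof (intro AE_I2)
      fix x
      have 1: "\<bar>q n x\<bar> \<le> B"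
      proof -
        obtain z where "\<eta> (x + t n *\<^sub>R ?e) - \<eta> (x + 0 *\<^sub>R ?e) = (t n - 0) * pdiff i \<eta> (x + z *\<^sub>R ?e)"
          using MVT2[where f = "\<lambda>s. \<eta> (x + s *\<^sub>R ?e)" and f' = "\<lambda>s. pdiff i \<eta> (x + s *\<^sub>R ?e)", OF t(1)[of n]] line by blast
        then have "q n x = pdiff i \<eta> (x + z *\<^sub>R ?e)" using t[of n] by (simp add: q_def)
        then show ?thesis using B by simp
      qed
      have 2: "q n x = 0" if "norm x > R + 1"
      proof -
        have "norm x \<le> norm (x + t n *\<^sub>R ?e) + norm (t n *\<^sub>R ?e)"
          by (metis add_diff_cancel_right' norm_triangle_ineq4)
        then have "norm (x + t n *\<^sub>R ?e) > R" using that t[of n] by (simp add: norm_axis_1)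
        then show ?thesis using R that by (simp add: q_def)
      qed
      show "norm (q n x) \<le> B * indicator (cball 0 (R + 1)) x"
        using 1 2 by (cases "norm x > R + 1") (auto simp: indicator_def)
    qed
    show "AE x in lborel. (\<lambda>n. q n x) \<longlonglongrightarrow> pdiff i \<eta> x"
    proof (intro AE_I2)
      fix x
      have "filterlim t (at 0) sequentially"
        using t0 t by (auto simp: filterlim_at less_le)
      with line[where x = x and s = 0 and i = i]
      have "((\<lambda>n. (\<eta> (x + (0 + t n) *\<^sub>R ?e) - \<eta> (x + 0 *\<^sub>R ?e)) / t n) \<longlongrightarrow> pdiff i \<eta> (x + 0 *\<^sub>R ?e)) sequentially"
        unfolding DERIV_def by (rule filterlim_compose)
      then show "(\<lambda>n. q n x) \<longlonglongrightarrow> pdiff i \<eta> x" by (simp add: q_def)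
    qed
  qed (simp_all add: q_def)
  moreover have "(LINT x|lborel. q n x) = 0" for n
  proof -
    note i = test_function_integrable[OF assms]
    have "(LINT x|lborel. q n x) = ((LINT x|lborel. \<eta> (t n *\<^sub>R ?e + x)) - (LINT x|lborel. \<eta> x)) / t n"
      unfolding q_def
      by (subst Bochner_Integration.integral_diff[symmetric, OF lborel_integrable_shift[OF i] i]) (simp add: add.commute)
    then show ?thesis by (simp add: lborel_integral_shift)
  qed
  ultimately show ?thesis by (simp add: LIMSEQ_const_iff)
qed

section \<open>Square integrable functions and uniqueness of weak gradients\<close>

lemma set_integrable_square:
  fixes f :: "'a::euclidean_space \<Rightarrow> real"
  assumes [measurable]: "f \<in> borel_measurable borel" and "integrable lborel (\<lambda>x. (f x)\<^sup>2)"
  shows "set_integrable lborel (cbox a b) f"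
  unfolding set_integrable_def
proof (rule Bochner_Integration.integrable_bound)
  show "integrable lborel (\<lambda>x. indicator (cbox a b) x + (f x)\<^sup>2 :: real)"
    using assms emeasure_lborel_cbox_finite by (intro Bochner_Integration.integrable_add integrable_real_indicator) auto
  have *: "\<bar>y\<bar> \<le> 1 + y\<^sup>2" for y :: real
    using sum_squares_bound[of 1 "\<bar>y\<bar>"] zero_le_power2[of y] by auto
  show "AE x in lborel. norm (indicator (cbox a b) x *\<^sub>R f x) \<le> norm (indicator (cbox a b) x + (f x)\<^sup>2)"
    using * by (auto simp: indicator_def abs_of_nonneg)
qed simp

lemma abs_mult_le_squares: "\<bar>a * b\<bar> \<le> a\<^sup>2 + b\<^sup>2" for a b :: real
  using sum_squares_bound[of "\<bar>a\<bar>" "\<bar>b\<bar>"] zero_le_mult_iff[of "\<bar>a\<bar>" "\<bar>b\<bar>"]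
  unfolding abs_mult mult.assoc power2_abs by linarith

lemma integrable_mult_square:
  fixes f g :: "'a \<Rightarrow> real"
  assumes [measurable]: "f \<in> borel_measurable M" "g \<in> borel_measurable M"
    and "integrable M (\<lambda>x. (f x)\<^sup>2)" "integrable M (\<lambda>x. (g x)\<^sup>2)"
  shows "integrable M (\<lambda>x. f x * g x)"
proof (rule Bochner_Integration.integrable_bound)
  show "integrable M (\<lambda>x. (f x)\<^sup>2 + (g x)\<^sup>2)" using assms by auto
  show "AE x in M. norm (f x * g x) \<le> norm ((f x)\<^sup>2 + (g x)\<^sup>2)"
    using abs_mult_le_squares by (auto simp: abs_of_nonneg)
qed simp

lemma weak_gradientD:
  assumes "weak_gradient u g" "test_function \<eta>"
  shows "(LINT x|lborel. u x * pdiff i \<eta> x) = - (LINT x|lborel. g x $ i * \<eta> x)"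
  using assms by (simp add: weak_gradient_def)

lemma weak_gradient_component:
  assumes "weak_gradient u g"
  shows "(\<lambda>x. g x $ i) \<in> borel_measurable borel" "integrable lborel (\<lambda>x. (g x $ i)\<^sup>2)"
proof -
  have [measurable]: "g \<in> borel_measurable borel" using assms by (simp add: weak_gradient_def)
  show [measurable]: "(\<lambda>x. g x $ i) \<in> borel_measurable borel"
    by (rule measurable_compose[OF _ borel_measurable_continuous_onI]) (auto intro: continuous_intros)
  show "integrable lborel (\<lambda>x. (g x $ i)\<^sup>2)"
    by (rule Bochner_Integration.integrable_bound[of _ "\<lambda>x. (norm (g x))\<^sup>2"])
      (use assms in \<open>auto simp: weak_gradient_def abs_le_square_iff[symmetric] component_le_norm_cart\<close>)
qed

text \<open>\<open>grad\<close> is a mere choice, so it cannot be evaluated before any two weak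
  gradients are known to agree almost everywhere. This is what identifies it with the classical
  gradient of the Yukawa kernels.\<close>

lemma weak_gradient_unique:
  assumes g: "weak_gradient u g" and g': "weak_gradient u g'"
  shows "AE x in lborel. g x = g' x"
proof -
  have "AE x in lborel. g x $ i - g' x $ i = 0" for i
  proof (rule AE_zero_if_test_integrals_zero)
    note [measurable] = weak_gradient_component(1)[OF g, of i] weak_gradient_component(1)[OF g', of i]
    note s = set_integrable_square[OF weak_gradient_component[OF g, of i]]
      set_integrable_square[OF weak_gradient_component[OF g', of i]]
    show "set_integrable lborel (cbox a b) (\<lambda>x. g x $ i - g' x $ i)" for a b
      using s by (rule set_integral_diff)
    show "(LINT x|lborel. (g x $ i - g' x $ i) * \<eta> x) = 0" if "test_function \<eta>" for \<eta>
    proof -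
      have "(LINT x|lborel. (g x $ i - g' x $ i) * \<eta> x) = (LINT x|lborel. g x $ i * \<eta> x) - (LINT x|lborel. g' x $ i * \<eta> x)"
        unfolding left_diff_distrib
        by (intro Bochner_Integration.integral_diff test_function_integrable_mult[OF that] s) simp_all
      moreover have "(LINT x|lborel. g x $ i * \<eta> x) = (LINT x|lborel. g' x $ i * \<eta> x)"
        using weak_gradientD[OF g that, of i] weak_gradientD[OF g' that, of i] by simp
      ultimately show ?thesis by simp
    qed
  qed (intro borel_measurable_diff weak_gradient_component(1)[OF g] weak_gradient_component(1)[OF g'])
  then have "AE x in lborel. \<forall>i\<in>(UNIV::3 set). g x $ i - g' x $ i = 0"
    by (intro AE_finite_allI) auto
  then show ?thesis by eventually_elim (simp add: vec_eq_iff)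
qed

lemma weak_gradient_grad: "u \<in> H1 \<Longrightarrow> weak_gradient u (grad u)"
  unfolding grad_def H1_def using someI_ex[of "weak_gradient u"] by blast

lemma smooth_H1:
  assumes "smooth f" "integrable lborel (\<lambda>x. (f x)\<^sup>2)" "\<And>i. integrable lborel (\<lambda>x. (pdiff i f x)\<^sup>2)"
  shows "weak_gradient f (\<lambda>x. \<chi> i. pdiff i f x)" "f \<in> H1"
    "AE x in lborel. grad f x = (\<chi> i. pdiff i f x)"
proof -
  note [measurable] = smooth_measurable[OF assms(1)] smooth_measurable[OF smooth_pdiff[OF assms(1)]]
  show *: "weak_gradient f (\<lambda>x. \<chi> i. pdiff i f x)"
    unfolding weak_gradient_def
  proof (intro conjI allI impI)
    have "(\<lambda>x. \<chi> i. pdiff i f x) = (\<lambda>x. \<Sum>i\<in>UNIV. pdiff i f x *\<^sub>R axis i 1)"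
      by (auto simp: fun_eq_iff vec_eq_iff axis_def if_distrib cong: if_cong)
    moreover have "(\<lambda>x. \<Sum>i\<in>UNIV. pdiff i f x *\<^sub>R axis i (1::real)) \<in> borel_measurable lborel"
      by (intro borel_measurable_sum borel_measurable_scaleR) simp_all
    ultimately show "(\<lambda>x. \<chi> i. pdiff i f x) \<in> borel_measurable lborel" by simp
    show "integrable lborel (\<lambda>x. (norm (\<chi> i. pdiff i f x))\<^sup>2)"
      using assms(3) unfolding power2_norm_eq_inner inner_vec_def
      by (auto intro!: Bochner_Integration.integrable_sum simp: power2_eq_square)
    fix \<eta> i assume \<eta>: "test_function \<eta>"
    have t: "test_function (\<lambda>x. f x * pdiff i \<eta> x)" "test_function (\<lambda>x. pdiff i f x * \<eta> x)"
      by (rule test_function_mult[OF test_function_pdiff[OF \<eta>] assms(1)],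
          rule test_function_mult[OF \<eta> smooth_pdiff[OF assms(1)]])
    have "0 = (LINT x|lborel. pdiff i (\<lambda>x. f x * \<eta> x) x)"
      using integral_pdiff_test_function[OF test_function_mult[OF \<eta> assms(1)]] by simp
    also have "\<dots> = (LINT x|lborel. f x * pdiff i \<eta> x + pdiff i f x * \<eta> x)"
      using \<eta> assms(1) by (intro Bochner_Integration.integral_cong refl pdiff_mult smooth_differentiable)
        (simp_all add: test_function_iff)
    also have "\<dots> = (LINT x|lborel. f x * pdiff i \<eta> x) + (LINT x|lborel. pdiff i f x * \<eta> x)"
      by (intro Bochner_Integration.integral_add test_function_integrable t)
    finally show "(LINT x|lborel. f x * pdiff i \<eta> x) = - (LINT x|lborel. (\<chi> i. pdiff i f x) $ i * \<eta> x)"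
      by simp
  qed
  then show H: "f \<in> H1" using assms(2) unfolding H1_def mem_Collect_eq by (intro conjI exI) simp_all
  show "AE x in lborel. grad f x = (\<chi> i. pdiff i f x)"
    by (rule weak_gradient_unique[OF weak_gradient_grad[OF H] *])
qed

text \<open>The argument is \<open>R - (norm x)\<^sup>2 / R\<close>: positive exactly inside the
  ball of radius \<open>R\<close>, tending to infinity with \<open>R\<close> for fixed
  \<open>x\<close>, and with a gradient of size \<open>2 * norm x / R\<close>, which stays bounded
  on that ball and tends to 0 pointwise. The square is written in coordinates so that the closure
  rules for \<open>smooth\<close> apply.\<close>

definition cutoff :: "real \<Rightarrow> R3 \<Rightarrow> real" where
  "cutoff R x = bump 0 (R + (- 1 / R) * (\<Sum>i\<in>UNIV. x $ i * x $ i))"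

lemma smooth_square_sum: "smooth (\<lambda>x. \<Sum>i\<in>UNIV. x $ i * x $ i)"
  by (intro smooth_sum smooth_mult smooth_coord)

lemma pdiff_square_sum: "pdiff i (\<lambda>x. \<Sum>i\<in>UNIV. x $ i * x $ i) x = 2 * x $ i"
proof -
  have "((\<lambda>x::R3. x \<bullet> x) has_derivative (\<lambda>h. x \<bullet> h + h \<bullet> x)) (at x)"
    by (rule has_derivative_inner; rule has_derivative_ident)
  from pdiff_eqI[OF this, of i] have "pdiff i (\<lambda>x. x \<bullet> x) x = 2 * x $ i"
    by (simp add: inner_axis inner_commute)
  then show ?thesis by (simp add: inner_vec_def)
qed

lemma square_sum_norm: "(\<Sum>i\<in>UNIV. x $ i * x $ i) = (norm (x::R3))\<^sup>2"
  by (simp add: power2_norm_eq_inner inner_vec_def)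

context
  fixes R :: real
  assumes R: "R > 0"
begin

lemma cutoff_arg_nonpos: assumes "norm (x::R3) > R" shows "R + (- 1 / R) * (\<Sum>i\<in>UNIV. x $ i * x $ i) \<le> 0"
proof -
  have "R * R < norm x * norm x" using assms R by (intro mult_strict_mono) auto
  then have "R < norm x * norm x / R" using R by (simp add: pos_less_divide_eq)
  then show ?thesis unfolding square_sum_norm by (simp add: power2_eq_square)
qed

lemma smooth_cutoff: "smooth (cutoff R)"
  unfolding cutoff_def[abs_def]
  by (intro smooth_bump smooth_add smooth_mult smooth_const smooth_square_sum)

lemma test_function_cutoff: "test_function (cutoff R)"
proof (rule test_functionI[OF smooth_cutoff])
  have "norm x \<le> R" if "cutoff R x \<noteq> 0" for x
  proof (rule ccontr)
    assume "\<not> norm x \<le> R"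
    then have "cutoff R x = 0" using cutoff_arg_nonpos[of x] unfolding cutoff_def bump_def by simp
    with that show False by simp
  qed
  then show "bounded {x. cutoff R x \<noteq> 0}"
    by (intro boundedI[of _ R]) blast
qed

lemma pdiff_cutoff: "pdiff i (cutoff R) x = bump 2 (R + (- 1 / R) * (\<Sum>i\<in>UNIV. x $ i * x $ i)) * ((- 1 / R) * (2 * x $ i))"
proof -
  let ?s = "\<lambda>x. R + (- 1 / R) * (\<Sum>i\<in>UNIV. x $ i * x $ i)"
  have d: "smooth (\<lambda>x. (- 1 / R) * (\<Sum>i\<in>UNIV. x $ i * x $ i))"
    by (intro smooth_mult smooth_const smooth_square_sum)
  have "pdiff i ?s x = (- 1 / R) * (2 * x $ i)"
    by (subst pdiff_add[OF smooth_differentiable smooth_differentiable, OF smooth_const d],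
       subst pdiff_mult[OF smooth_differentiable smooth_differentiable, OF smooth_const smooth_square_sum])
      (simp add: pdiff_square_sum)
  moreover have "pdiff i (cutoff R) x = bump 2 (?s x) * pdiff i ?s x"
    using pdiff_bump(1)[OF smooth_differentiable[OF smooth_add[OF smooth_const d]], of i 0 R x]
    by (simp add: cutoff_def[abs_def] numeral_2_eq_2)
  ultimately show ?thesis by simp
qed

lemma pdiff_cutoff_le: "\<bar>pdiff i (cutoff R) x\<bar> \<le> 4 * norm x / R" "\<bar>pdiff i (cutoff R) x\<bar> \<le> 4"
proof -
  let ?s = "R + (- 1 / R) * (\<Sum>i\<in>UNIV. x $ i * x $ i)"
  \<comment> \<open>The bound is \<open>fact 2\<close>, from \<open>bump_bound\<close> with no power
    to spare; together with the factor 2 of the squared coordinate it produces the constant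
    4.\<close>
  have b: "bump 2 ?s \<le> 2"
    using bump_bound[of ?s 2 0] by (cases "?s > 0") (auto simp: bump_def fact_numeral)
  have "\<bar>pdiff i (cutoff R) x\<bar> = bump 2 ?s * ((2 / R) * \<bar>x $ i\<bar>)"
    using R by (simp add: pdiff_cutoff abs_mult)
  also have "\<dots> \<le> 2 * ((2 / R) * norm x)"
    using b R component_le_norm_cart[of x i] by (intro mult_mono mult_left_mono) auto
  finally show 1: "\<bar>pdiff i (cutoff R) x\<bar> \<le> 4 * norm x / R" by simp
  show "\<bar>pdiff i (cutoff R) x\<bar> \<le> 4"
  proof (cases "norm x > R")
    case True
    from cutoff_arg_nonpos[OF True] have "bump 2 ?s = 0" by (simp add: bump_def)
    then show ?thesis by (simp add: pdiff_cutoff)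
  next
    case False
    then have "4 * norm x / R \<le> 4" using R by (simp add: field_simps)
    with 1 show ?thesis by linarith
  qed
qed

end

lemma cutoff_le_1: "\<bar>cutoff R x\<bar> \<le> 1"
  by (auto simp: cutoff_def bump_def)

lemma cutoff_tendsto: "(\<lambda>n. cutoff (real (Suc n)) x) \<longlonglongrightarrow> 1"
proof -
  have "filterlim (\<lambda>n. real (Suc n)) at_top sequentially"
    using filterlim_real_sequentially by (rule filterlim_sequentially_Suc[THEN iffD2])
  moreover have "(\<lambda>n. (- 1 / real (Suc n)) * (\<Sum>i\<in>UNIV. x $ i * x $ i)) \<longlonglongrightarrow> 0 * (\<Sum>i\<in>UNIV. x $ i * x $ i)"
    by (rule tendsto_mult[OF real_tendsto_divide_at_top[OF tendsto_const calculation] tendsto_const])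
  ultimately have "filterlim (\<lambda>n. real (Suc n) + (- 1 / real (Suc n)) * (\<Sum>i\<in>UNIV. x $ i * x $ i)) at_top sequentially"
    by (subst add.commute) (rule filterlim_tendsto_add_at_top)
  from bump_tendsto_1[OF this] show ?thesis by (simp only: cutoff_def)
qed

lemma pdiff_cutoff_tendsto: "(\<lambda>n. pdiff i (cutoff (real (Suc n))) x) \<longlonglongrightarrow> 0"
proof (rule Lim_null_comparison)
  show "\<forall>\<^sub>F n in sequentially. norm (pdiff i (cutoff (real (Suc n))) x) \<le> (4 * norm x) * inverse (real (Suc n))"
    using pdiff_cutoff_le(1)[of "real (Suc n)" i x for n]
    by (intro always_eventually allI) (simp add: divide_inverse del: of_nat_Suc)
  have "(\<lambda>n. (4 * norm x) * inverse (real (Suc n))) \<longlonglongrightarrow> (4 * norm x) * 0"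
    by (intro tendsto_mult tendsto_const LIMSEQ_inverse_real_of_nat)
  then show "(\<lambda>n. (4 * norm x) * inverse (real (Suc n))) \<longlonglongrightarrow> 0" by simp
qed

text \<open>The defining identity is applied to \<open>f\<close> times a cutoff. The term in which
  the cutoff is differentiated is dominated by \<open>4 * \<bar>u x * f x\<bar>\<close> and tends to
  0, so compact support may be replaced by integrability of the three products.\<close>

lemma weak_gradient_smooth:
  assumes g: "weak_gradient u g" and "u \<in> borel_measurable borel" and f: "smooth f"
    and int: "integrable lborel (\<lambda>x. u x * f x)" "integrable lborel (\<lambda>x. u x * pdiff i f x)"
      "integrable lborel (\<lambda>x. g x $ i * f x)"
  shows "(LINT x|lborel. u x * pdiff i f x) = - (LINT x|lborel. g x $ i * f x)"
proof -
  note [measurable] = assms(2) smooth_measurable[OF f] smooth_measurable[OF smooth_pdiff[OF f]]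
    weak_gradient_component(1)[OF g]
  have cs: "smooth (cutoff (real (Suc n)))" for n using smooth_cutoff[of "real (Suc n)"] by simp
  note [measurable] = smooth_measurable[OF cs] smooth_measurable[OF smooth_pdiff[OF cs]]
  have eq: "(LINT x|lborel. u x * (f x * pdiff i (cutoff (real (Suc n))) x + pdiff i f x * cutoff (real (Suc n)) x)) =
    - (LINT x|lborel. g x $ i * (f x * cutoff (real (Suc n)) x))" for n
  proof -
    have "pdiff i (\<lambda>x. f x * cutoff (real (Suc n)) x) = (\<lambda>x. f x * pdiff i (cutoff (real (Suc n))) x + pdiff i f x * cutoff (real (Suc n)) x)"
      by (rule ext) (intro pdiff_mult smooth_differentiable f cs)
    then show ?thesis
      using weak_gradientD[OF g test_function_mult[OF test_function_cutoff f, of "real (Suc n)"], of i] by (simp del: of_nat_Suc)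
  qed
  have A: "(\<lambda>n. LINT x|lborel. u x * (f x * pdiff i (cutoff (real (Suc n))) x + pdiff i f x * cutoff (real (Suc n)) x)) \<longlonglongrightarrow>
    (LINT x|lborel. u x * (f x * 0 + pdiff i f x * 1))"
  proof (rule integral_dominated_convergence)
    show "integrable lborel (\<lambda>x. 4 * \<bar>u x * f x\<bar> + \<bar>u x * pdiff i f x\<bar>)"
      using int by auto
    show "AE x in lborel. (\<lambda>n. u x * (f x * pdiff i (cutoff (real (Suc n))) x + pdiff i f x * cutoff (real (Suc n)) x)) \<longlonglongrightarrow> u x * (f x * 0 + pdiff i f x * 1)"
      by (intro AE_I2 tendsto_intros cutoff_tendsto pdiff_cutoff_tendsto)
    show "AE x in lborel. norm (u x * (f x * pdiff i (cutoff (real (Suc n))) x + pdiff i f x * cutoff (real (Suc n)) x)) \<le> 4 * \<bar>u x * f x\<bar> + \<bar>u x * pdiff i f x\<bar>" for n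
    proof (intro AE_I2)
      fix x
      have "\<bar>u x * f x\<bar> * \<bar>pdiff i (cutoff (real (Suc n))) x\<bar> \<le> \<bar>u x * f x\<bar> * 4"
        "\<bar>u x * pdiff i f x\<bar> * \<bar>cutoff (real (Suc n)) x\<bar> \<le> \<bar>u x * pdiff i f x\<bar> * 1"
        by (intro mult_left_mono cutoff_le_1 pdiff_cutoff_le(2); simp)+
      moreover have "norm (u x * (f x * pdiff i (cutoff (real (Suc n))) x + pdiff i f x * cutoff (real (Suc n)) x)) \<le>
        \<bar>u x * f x\<bar> * \<bar>pdiff i (cutoff (real (Suc n))) x\<bar> + \<bar>u x * pdiff i f x\<bar> * \<bar>cutoff (real (Suc n)) x\<bar>"
        using abs_triangle_ineq[of "u x * f x * pdiff i (cutoff (real (Suc n))) x" "u x * pdiff i f x * cutoff (real (Suc n)) x"]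
        unfolding distrib_left mult.assoc[symmetric] real_norm_def abs_mult .
      ultimately show "norm (u x * (f x * pdiff i (cutoff (real (Suc n))) x + pdiff i f x * cutoff (real (Suc n)) x)) \<le> 4 * \<bar>u x * f x\<bar> + \<bar>u x * pdiff i f x\<bar>"
        by linarith
    qed
  qed (simp_all del: of_nat_Suc)
  have B: "(\<lambda>n. LINT x|lborel. g x $ i * (f x * cutoff (real (Suc n)) x)) \<longlonglongrightarrow> (LINT x|lborel. g x $ i * (f x * 1))"
  proof (rule integral_dominated_convergence)
    show "integrable lborel (\<lambda>x. \<bar>g x $ i * f x\<bar>)" using int by auto
    show "AE x in lborel. (\<lambda>n. g x $ i * (f x * cutoff (real (Suc n)) x)) \<longlonglongrightarrow> g x $ i * (f x * 1)"
      by (intro AE_I2 tendsto_intros cutoff_tendsto pdiff_cutoff_tendsto)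
    show "AE x in lborel. norm (g x $ i * (f x * cutoff (real (Suc n)) x)) \<le> \<bar>g x $ i * f x\<bar>" for n
      by (intro AE_I2) (simp add: abs_mult mult.assoc[symmetric] mult_left_le cutoff_le_1)
  qed (simp_all del: of_nat_Suc)
  show ?thesis
    using LIMSEQ_unique[OF A[unfolded eq] tendsto_minus[OF B]] by simp
qed

section \<open>Integrals of radial functions\<close>

lemma ball_borel [measurable]: "ball a r \<in> sets borel" "cball a r \<in> sets borel" for a :: "'a::metric_space"
  by simp_all

lemma ennreal_suminf_ge: "f k \<le> (\<Sum>k. f k)" for f :: "nat \<Rightarrow> ennreal"
  using sum_le_suminf[OF summableI, of "{k}" f] by simp

lemma ex_dyadic:
  fixes y :: real assumes "1 \<le> y" obtains k where "2 ^ k \<le> y" "y < 2 ^ Suc k"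
proof -
  define k where "k = nat \<lfloor>log 2 y\<rfloor>"
  have "0 \<le> log 2 y" using assms by simp
  then have k: "real k \<le> log 2 y" "log 2 y < real (Suc k)" unfolding k_def by linarith+
  have "2 powr real k \<le> y" "y < 2 powr real (Suc k)"
    using k assms by (simp_all add: le_log_iff log_less_iff)
  then show thesis by (intro that[of k]) (simp_all add: powr_realpow del: of_nat_Suc)
qed

text \<open>Only the scaling of ball volumes with the cube of the radius is used in place of polar
  coordinates: the integrals over balls of dyadic radii form a geometric series of ratio
  \<open>x\<close>.\<close>

lemma nn_integral_dyadic:
  fixes f :: "R3 \<Rightarrow> ennreal"
  assumes f: "\<And>z. f z \<le> (\<Sum>k. ennreal (a k) * indicator (cball 0 (r k)) z)"
    and ar: "\<And>k. 0 \<le> a k" "\<And>k. 0 \<le> r k" "\<And>k. a k * r k ^ 3 = D * x ^ k"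
    and x: "0 \<le> x" "x < 1"
  shows "(\<integral>\<^sup>+z. f z \<partial>lborel) \<le> ennreal (unit_ball_vol 3 * (D / (1 - x)))"
proof -
  have "(\<lambda>k. unit_ball_vol 3 * (D * x ^ k)) sums (unit_ball_vol 3 * (D * (1 / (1 - x))))"
    using x by (intro sums_mult geometric_sums) auto
  then have s: "(\<lambda>k. unit_ball_vol 3 * (D * x ^ k)) sums (unit_ball_vol 3 * (D / (1 - x)))"
    by simp
  have D: "0 \<le> D * x ^ k" for k using ar by (metis mult_nonneg_nonneg zero_le_power)
  have "(\<integral>\<^sup>+z. f z \<partial>lborel) \<le> (\<integral>\<^sup>+z. (\<Sum>k. ennreal (a k) * indicator (cball (0::R3) (r k)) z) \<partial>lborel)"
    by (intro nn_integral_mono f)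
  also have "\<dots> = (\<Sum>k. \<integral>\<^sup>+z. ennreal (a k) * indicator (cball (0::R3) (r k)) z \<partial>lborel)"
    by (intro nn_integral_suminf borel_measurable_times_ennreal borel_measurable_const borel_measurable_indicator) auto
  also have "\<dots> = (\<Sum>k. ennreal (unit_ball_vol 3 * (D * x ^ k)))"
  proof (rule suminf_cong)
    fix k
    have "(\<integral>\<^sup>+z. ennreal (a k) * indicator (cball (0::R3) (r k)) z \<partial>lborel) = ennreal (a k) * ennreal (unit_ball_vol 3 * r k ^ 3)"
      using ar(2)[of k] by (simp add: nn_integral_cmult_indicator emeasure_cball)
    also have "\<dots> = ennreal (a k * (unit_ball_vol 3 * r k ^ 3))"
      using ar(1) by (rule ennreal_mult'[symmetric])
    also have "a k * (unit_ball_vol 3 * r k ^ 3) = unit_ball_vol 3 * (D * x ^ k)"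
      by (simp flip: ar(3))
    finally show "(\<integral>\<^sup>+z. ennreal (a k) * indicator (cball (0::R3) (r k)) z \<partial>lborel) = ennreal (unit_ball_vol 3 * (D * x ^ k))" .
  qed
  also have "\<dots> = ennreal (unit_ball_vol 3 * (D / (1 - x)))"
    by (intro suminf_ennreal_eq s mult_nonneg_nonneg[OF unit_ball_vol_nonneg D]) auto
  finally show ?thesis .
qed

lemma two_power_powr: "(2 ^ k) powr a = (2 powr a) ^ k" for a :: real
  by (simp add: powr_realpow[symmetric] powr_powr mult.commute powr_power)

lemma two_power_cube: "(2 ^ k) ^ 3 = (8::real) ^ k"
  by (induction k) (simp_all add: power_mult_distrib)

text \<open>On the shell between radii \<open>t / 2 ^ Suc k\<close> and \<open>t / 2 ^ k\<close> the
  power is comparable to a constant, and the contributions have ratio \<open>2 powr (a - 3)\<close>.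
  The exact power of \<open>t\<close> matters, because the weak \<open>L\<^sup>6\<close> estimate
  optimizes over the splitting radius.\<close>

lemma nn_integral_ball_powr:
  assumes "0 \<le> a" "a < 3"
  obtains C where "C > 0"
    "\<And>t. t > 0 \<Longrightarrow> (\<integral>\<^sup>+z. ennreal (norm (z::R3) powr - a) * indicator (ball 0 t) z \<partial>lborel) \<le> ennreal (C * t powr (3 - a))"
proof
  let ?x = "2 powr (a - 3) :: real"
  have x1: "?x < 1" using assms by (subst powr_less_one) auto
  let ?C = "unit_ball_vol 3 * (2 powr a / (1 - ?x))"
  show "?C > 0" using x1 by (auto intro!: mult_pos_pos divide_pos_pos unit_ball_vol_pos)
  fix t :: real assume t: "t > 0"
  have "(\<integral>\<^sup>+z. ennreal (norm (z::R3) powr - a) * indicator (ball 0 t) z \<partial>lborel)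
     \<le> ennreal (unit_ball_vol 3 * ((2 powr a * t powr (3 - a)) / (1 - ?x)))"
  proof (rule nn_integral_dyadic)
    fix z :: R3
    \<comment> \<open>The origin lies in no shell, but there \<open>0 powr (- a) = 0\<close> makes
      the left-hand side vanish.\<close>
    show "ennreal (norm z powr - a) * indicator (ball 0 t) z \<le>
      (\<Sum>k. ennreal ((t / 2 ^ Suc k) powr - a) * indicator (cball 0 (t / 2 ^ k)) z)"
    proof (cases "z \<noteq> 0 \<and> norm z < t")
      case True
      then have "1 \<le> t / norm z" by auto
      then obtain k where k: "2 ^ k \<le> t / norm z" "t / norm z < 2 ^ Suc k" using ex_dyadic by blast
      have "norm z \<le> t / 2 ^ k" "t / 2 ^ Suc k < norm z"
        using k True t by (simp_all add: field_simps)
      then have "norm z powr - a \<le> (t / 2 ^ Suc k) powr - a" "z \<in> cball 0 (t / 2 ^ k)"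
        using t assms by (auto intro!: powr_mono2')
      then have "ennreal (norm z powr - a) * indicator (ball 0 t) z \<le> ennreal ((t / 2 ^ Suc k) powr - a) * indicator (cball 0 (t / 2 ^ k)) z"
        by (auto simp: indicator_def intro!: ennreal_leI)
      also have "\<dots> \<le> (\<Sum>k. ennreal ((t / 2 ^ Suc k) powr - a) * indicator (cball 0 (t / 2 ^ k)) z)"
        by (rule ennreal_suminf_ge)
      finally show ?thesis .
    qed auto
    fix k
    have "(t / 2 ^ Suc k) powr - a * (t / 2 ^ k) ^ 3 = t powr - a * 2 powr a * (2 powr a) ^ k * t ^ 3 / (2 ^ k) ^ 3"
      using t by (simp add: powr_divide powr_mult powr_minus_divide two_power_powr field_simps)
    also have "\<dots> = 2 powr a * (t powr - a * t powr 3) * ((2 powr a) ^ k / (2 powr 3) ^ k)"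
      using t by (simp add: two_power_cube)
    also have "\<dots> = 2 powr a * t powr (3 - a) * (2 powr (a - 3)) ^ k"
      by (simp add: powr_add[symmetric] power_divide[symmetric] powr_diff)
    finally show "(t / 2 ^ Suc k) powr - a * (t / 2 ^ k) ^ 3 = 2 powr a * t powr (3 - a) * (2 powr (a - 3)) ^ k" .
  qed (use t x1 in auto)
  then show "(\<integral>\<^sup>+z. ennreal (norm (z::R3) powr - a) * indicator (ball 0 t) z \<partial>lborel) \<le> ennreal (?C * t powr (3 - a))"
    by (simp add: mult_ac)
qed

text \<open>The same series with shells growing outwards; now the ratio is
  \<open>2 powr (3 - a)\<close>, below 1 for \<open>a > 3\<close>.\<close>

lemma nn_integral_outside_ball_powr:
  assumes "3 < a"
  obtains C where "C > 0"
    "\<And>t. t > 0 \<Longrightarrow> (\<integral>\<^sup>+z. ennreal (norm (z::R3) powr - a) * indicator (- ball 0 t) z \<partial>lborel) \<le> ennreal (C * t powr (3 - a))"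
proof
  let ?x = "2 powr (3 - a) :: real"
  have x1: "?x < 1" using assms by (subst powr_less_one) auto
  let ?C = "unit_ball_vol 3 * (8 / (1 - ?x))"
  show "?C > 0" using x1 by (auto intro!: mult_pos_pos divide_pos_pos unit_ball_vol_pos)
  fix t :: real assume t: "t > 0"
  have "(\<integral>\<^sup>+z. ennreal (norm (z::R3) powr - a) * indicator (- ball 0 t) z \<partial>lborel)
     \<le> ennreal (unit_ball_vol 3 * ((8 * t powr (3 - a)) / (1 - ?x)))"
  proof (rule nn_integral_dyadic)
    fix z :: R3
    show "ennreal (norm z powr - a) * indicator (- ball 0 t) z \<le>
      (\<Sum>k. ennreal ((t * 2 ^ k) powr - a) * indicator (cball 0 (t * 2 ^ Suc k)) z)"
    proof (cases "norm z \<ge> t")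
      case True
      then have "1 \<le> norm z / t" using t by auto
      then obtain k where k: "2 ^ k \<le> norm z / t" "norm z / t < 2 ^ Suc k" using ex_dyadic by blast
      have "norm z \<le> t * 2 ^ Suc k" "t * 2 ^ k \<le> norm z"
        using k True t by (simp_all add: field_simps)
      then have "norm z powr - a \<le> (t * 2 ^ k) powr - a" "z \<in> cball 0 (t * 2 ^ Suc k)"
        using t assms by (auto intro!: powr_mono2')
      then have "ennreal (norm z powr - a) * indicator (- ball 0 t) z \<le> ennreal ((t * 2 ^ k) powr - a) * indicator (cball 0 (t * 2 ^ Suc k)) z"
        by (auto simp: indicator_def intro!: ennreal_leI)
      also have "\<dots> \<le> (\<Sum>k. ennreal ((t * 2 ^ k) powr - a) * indicator (cball 0 (t * 2 ^ Suc k)) z)"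
        by (rule ennreal_suminf_ge)
      finally show ?thesis .
    qed auto
    fix k
    have "(t * 2 ^ k) powr - a * (t * 2 ^ Suc k) ^ 3 = 8 * (t powr - a * t ^ 3) * ((2 powr - a) ^ k * (2 ^ k) ^ 3)"
      using t by (simp add: powr_mult two_power_powr power_mult_distrib)
    also have "\<dots> = 8 * (t powr - a * t powr 3) * ((2 powr - a) ^ k * (2 powr 3) ^ k)"
      using t by (simp add: two_power_cube)
    also have "\<dots> = 8 * t powr (3 - a) * (2 powr (3 - a)) ^ k"
      by (simp only: powr_add[symmetric] power_mult_distrib[symmetric] uminus_add_conv_diff)
    finally show "(t * 2 ^ k) powr - a * (t * 2 ^ Suc k) ^ 3 = 8 * t powr (3 - a) * (2 powr (3 - a)) ^ k" .
  qed (use t x1 in auto)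
  then show "(\<integral>\<^sup>+z. ennreal (norm (z::R3) powr - a) * indicator (- ball 0 t) z \<partial>lborel) \<le> ennreal (?C * t powr (3 - a))"
    by (simp add: mult_ac)
qed

text \<open>The term of order 4 in the exponential series gives the factor
  \<open>fact 4 = 24\<close>; 4 is the first whole power integrable at infinity in dimension
  3.\<close>

lemma exp_minus_le_powr4:
  fixes a r :: real assumes "a > 0" "r > 0"
  shows "exp (- a * r) \<le> (24 / a ^ 4) * r powr - 4"
proof -
  have 1: "y ^ 4 / 24 \<le> exp y" if "y \<ge> 0" for y :: real
  proof -
    have "(\<Sum>i\<in>{4}. y ^ i /\<^sub>R fact i) \<le> (\<Sum>i. y ^ i /\<^sub>R fact i)"
      using that by (intro sum_le_suminf summable_exp_generic) auto
    then have "y ^ 4 /\<^sub>R fact 4 \<le> exp y" by (simp add: exp_def)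
    moreover have f4: "fact 4 = (24::real)" by (simp add: fact_numeral)
    ultimately show ?thesis unfolding f4 by simp
  qed
  have "exp (- a * r) = 1 / exp (a * r)" by (simp add: exp_minus inverse_eq_divide)
  also have "\<dots> \<le> 1 / ((a * r) ^ 4 / 24)"
    using assms by (intro divide_left_mono 1) auto
  also have "\<dots> = (24 / a ^ 4) * r powr - 4"
    using assms by (simp add: powr_neg_numeral power_mult_distrib)
  finally show ?thesis .
qed

lemma exp_minus_norm_finite:
  assumes "a > 0" shows "(\<integral>\<^sup>+z. ennreal (exp (- a * norm (z::R3))) \<partial>lborel) < \<infinity>"
proof -
  obtain C' where "\<And>t. t > 0 \<Longrightarrow> (\<integral>\<^sup>+z. ennreal (norm (z::R3) powr - 4) * indicator (- ball 0 t) z \<partial>lborel) \<le> ennreal (C' * t powr (3 - 4))"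
    by (rule nn_integral_outside_ball_powr[of 4]) (simp, blast)
  from this[of 1] obtain C where C: "(\<integral>\<^sup>+z. ennreal (norm (z::R3) powr - 4) * indicator (- ball 0 1) z \<partial>lborel) \<le> ennreal C"
    by auto
  have "(\<integral>\<^sup>+z. ennreal (exp (- a * norm (z::R3))) \<partial>lborel) \<le>
    (\<integral>\<^sup>+z. indicator (ball 0 1) z + ennreal (24 / a ^ 4) * (ennreal (norm (z::R3) powr - 4) * indicator (- ball 0 1) z) \<partial>lborel)"
  proof (intro nn_integral_mono)
    fix z :: R3
    show "ennreal (exp (- a * norm z)) \<le> indicator (ball 0 1) z + ennreal (24 / a ^ 4) * (ennreal (norm z powr - 4) * indicator (- ball 0 1) z)"
    proof (cases "norm z < 1")
      case True
      then show ?thesis using assms by simp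
    next
      case False
      then have "z \<noteq> 0" by auto
      with False show ?thesis using assms exp_minus_le_powr4[of a "norm z"]
        by (auto simp: ennreal_mult'[symmetric] intro!: ennreal_leI)
    qed
  qed
  also have "\<dots> = emeasure lborel (ball 0 1 :: R3 set) + ennreal (24 / a ^ 4) * (\<integral>\<^sup>+z. ennreal (norm (z::R3) powr - 4) * indicator (- ball 0 1) z \<partial>lborel)"
    by (subst nn_integral_add) (simp_all add: nn_integral_cmult)
  also have "\<dots> < \<infinity>"
    using le_less_trans[OF C ennreal_less_top] emeasure_lborel_ball_finite[of "0::R3" 1]
    by (simp add: ennreal_mult_less_top)
  finally show ?thesis .
qed

lemma integrable_exp_minus_norm:
  assumes "a > 0" shows "integrable lborel (\<lambda>z::R3. exp (- a * norm z))"
  by (rule integrableI_bounded) (use exp_minus_norm_finite[OF assms] in auto)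

text \<open>The condition \<open>a < 3\<close> controls the origin and the exponential controls
  infinity. It serves the Yukawa kernel (\<open>a = 1\<close>), its gradient (\<open>a = 2\<close>)
  and, in the Young estimate, a power of the Yukawa kernel with exponent between 1 and 3.\<close>

lemma kernel_finite:
  assumes "0 \<le> a" "a < 3" "b > 0"
  shows "(\<integral>\<^sup>+z. ennreal (norm (z::R3) powr - a * exp (- b * norm z)) \<partial>lborel) < \<infinity>"
proof -
  obtain C' where "\<And>t. t > 0 \<Longrightarrow> (\<integral>\<^sup>+z. ennreal (norm (z::R3) powr - a) * indicator (ball 0 t) z \<partial>lborel) \<le> ennreal (C' * t powr (3 - a))"
    by (rule nn_integral_ball_powr[OF assms(1,2)]) blast
  from this[of 1] obtain C where C: "(\<integral>\<^sup>+z. ennreal (norm (z::R3) powr - a) * indicator (ball 0 1) z \<partial>lborel) \<le> ennreal C"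
    by auto
  have "(\<integral>\<^sup>+z. ennreal (norm (z::R3) powr - a * exp (- b * norm z)) \<partial>lborel) \<le>
    (\<integral>\<^sup>+z. ennreal (norm (z::R3) powr - a) * indicator (ball 0 1) z + ennreal (exp (- b * norm z)) \<partial>lborel)"
  proof (intro nn_integral_mono)
    fix z :: R3
    show "ennreal (norm z powr - a * exp (- b * norm z)) \<le> ennreal (norm z powr - a) * indicator (ball 0 1) z + ennreal (exp (- b * norm z))"
    proof (cases "norm z < 1")
      case True
      have "ennreal (norm z powr - a * exp (- b * norm z)) \<le> ennreal (norm z powr - a)"
        using assms by (intro ennreal_leI) (simp add: mult_left_le)
      with True show ?thesis by (simp add: add_increasing2)
    next
      case False
      have "norm z powr - a \<le> 1"
        using False assms powr_mono2'[of "-a" 1 "norm z"] by auto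
      with False show ?thesis by (auto intro!: ennreal_leI simp: mult_left_le_one_le)
    qed
  qed
  also have "\<dots> = (\<integral>\<^sup>+z. ennreal (norm (z::R3) powr - a) * indicator (ball 0 1) z \<partial>lborel) + (\<integral>\<^sup>+z. ennreal (exp (- b * norm (z::R3))) \<partial>lborel)"
    by (subst nn_integral_add) simp_all
  also have "\<dots> < \<infinity>"
    using le_less_trans[OF C ennreal_less_top] exp_minus_norm_finite[OF assms(3)] by simp
  finally show ?thesis .
qed

section \<open>The regularized Yukawa kernel\<close>

lemma pdiff_shift:
  assumes "f differentiable (at (x - a))"
  shows "pdiff i (\<lambda>x. f (x - a)) x = pdiff i f (x - a)" "(\<lambda>x. f (x - a)) differentiable (at x)"
proof -
  have "((\<lambda>x. x - a) has_derivative (\<lambda>h. h)) (at x)"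
    by (auto intro!: derivative_eq_intros)
  from has_derivative_compose[OF this assms[unfolded frechet_derivative_works]]
  have *: "((\<lambda>x. f (x - a)) has_derivative frechet_derivative f (at (x - a))) (at x)" .
  show "(\<lambda>x. f (x - a)) differentiable (at x)" using * by (auto simp: differentiable_def)
  show "pdiff i (\<lambda>x. f (x - a)) x = pdiff i f (x - a)"
    using pdiff_eqI[OF *] by (simp add: pdiff_def)
qed

lemma smooth_shift:
  assumes "smooth f" shows "smooth (\<lambda>x. f (x - a))"
proof (rule smooth_algI[of "{\<lambda>x. f (x - a) |f. smooth f}"])
  let ?A = "{\<lambda>x. f (x - a) |f. smooth f}"
  show "g differentiable at x" if "g \<in> ?A" for g x
    using that by (auto intro!: pdiff_shift(2)[OF smooth_differentiable])
  show "alg ?A (pdiff i g)" if "g \<in> ?A" for g i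
  proof -
    from that obtain f where f: "g = (\<lambda>x. f (x - a))" "smooth f" by auto
    have "pdiff i g = (\<lambda>x. pdiff i f (x - a))"
      unfolding f(1) using pdiff_shift(1)[OF smooth_differentiable[OF f(2)]] by blast
    with f show ?thesis by (auto intro!: alg_gen smooth_pdiff)
  qed
qed (use assms in \<open>auto intro!: alg_gen\<close>)

definition rho :: "real \<Rightarrow> R3 \<Rightarrow> real" where
  "rho \<epsilon> z = sqrt (\<epsilon>\<^sup>2 + z \<bullet> z)"

text \<open>The regularized Yukawa kernel: replacing \<open>norm z\<close> by \<open>rho \<epsilon> z\<close> in the fundamental solution
  \<open>exp (- k * norm z) / norm z\<close> of \<open>k\<^sup>2 - \<Delta>\<close> makes it smooth, and \<open>k\<^sup>2 - \<Delta>\<close> maps it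
  to the explicit approximate identity \<open>mollifier k \<epsilon>\<close>.\<close>

definition yukawa :: "real \<Rightarrow> real \<Rightarrow> R3 \<Rightarrow> real" where
  "yukawa k \<epsilon> z = exp (- k * rho \<epsilon> z) * inverse (rho \<epsilon> z)"

text \<open>The partial derivative of \<open>yukawa k \<epsilon>\<close>, kept in closed form
  because the formula still makes sense for \<open>\<epsilon> = 0\<close>, where it is the pointwise
  limit away from the origin.\<close>

definition yukawa' :: "real \<Rightarrow> real \<Rightarrow> 3 \<Rightarrow> R3 \<Rightarrow> real" where
  "yukawa' k \<epsilon> i z = - z $ i * (k * inverse (rho \<epsilon> z) ^ 2 + inverse (rho \<epsilon> z) ^ 3) * exp (- k * rho \<epsilon> z)"

definition mollifier :: "real \<Rightarrow> real \<Rightarrow> R3 \<Rightarrow> real" where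
  "mollifier k \<epsilon> z = \<epsilon>\<^sup>2 * exp (- k * rho \<epsilon> z) *
     (k\<^sup>2 * inverse (rho \<epsilon> z) ^ 3 + 3 * k * inverse (rho \<epsilon> z) ^ 4 + 3 * inverse (rho \<epsilon> z) ^ 5)"

lemma rho_ge_norm: "norm z \<le> rho \<epsilon> z"
  unfolding rho_def norm_eq_sqrt_inner by (intro real_sqrt_le_mono) auto

lemma rho_ge: "\<epsilon> \<le> rho \<epsilon> z"
  unfolding rho_def by (intro real_le_rsqrt) auto

lemma rho_sq: "(rho \<epsilon> z)\<^sup>2 = \<epsilon>\<^sup>2 + (norm z)\<^sup>2"
  by (simp add: rho_def power2_norm_eq_inner)

context
  fixes k \<epsilon> :: real
  assumes k: "k > 0" and e: "\<epsilon> > 0"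
begin

lemma rho_pos: "rho \<epsilon> z > 0"
  using rho_ge[of \<epsilon> z] e by linarith

lemma rho_has_derivative: "(rho \<epsilon> has_derivative (\<lambda>h. (z \<bullet> h) * inverse (rho \<epsilon> z))) (at z)"
proof -
  have "\<epsilon>\<^sup>2 + z \<bullet> z > 0" using e by (simp add: add_pos_nonneg)
  then show ?thesis
    unfolding rho_def[abs_def]
    by (auto intro!: derivative_eq_intros simp: inner_commute field_simps)
qed

lemma inverse_rho_has_derivative:
  "((\<lambda>z. inverse (rho \<epsilon> z)) has_derivative (\<lambda>h. - (z \<bullet> h) * inverse (rho \<epsilon> z) ^ 3)) (at z)"
  using rho_pos[of z]
  by (auto intro!: derivative_eq_intros rho_has_derivative simp: power3_eq_cube)

lemma exp_rho_has_derivative: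
  "((\<lambda>z. exp (- k * rho \<epsilon> z)) has_derivative (\<lambda>h. - k * (z \<bullet> h) * inverse (rho \<epsilon> z) * exp (- k * rho \<epsilon> z))) (at z)"
  by (auto intro!: derivative_eq_intros rho_has_derivative)

text \<open>Differentiating \<open>rho\<close> produces a coordinate times
  \<open>inverse (rho \<epsilon> z)\<close>. Hence the coordinates, the reciprocal and the
  exponential generate an algebra that is closed under partial derivatives.\<close>

lemma smooth_rho:
  shows "smooth (\<lambda>z. inverse (rho \<epsilon> z))" "smooth (\<lambda>z. exp (- k * rho \<epsilon> z))"
proof -
  let ?g = "\<lambda>z. inverse (rho \<epsilon> z)" and ?h = "\<lambda>z. exp (- k * rho \<epsilon> z)"
  let ?A = "{?g, ?h} \<union> range (\<lambda>i z. z $ i)"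
  have d: "f differentiable at x" if "f \<in> ?A" for f x
    using that inverse_rho_has_derivative[of x] exp_rho_has_derivative[of x] smooth_differentiable[OF smooth_coord]
    by (auto simp: differentiable_def)
  have p: "alg ?A (pdiff i f)" if "f \<in> ?A" for f i
  proof -
    consider "f = ?g" | "f = ?h" | j where "f = (\<lambda>z. z $ j)" using \<open>f \<in> ?A\<close> by blast
    then show ?thesis
    proof cases
      case 1
      have "pdiff i f = (\<lambda>z. (- 1 * z $ i) * (?g z * (?g z * ?g z)))"
        unfolding 1 using pdiff_eqI[OF inverse_rho_has_derivative] by (auto simp: fun_eq_iff inner_axis power3_eq_cube mult.assoc)
      moreover have "alg ?A (\<lambda>z. (- 1 * z $ i) * (?g z * (?g z * ?g z)))"
        by (intro alg_mult alg_const; rule alg_gen; blast)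
      ultimately show ?thesis by simp
    next
      case 2
      have "pdiff i f = (\<lambda>z. (- k * z $ i) * (?g z * ?h z))"
        unfolding 2 using pdiff_eqI[OF exp_rho_has_derivative] by (auto simp: fun_eq_iff inner_axis mult.assoc)
      moreover have "alg ?A (\<lambda>z. (- k * z $ i) * (?g z * ?h z))"
        by (intro alg_mult alg_const; rule alg_gen; blast)
      ultimately show ?thesis by simp
    next
      case 3
      then show ?thesis by (simp add: pdiff_coord alg_const)
    qed
  qed
  show "smooth ?g" "smooth ?h"
    by (rule smooth_algI[of ?A]; (fact d | fact p | (rule alg_gen, blast)))+
qed

lemma smooth_yukawa: "smooth (yukawa k \<epsilon>)"
  unfolding yukawa_def[abs_def] by (intro smooth_mult smooth_rho)

lemma pdiff_yukawa: "pdiff i (yukawa k \<epsilon>) = yukawa' k \<epsilon> i"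
proof
  fix z
  have "(yukawa k \<epsilon> has_derivative (\<lambda>h. exp (- k * rho \<epsilon> z) * (- (z \<bullet> h) * inverse (rho \<epsilon> z) ^ 3) +
      (- k * (z \<bullet> h) * inverse (rho \<epsilon> z) * exp (- k * rho \<epsilon> z)) * inverse (rho \<epsilon> z))) (at z)"
    unfolding yukawa_def[abs_def]
    by (rule has_derivative_mult[OF exp_rho_has_derivative inverse_rho_has_derivative])
  from pdiff_eqI[OF this, of i] show "pdiff i (yukawa k \<epsilon>) z = yukawa' k \<epsilon> i z"
    by (simp add: inner_axis yukawa'_def algebra_simps power2_eq_square)
qed

lemma smooth_yukawa': "smooth (yukawa' k \<epsilon> i)"
  using smooth_pdiff[OF smooth_yukawa, of i] by (simp add: pdiff_yukawa)

lemma pdiff_yukawa':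
  "pdiff i (yukawa' k \<epsilon> i) z = exp (- k * rho \<epsilon> z) *
     ((z $ i)\<^sup>2 * (k\<^sup>2 * inverse (rho \<epsilon> z) ^ 3 + 3 * k * inverse (rho \<epsilon> z) ^ 4 + 3 * inverse (rho \<epsilon> z) ^ 5)
      - (k * inverse (rho \<epsilon> z) ^ 2 + inverse (rho \<epsilon> z) ^ 3))"
proof -
  let ?r = "inverse (rho \<epsilon> z)"
  have c: "((\<lambda>z::R3. - z $ i) has_derivative (\<lambda>h. - h $ i)) (at z)"
    by (intro has_derivative_minus bounded_linear_imp_has_derivative bounded_linear_vec_nth)
  have q: "((\<lambda>z. k * inverse (rho \<epsilon> z) ^ 2 + inverse (rho \<epsilon> z) ^ 3) has_derivative
      (\<lambda>h. - (z \<bullet> h) * (2 * k * ?r ^ 4 + 3 * ?r ^ 5))) (at z)"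
    by (rule derivative_eq_intros inverse_rho_has_derivative refl)+ (auto simp: fun_eq_iff algebra_simps eval_nat_numeral)
  from pdiff_eqI[OF has_derivative_mult[OF has_derivative_mult[OF c q] exp_rho_has_derivative], of i]
  show ?thesis
    by (simp add: yukawa'_def[abs_def] inner_axis algebra_simps eval_nat_numeral)
qed

text \<open>With \<open>(norm z)\<^sup>2\<close> replaced by
  \<open>(rho \<epsilon> z)\<^sup>2 - \<epsilon>\<^sup>2\<close>, the part without
  \<open>\<epsilon>\<^sup>2\<close> cancels as it does for the exact fundamental solution. What
  remains is \<open>\<epsilon>\<^sup>2\<close> times a sum of positive terms.\<close>

lemma yukawa_equation: "k\<^sup>2 * yukawa k \<epsilon> z - (\<Sum>i\<in>UNIV. pdiff i (yukawa' k \<epsilon> i) z) = mollifier k \<epsilon> z"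
proof -
  let ?r = "inverse (rho \<epsilon> z)" and ?E = "exp (- k * rho \<epsilon> z)"
  let ?Q = "k\<^sup>2 * ?r ^ 3 + 3 * k * ?r ^ 4 + 3 * ?r ^ 5"
  have n: "(norm z)\<^sup>2 = (rho \<epsilon> z)\<^sup>2 - \<epsilon>\<^sup>2" by (simp add: rho_sq)
  have r: "(rho \<epsilon> z)\<^sup>2 * ?Q = k\<^sup>2 * ?r + 3 * k * ?r ^ 2 + 3 * ?r ^ 3"
    using rho_pos[of z] by (simp add: field_simps eval_nat_numeral)
  have "(\<Sum>i\<in>UNIV. pdiff i (yukawa' k \<epsilon> i) z) = ?E * ((\<Sum>i\<in>UNIV. (z $ i)\<^sup>2) * ?Q - 3 * (k * ?r ^ 2 + ?r ^ 3))"
    by (simp only: pdiff_yukawa' sum_distrib_left[symmetric] sum_subtractf sum_distrib_right[symmetric]) simp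
  also have "(\<Sum>i\<in>UNIV. (z $ i)\<^sup>2) = (rho \<epsilon> z)\<^sup>2 - \<epsilon>\<^sup>2"
    unfolding n[symmetric] square_sum_norm[symmetric] by (simp only: power2_eq_square)
  also have "?E * (((rho \<epsilon> z)\<^sup>2 - \<epsilon>\<^sup>2) * ?Q - 3 * (k * ?r ^ 2 + ?r ^ 3)) = ?E * ((rho \<epsilon> z)\<^sup>2 * ?Q - 3 * (k * ?r ^ 2 + ?r ^ 3)) - \<epsilon>\<^sup>2 * ?E * ?Q"
    by (simp only: left_diff_distrib right_diff_distrib mult_ac)
  also have "\<dots> = k\<^sup>2 * yukawa k \<epsilon> z - mollifier k \<epsilon> z"
    unfolding r yukawa_def mollifier_def by (simp add: algebra_simps)
  finally show ?thesis by simp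
qed

lemma inverse_rho_le: "inverse (rho \<epsilon> z) \<le> inverse \<epsilon>"
  using e rho_ge[of \<epsilon> z] by (intro le_imp_inverse_le) auto

lemma exp_rho_le: "exp (- k * rho \<epsilon> z) \<le> exp (- k * norm z)"
  using k rho_ge_norm[of z \<epsilon>] by simp

text \<open>Here \<open>\<epsilon>\<close> is fixed, and constants may blow up as it tends to 0:
  these bounds only put the regularized kernels and their derivatives into \<open>L\<^sup>2\<close>.
  The estimates uniform in \<open>\<epsilon>\<close> come later, with a singularity at the
  origin.\<close>

lemma square_integrable_exp_bound:
  assumes [measurable]: "f \<in> borel_measurable borel" and "\<And>z. \<bar>f z\<bar> \<le> C * exp (- k * norm (z::R3))"
  shows "integrable lborel (\<lambda>z. (f z)\<^sup>2)"
proof (rule Bochner_Integration.integrable_bound)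
  show "integrable lborel (\<lambda>z::R3. C\<^sup>2 * exp (- (2 * k) * norm z))"
    using k by (intro integrable_mult_right integrable_exp_minus_norm) simp
  have "(f z)\<^sup>2 \<le> C\<^sup>2 * exp (- (2 * k) * norm z)" for z
  proof -
    have "\<bar>f z\<bar>\<^sup>2 \<le> (C * exp (- k * norm z))\<^sup>2" using assms(2) by (intro power_mono) auto
    also have "\<dots> = C\<^sup>2 * exp (- (2 * k) * norm z)"
      by (simp add: power_mult_distrib power2_eq_square flip: exp_add)
    finally show ?thesis by simp
  qed
  then show "AE z in lborel. norm ((f z)\<^sup>2) \<le> norm (C\<^sup>2 * exp (- (2 * k) * norm z))"
    by (auto simp: abs_mult)
qed simp

lemma yukawa_nonneg: "0 \<le> yukawa k \<epsilon> z"
  unfolding yukawa_def using rho_pos[of z] by simp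

lemma yukawa_le: "\<bar>yukawa k \<epsilon> z\<bar> \<le> inverse \<epsilon> * exp (- k * norm z)"
  using mult_mono[OF exp_rho_le inverse_rho_le, of z z] rho_pos[of z] yukawa_nonneg[of z]
  by (simp add: yukawa_def mult.commute)

lemma coord_rho_le: "\<bar>z $ i\<bar> * inverse (rho \<epsilon> z) \<le> 1"
proof -
  have "\<bar>z $ i\<bar> \<le> rho \<epsilon> z" using component_le_norm_cart[of z i] rho_ge_norm[of z \<epsilon>] by linarith
  then show ?thesis using rho_pos[of z] by (simp add: field_simps)
qed

lemma yukawa'_le': "\<bar>yukawa' k \<epsilon> i z\<bar> \<le> (k * inverse (rho \<epsilon> z) + inverse (rho \<epsilon> z) ^ 2) * exp (- k * rho \<epsilon> z)"
proof -
  let ?r = "inverse (rho \<epsilon> z)"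
  have r: "?r > 0" using rho_pos[of z] by simp
  have "\<bar>yukawa' k \<epsilon> i z\<bar> = (\<bar>z $ i\<bar> * ?r) * ((k * ?r + ?r ^ 2) * exp (- k * rho \<epsilon> z))"
  proof -
    have "\<bar>yukawa' k \<epsilon> i z\<bar> = \<bar>z $ i\<bar> * (k * ?r ^ 2 + ?r ^ 3) * exp (- k * rho \<epsilon> z)"
      using r k by (simp add: yukawa'_def abs_mult)
    also have "k * ?r ^ 2 + ?r ^ 3 = ?r * (k * ?r + ?r ^ 2)" by (simp add: algebra_simps eval_nat_numeral)
    finally show ?thesis by (simp only: mult_ac)
  qed
  also have "\<dots> \<le> 1 * ((k * ?r + ?r ^ 2) * exp (- k * rho \<epsilon> z))"
    using r k by (intro mult_right_mono coord_rho_le) auto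
  finally show ?thesis by simp
qed

lemma yukawa'_le: "\<bar>yukawa' k \<epsilon> i z\<bar> \<le> (k * inverse \<epsilon> + inverse \<epsilon> ^ 2) * exp (- k * norm z)"
proof -
  have "(k * inverse (rho \<epsilon> z) + inverse (rho \<epsilon> z) ^ 2) * exp (- k * rho \<epsilon> z) \<le> (k * inverse \<epsilon> + inverse \<epsilon> ^ 2) * exp (- k * norm z)"
    using k e rho_pos[of z] by (intro mult_mono add_mono mult_left_mono power_mono exp_rho_le inverse_rho_le) auto
  with yukawa'_le' show ?thesis by (rule order_trans)
qed

lemma pdiff_yukawa'_le: "\<bar>pdiff i (yukawa' k \<epsilon> i) z\<bar> \<le>
  ((k\<^sup>2 * inverse \<epsilon> + 3 * k * inverse \<epsilon> ^ 2 + 3 * inverse \<epsilon> ^ 3) + (k * inverse \<epsilon> ^ 2 + inverse \<epsilon> ^ 3)) * exp (- k * norm z)"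
proof -
  let ?r = "inverse (rho \<epsilon> z)"
  have r: "?r > 0" using rho_pos[of z] by simp
  have "\<bar>pdiff i (yukawa' k \<epsilon> i) z\<bar> = exp (- k * rho \<epsilon> z) * \<bar>(\<bar>z $ i\<bar> * ?r)\<^sup>2 * (k\<^sup>2 * ?r + 3 * k * ?r ^ 2 + 3 * ?r ^ 3) - (k * ?r ^ 2 + ?r ^ 3)\<bar>"
    unfolding pdiff_yukawa' abs_mult power_mult_distrib power2_abs
    by (simp add: algebra_simps eval_nat_numeral)
  also have "\<dots> \<le> exp (- k * rho \<epsilon> z) * (1 * (k\<^sup>2 * ?r + 3 * k * ?r ^ 2 + 3 * ?r ^ 3) + (k * ?r ^ 2 + ?r ^ 3))"
  proof (intro mult_left_mono)
    have 1: "(\<bar>z $ i\<bar> * ?r)\<^sup>2 * (k\<^sup>2 * ?r + 3 * k * ?r ^ 2 + 3 * ?r ^ 3) \<le> 1 * (k\<^sup>2 * ?r + 3 * k * ?r ^ 2 + 3 * ?r ^ 3)"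
      using r k coord_rho_le[of z i] by (intro mult_right_mono power_le_one) auto
    have 2: "0 \<le> (\<bar>z $ i\<bar> * ?r)\<^sup>2 * (k\<^sup>2 * ?r + 3 * k * ?r ^ 2 + 3 * ?r ^ 3)" "0 \<le> k * ?r ^ 2 + ?r ^ 3"
      using r k by auto
    show "\<bar>(\<bar>z $ i\<bar> * ?r)\<^sup>2 * (k\<^sup>2 * ?r + 3 * k * ?r ^ 2 + 3 * ?r ^ 3) - (k * ?r ^ 2 + ?r ^ 3)\<bar> \<le>
      1 * (k\<^sup>2 * ?r + 3 * k * ?r ^ 2 + 3 * ?r ^ 3) + (k * ?r ^ 2 + ?r ^ 3)"
      using 1 2 by linarith
  qed simp
  also have "\<dots> \<le> exp (- k * norm z) * ((k\<^sup>2 * inverse \<epsilon> + 3 * k * inverse \<epsilon> ^ 2 + 3 * inverse \<epsilon> ^ 3) + (k * inverse \<epsilon> ^ 2 + inverse \<epsilon> ^ 3))"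
    unfolding mult_1
    using k e r inverse_rho_le[of z]
    by (intro mult_mono add_mono mult_left_mono power_mono exp_rho_le) (auto intro!: add_nonneg_nonneg mult_nonneg_nonneg)
  finally show ?thesis by (simp only: mult.commute)
qed

end

section \<open>Translated kernels as test functions\<close>

lemma integrable_shift_minus:
  fixes f :: "R3 \<Rightarrow> real"
  assumes "integrable lborel f" shows "integrable lborel (\<lambda>y. f (y - x))"
  using lborel_integrable_shift[OF assms, of "- x"] by simp

context
  fixes k \<epsilon> :: real and x :: R3
  assumes k: "k > 0" and e: "\<epsilon> > 0"
begin

lemma yukawa_measurable [measurable]:
  "yukawa k \<epsilon> \<in> borel_measurable borel" "yukawa' k \<epsilon> i \<in> borel_measurable borel"
  "pdiff j (yukawa' k \<epsilon> i) \<in> borel_measurable borel"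
  by (intro smooth_measurable smooth_yukawa[OF k e] smooth_yukawa'[OF k e] smooth_pdiff)+

lemma yukawa_square_integrable:
  "integrable lborel (\<lambda>y. (yukawa k \<epsilon> (y - x))\<^sup>2)"
  "integrable lborel (\<lambda>y. (yukawa' k \<epsilon> i (y - x))\<^sup>2)"
  "integrable lborel (\<lambda>y. (pdiff i (yukawa' k \<epsilon> i) (y - x))\<^sup>2)"
  by (intro integrable_shift_minus[where f = "\<lambda>y. (yukawa k \<epsilon> y)\<^sup>2"]
      integrable_shift_minus[where f = "\<lambda>y. (yukawa' k \<epsilon> i y)\<^sup>2"]
      integrable_shift_minus[where f = "\<lambda>y. (pdiff i (yukawa' k \<epsilon> i) y)\<^sup>2"]
      square_integrable_exp_bound[OF k e _ yukawa_le[OF k e]]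
      square_integrable_exp_bound[OF k e _ yukawa'_le[OF k e]]
      square_integrable_exp_bound[OF k e _ pdiff_yukawa'_le[OF k e]] yukawa_measurable)+

lemma smooth_yukawa_shift: "smooth (\<lambda>y. yukawa k \<epsilon> (y - x))" "smooth (\<lambda>y. yukawa' k \<epsilon> i (y - x))"
  by (intro smooth_shift smooth_yukawa[OF k e] smooth_yukawa'[OF k e])+

lemma pdiff_yukawa_shift:
  "pdiff i (\<lambda>y. yukawa k \<epsilon> (y - x)) = (\<lambda>y. yukawa' k \<epsilon> i (y - x))"
  "pdiff j (\<lambda>y. yukawa' k \<epsilon> i (y - x)) = (\<lambda>y. pdiff j (yukawa' k \<epsilon> i) (y - x))"
  using pdiff_shift(1)[OF smooth_differentiable[OF smooth_yukawa[OF k e]]]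
    pdiff_shift(1)[OF smooth_differentiable[OF smooth_yukawa'[OF k e]]]
  by (auto simp: fun_eq_iff pdiff_yukawa[OF k e])

lemma yukawa_shift_H1:
  "(\<lambda>y. yukawa k \<epsilon> (y - x)) \<in> H1"
  "AE y in lborel. grad (\<lambda>y. yukawa k \<epsilon> (y - x)) y = (\<chi> i. yukawa' k \<epsilon> i (y - x))"
  using smooth_H1(2,3)[OF smooth_yukawa_shift(1) yukawa_square_integrable(1)] yukawa_square_integrable(2)
  by (simp_all add: pdiff_yukawa_shift(1))

text \<open>\<open>u\<close> has only first weak derivatives, so of the two derivatives hidden in
  \<open>mollifier\<close> just one is moved to \<open>u\<close>: the weak gradient identity is
  applied to \<open>yukawa'\<close> instead of \<open>yukawa\<close>.\<close>

lemma yukawa_weak_gradient: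
  assumes g: "weak_gradient u g" and [measurable]: "u \<in> borel_measurable borel"
    and u: "integrable lborel (\<lambda>x. (u x)\<^sup>2)"
  shows "(LINT y|lborel. u y * mollifier k \<epsilon> (y - x)) =
    (LINT y|lborel. k\<^sup>2 * (u y * yukawa k \<epsilon> (y - x)) + (\<Sum>i\<in>UNIV. g y $ i * yukawa' k \<epsilon> i (y - x)))"
proof -
  note [measurable] = weak_gradient_component(1)[OF g]
  note gi = weak_gradient_component(2)[OF g]
  have i1: "integrable lborel (\<lambda>y. u y * yukawa k \<epsilon> (y - x))"
    by (intro integrable_mult_square u yukawa_square_integrable) measurable
  have i2: "integrable lborel (\<lambda>y. u y * yukawa' k \<epsilon> i (y - x))" for i
    by (intro integrable_mult_square u yukawa_square_integrable) measurable
  have i3: "integrable lborel (\<lambda>y. u y * pdiff i (yukawa' k \<epsilon> i) (y - x))" for i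
    by (intro integrable_mult_square u yukawa_square_integrable) measurable
  have i4: "integrable lborel (\<lambda>y. g y $ i * yukawa' k \<epsilon> i (y - x))" for i
    by (intro integrable_mult_square gi yukawa_square_integrable) measurable
  have w: "(LINT y|lborel. u y * pdiff i (yukawa' k \<epsilon> i) (y - x)) = - (LINT y|lborel. g y $ i * yukawa' k \<epsilon> i (y - x))" for i
    using weak_gradient_smooth[OF g assms(2) smooth_yukawa_shift(2)[of i] i2, of i] i3[of i] i4[of i]
    by (simp add: pdiff_yukawa_shift(2))
  have "(LINT y|lborel. u y * mollifier k \<epsilon> (y - x)) =
    (LINT y|lborel. k\<^sup>2 * (u y * yukawa k \<epsilon> (y - x)) - (\<Sum>i\<in>UNIV. u y * pdiff i (yukawa' k \<epsilon> i) (y - x)))"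
    by (simp add: yukawa_equation[OF k e, symmetric] right_diff_distrib sum_distrib_left mult_ac)
  also have "\<dots> = k\<^sup>2 * (LINT y|lborel. u y * yukawa k \<epsilon> (y - x)) - (\<Sum>i\<in>UNIV. LINT y|lborel. u y * pdiff i (yukawa' k \<epsilon> i) (y - x))"
    by (simp add: Bochner_Integration.integral_diff Bochner_Integration.integral_sum i1 i3)
  also have "\<dots> = k\<^sup>2 * (LINT y|lborel. u y * yukawa k \<epsilon> (y - x)) + (\<Sum>i\<in>UNIV. LINT y|lborel. g y $ i * yukawa' k \<epsilon> i (y - x))"
    by (simp add: w sum_negf)
  also have "\<dots> = (LINT y|lborel. k\<^sup>2 * (u y * yukawa k \<epsilon> (y - x)) + (\<Sum>i\<in>UNIV. g y $ i * yukawa' k \<epsilon> i (y - x)))"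
    by (simp add: Bochner_Integration.integral_add Bochner_Integration.integral_sum i1 i4)
  finally show ?thesis .
qed

end

text \<open>\<open>mollifier\<close> after the substitution
  \<open>z = \<epsilon> *\<^sub>R t\<close>, with the Jacobian \<open>\<epsilon> ^ 3\<close>
  included. In this form only the last term survives as \<open>\<epsilon>\<close> tends to
  0.\<close>

definition mollifier1 :: "real \<Rightarrow> real \<Rightarrow> R3 \<Rightarrow> real" where
  "mollifier1 k \<epsilon> t = exp (- k * \<epsilon> * rho 1 t) *
     (k\<^sup>2 * \<epsilon>\<^sup>2 * inverse (rho 1 t) ^ 3 + 3 * k * \<epsilon> * inverse (rho 1 t) ^ 4 + 3 * inverse (rho 1 t) ^ 5)"

text \<open>The value is \<open>4 * pi\<close>, but only positivity matters.\<close>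

definition mass :: real where
  "mass = (LINT t|lborel. 3 * inverse (rho 1 (t::R3)) ^ 5)"

lemma rho_scale: assumes "\<epsilon> > 0" shows "rho \<epsilon> (\<epsilon> *\<^sub>R t) = \<epsilon> * rho 1 t"
proof -
  have "\<epsilon>\<^sup>2 + (\<epsilon> *\<^sub>R t) \<bullet> (\<epsilon> *\<^sub>R t) = \<epsilon>\<^sup>2 * (1\<^sup>2 + t \<bullet> t)"
    by (simp add: algebra_simps power2_eq_square)
  then show ?thesis using assms by (simp add: rho_def real_sqrt_mult)
qed

lemma mollifier_scale:
  assumes "\<epsilon> > 0" shows "\<epsilon> ^ 3 * mollifier k \<epsilon> (\<epsilon> *\<^sub>R t) = mollifier1 k \<epsilon> t"
proof -
  let ?r = "inverse (rho 1 t)"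
  have "\<epsilon> ^ 3 * mollifier k \<epsilon> (\<epsilon> *\<^sub>R t) = exp (- k * \<epsilon> * rho 1 t) * (\<epsilon> ^ 3 * \<epsilon>\<^sup>2 *
    (k\<^sup>2 * (inverse \<epsilon> * ?r) ^ 3 + 3 * k * (inverse \<epsilon> * ?r) ^ 4 + 3 * (inverse \<epsilon> * ?r) ^ 5))"
    unfolding mollifier_def rho_scale[OF assms] by (simp add: mult_ac)
  also have "\<epsilon> ^ 3 * \<epsilon>\<^sup>2 * (k\<^sup>2 * (inverse \<epsilon> * ?r) ^ 3 + 3 * k * (inverse \<epsilon> * ?r) ^ 4 + 3 * (inverse \<epsilon> * ?r) ^ 5) =
    k\<^sup>2 * \<epsilon>\<^sup>2 * ?r ^ 3 + 3 * k * \<epsilon> * ?r ^ 4 + 3 * ?r ^ 5"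
  proof -
    have "\<epsilon> ^ 3 * \<epsilon>\<^sup>2 * inverse \<epsilon> ^ 3 = \<epsilon>\<^sup>2" "\<epsilon> ^ 3 * \<epsilon>\<^sup>2 * inverse \<epsilon> ^ 4 = \<epsilon>" "\<epsilon> ^ 3 * \<epsilon>\<^sup>2 * inverse \<epsilon> ^ 5 = 1"
      using assms by (simp_all add: field_simps eval_nat_numeral)
    moreover have "\<epsilon> ^ 3 * \<epsilon>\<^sup>2 * (k\<^sup>2 * (X * a) + 3 * k * (Y * b) + 3 * (Z * c)) =
      k\<^sup>2 * (\<epsilon> ^ 3 * \<epsilon>\<^sup>2 * X) * a + 3 * k * (\<epsilon> ^ 3 * \<epsilon>\<^sup>2 * Y) * b + 3 * (\<epsilon> ^ 3 * \<epsilon>\<^sup>2 * Z) * c" for X Y Z a b c :: real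
      by (simp only: distrib_left mult_ac)
    ultimately show ?thesis
      unfolding power_mult_distrib by simp
  qed
  finally show ?thesis by (simp add: mollifier1_def)
qed

lemma rho1_ge: "rho 1 t \<ge> 1" "inverse (rho 1 t) \<le> 1" "inverse (rho 1 t) > 0"
proof -
  show "rho 1 t \<ge> 1" using rho_ge[of 1 t] by simp
  then show "inverse (rho 1 t) \<le> 1" "inverse (rho 1 t) > 0"
    by (auto simp: inverse_le_1_iff)
qed

lemma rho1_measurable [measurable]: "rho 1 \<in> borel_measurable borel"
  unfolding rho_def[abs_def] by measurable

text \<open>The majorant must be integrable and free of \<open>\<epsilon>\<close>. The first term
  decays only like the third power of \<open>inverse (rho 1 t)\<close>, which is not integrable; a
  factor \<open>y\<close> taken out of it is paid for by \<open>y * exp (- y) \<le> 1\<close> and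
  yields the missing power.\<close>

lemma mollifier1_bounds:
  assumes "k > 0" "\<epsilon> > 0" "\<epsilon> \<le> 1"
  shows "0 \<le> mollifier1 k \<epsilon> t" "mollifier1 k \<epsilon> t \<le> (4 * k + 3) * inverse (rho 1 t) ^ 4"
proof -
  let ?r = "inverse (rho 1 t)" and ?E = "exp (- k * \<epsilon> * rho 1 t)"
  note r = rho1_ge[of t]
  show "0 \<le> mollifier1 k \<epsilon> t"
    using assms r by (simp add: mollifier1_def)
  define y where "y = k * \<epsilon> * rho 1 t"
  have y: "y \<ge> 0" using assms r by (simp add: y_def)
  have "y * exp (- y) \<le> 1"
  proof -
    have "y \<le> exp y" using exp_ge_add_one_self[of y] by linarith
    then show ?thesis by (simp add: exp_minus field_simps)
  qed
  moreover have "?E * (k\<^sup>2 * \<epsilon>\<^sup>2 * ?r ^ 3) = (y * exp (- y)) * (k * \<epsilon> * ?r ^ 4)"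
    using r by (simp add: y_def field_simps eval_nat_numeral)
  moreover have "k * \<epsilon> * ?r ^ 4 \<le> k * 1 * ?r ^ 4"
    using assms r by (intro mult_right_mono mult_left_mono) auto
  moreover have "(y * exp (- y)) * (k * \<epsilon> * ?r ^ 4) \<le> 1 * (k * \<epsilon> * ?r ^ 4)"
    using calculation(1) assms r by (intro mult_right_mono) auto
  ultimately have 1: "?E * (k\<^sup>2 * \<epsilon>\<^sup>2 * ?r ^ 3) \<le> k * ?r ^ 4" by simp
  have E: "?E \<le> 1" using assms r by simp
  have 2: "?E * (3 * k * \<epsilon> * ?r ^ 4) \<le> 1 * (3 * k * 1 * ?r ^ 4)"
    using E assms r by (intro mult_mono mult_right_mono mult_left_mono) auto
  have "?r ^ 5 \<le> ?r ^ 4" using r by (intro power_decreasing) auto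
  then have 3: "?E * (3 * ?r ^ 5) \<le> 1 * (3 * ?r ^ 4)"
    using E r by (intro mult_mono) auto
  show "mollifier1 k \<epsilon> t \<le> (4 * k + 3) * ?r ^ 4"
    unfolding mollifier1_def distrib_left using 1 2 3 by (simp add: algebra_simps)
qed

lemma integrable_rho4: "integrable lborel (\<lambda>t::R3. inverse (rho 1 t) ^ 4)"
proof (rule integrableI_bounded)
  obtain C' where "\<And>t. t > 0 \<Longrightarrow> (\<integral>\<^sup>+z. ennreal (norm (z::R3) powr - 4) * indicator (- ball 0 t) z \<partial>lborel) \<le> ennreal (C' * t powr (3 - 4))"
    by (rule nn_integral_outside_ball_powr[of 4]) (simp, blast)
  from this[of 1] obtain C where C: "(\<integral>\<^sup>+z. ennreal (norm (z::R3) powr - 4) * indicator (- ball 0 1) z \<partial>lborel) \<le> ennreal C"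
    by auto
  have "(\<integral>\<^sup>+t. ennreal (norm (inverse (rho 1 (t::R3)) ^ 4)) \<partial>lborel) \<le>
    (\<integral>\<^sup>+z. indicator (ball 0 1) z + ennreal (norm (z::R3) powr - 4) * indicator (- ball 0 1) z \<partial>lborel)"
  proof (intro nn_integral_mono)
    fix z :: R3
    note r = rho1_ge[of z]
    show "ennreal (norm (inverse (rho 1 z) ^ 4)) \<le> indicator (ball 0 1) z + ennreal (norm z powr - 4) * indicator (- ball 0 1) z"
    proof (cases "norm z < 1")
      case True
      have "inverse (rho 1 z) ^ 4 \<le> 1" using r by (intro power_le_one) auto
      then show ?thesis using True r by simp
    next
      case False
      then have "norm z > 0" by linarith
      have "inverse (rho 1 z) \<le> inverse (norm z)"
        using rho_ge_norm[of z 1] \<open>norm z > 0\<close> by (intro le_imp_inverse_le)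
      then have "inverse (rho 1 z) ^ 4 \<le> inverse (norm z) ^ 4"
        using r by (intro power_mono) auto
      also have "\<dots> = norm z powr - 4"
        using \<open>norm z > 0\<close> by (simp add: powr_neg_numeral inverse_eq_divide power_divide)
      finally show ?thesis using False r by (simp add: ennreal_leI)
    qed
  qed
  also have "\<dots> = emeasure lborel (ball 0 1 :: R3 set) + (\<integral>\<^sup>+z. ennreal (norm (z::R3) powr - 4) * indicator (- ball 0 1) z \<partial>lborel)"
    by (subst nn_integral_add) simp_all
  also have "\<dots> < \<infinity>"
    using le_less_trans[OF C ennreal_less_top] emeasure_lborel_ball_finite[of "0::R3" 1] by simp
  finally show "(\<integral>\<^sup>+t. ennreal (norm (inverse (rho 1 (t::R3)) ^ 4)) \<partial>lborel) < \<infinity>" .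
qed measurable

lemma integrable_rho5: "integrable lborel (\<lambda>t::R3. 3 * inverse (rho 1 t) ^ 5)"
proof (rule Bochner_Integration.integrable_bound)
  show "integrable lborel (\<lambda>t::R3. 3 * inverse (rho 1 t) ^ 4)"
    by (intro integrable_mult_right integrable_rho4)
  have "inverse (rho 1 t) ^ 5 \<le> inverse (rho 1 t) ^ 4" for t :: R3
    using rho1_ge[of t] by (intro power_decreasing) auto
  then show "AE t in lborel. norm (3 * inverse (rho 1 (t::R3)) ^ 5) \<le> norm (3 * inverse (rho 1 t) ^ 4)"
    using rho1_ge(3)[THEN less_imp_le] by (intro AE_I2) (simp add: abs_of_nonneg del: inverse_nonnegative_iff_nonnegative)
qed measurable

lemma mass_pos: "mass > 0"
proof -
  have "mass \<noteq> 0"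
  proof
    assume "mass = 0"
    then have "AE t in lborel. 3 * inverse (rho 1 (t::R3)) ^ 5 = 0"
      unfolding mass_def using integrable_rho5 rho1_ge
      by (subst (asm) integral_nonneg_eq_0_iff_AE) (auto intro!: AE_I2 zero_le_power less_imp_le[OF rho1_ge(3)] simp del: inverse_nonnegative_iff_nonnegative)
    moreover have "3 * inverse (rho 1 t) ^ 5 \<noteq> 0" for t using rho1_ge(3)[of t] by simp
    ultimately have "AE t::R3 in lborel. False" by simp
    then have "emeasure lborel (UNIV :: R3 set) = 0"
      by (subst (asm) AE_iff_measurable[OF _ refl]) auto
    then show False by (simp add: emeasure_lborel_UNIV)
  qed
  moreover have "mass \<ge> 0"
    unfolding mass_def using rho1_ge(3) by (intro integral_nonneg_AE AE_I2) (simp add: less_imp_le)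
  ultimately show ?thesis by simp
qed

section \<open>Removing the mollification\<close>

lemma AE_less_top_if_box_integrals:
  fixes F :: "R3 \<Rightarrow> ennreal"
  assumes [measurable]: "F \<in> borel_measurable borel"
    and fin: "\<And>a b. (\<integral>\<^sup>+x. F x * indicator (cbox a b) x \<partial>lborel) < \<infinity>"
  shows "AE x in lborel. F x < \<infinity>"
proof (rule AE_if_AE_boxes)
  fix n
  let ?a = "(\<chi> i. real n) :: R3"
  have "AE x in lborel. F x * indicator (cbox (- ?a) ?a) x \<noteq> \<infinity>"
    by (rule nn_integral_noteq_infinite) (use fin[of "- ?a" ?a] in \<open>auto simp: less_top\<close>)
  then show "AE x in lborel. x \<in> box (- ?a) ?a \<longrightarrow> F x < \<infinity>"
    by eventually_elim (auto simp: less_top dest: subsetD[OF box_subset_cbox])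
qed

text \<open>For \<open>h\<close> only the integrals over translates of a box are controlled,
  uniformly in the translation. This covers integrable and square integrable functions and their
  sums, and by Tonelli it still gives local integrability of the convolution.\<close>

lemma convolution_box_finite:
  fixes K h :: "R3 \<Rightarrow> real"
  assumes [measurable]: "K \<in> borel_measurable borel" "h \<in> borel_measurable borel"
    and K: "(\<integral>\<^sup>+z. ennreal (K z) \<partial>lborel) < \<infinity>"
    and h: "\<And>z. (\<integral>\<^sup>+x. ennreal (h x) * indicator (cbox a b) (x + z) \<partial>lborel) \<le> ennreal D"
  shows "(\<integral>\<^sup>+x. (\<integral>\<^sup>+y. ennreal (K (x - y)) * ennreal (h y) \<partial>lborel) * indicator (cbox a b) x \<partial>lborel) < \<infinity>"
proof -
  have "(\<integral>\<^sup>+x. (\<integral>\<^sup>+y. ennreal (K (x - y)) * ennreal (h y) \<partial>lborel) * indicator (cbox a b) x \<partial>lborel) =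
    (\<integral>\<^sup>+x. (\<integral>\<^sup>+z. ennreal (K z) * ennreal (h (x - z)) \<partial>lborel) * indicator (cbox a b) x \<partial>lborel)"
  proof (rule nn_integral_cong, rule arg_cong2[where f = "(*)", OF _ refl])
    fix x :: R3
    show "(\<integral>\<^sup>+y. ennreal (K (x - y)) * ennreal (h y) \<partial>lborel) = (\<integral>\<^sup>+z. ennreal (K z) * ennreal (h (x - z)) \<partial>lborel)"
      using lborel_nn_integral_reflect[of "\<lambda>z. ennreal (K z) * ennreal (h (x - z))" x] by simp
  qed
  also have "\<dots> = (\<integral>\<^sup>+x. (\<integral>\<^sup>+z. ennreal (K z) * ennreal (h (x - z)) * indicator (cbox a b) x \<partial>lborel) \<partial>lborel)"
    by (intro nn_integral_cong nn_integral_multc[symmetric]) measurable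
  also have "\<dots> = (\<integral>\<^sup>+z. (\<integral>\<^sup>+x. ennreal (K z) * ennreal (h (x - z)) * indicator (cbox a b) x \<partial>lborel) \<partial>lborel)"
    by (rule lborel_pair.Fubini') measurable
  also have "\<dots> = (\<integral>\<^sup>+z. ennreal (K z) * (\<integral>\<^sup>+x. ennreal (h (x - z)) * indicator (cbox a b) x \<partial>lborel) \<partial>lborel)"
    unfolding mult.assoc by (intro nn_integral_cong nn_integral_cmult) measurable
  also have "\<dots> \<le> (\<integral>\<^sup>+z. ennreal (K z) * ennreal D \<partial>lborel)"
  proof (intro nn_integral_mono mult_left_mono)
    fix z :: R3
    have "(\<integral>\<^sup>+x. ennreal (h (x - z)) * indicator (cbox a b) x \<partial>lborel) = (\<integral>\<^sup>+x. ennreal (h x) * indicator (cbox a b) (x + z) \<partial>lborel)"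
      using lborel_nn_integral_shift[of "\<lambda>x. ennreal (h x) * indicator (cbox a b) (x + z)" "- z"] by simp
    with h show "(\<integral>\<^sup>+x. ennreal (h (x - z)) * indicator (cbox a b) x \<partial>lborel) \<le> ennreal D" by simp
  qed auto
  also have "\<dots> = (\<integral>\<^sup>+z. ennreal (K z) \<partial>lborel) * ennreal D"
    by (rule nn_integral_multc) measurable
  also have "\<dots> < \<infinity>" using K by (simp add: ennreal_mult_less_top)
  finally show ?thesis .
qed

lemma mollifier1_tendsto:
  "(\<lambda>n. mollifier1 k (inverse (real (Suc n))) t) \<longlonglongrightarrow> 3 * inverse (rho 1 t) ^ 5"
proof -
  have "(\<lambda>n. mollifier1 k (inverse (real (Suc n))) t) \<longlonglongrightarrow> exp (- k * 0 * rho 1 t) *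
     (k\<^sup>2 * 0\<^sup>2 * inverse (rho 1 t) ^ 3 + 3 * k * 0 * inverse (rho 1 t) ^ 4 + 3 * inverse (rho 1 t) ^ 5)"
    unfolding mollifier1_def by (intro tendsto_intros LIMSEQ_inverse_real_of_nat)
  then show ?thesis by simp
qed

lemma mollifier1_measurable [measurable]: "mollifier1 k \<epsilon> \<in> borel_measurable borel"
  unfolding mollifier1_def[abs_def] by measurable

lemma mollifier_measurable [measurable]: "mollifier k \<epsilon> \<in> borel_measurable borel"
  unfolding mollifier_def[abs_def] rho_def by measurable

text \<open>The approximate identity is rescaled to \<open>mollifier1\<close> and moved onto the test function, so that
  only dominated convergence is needed.\<close>

lemma mollifier_test_limit:
  assumes k: "k > 0" and [measurable]: "u \<in> borel_measurable borel"
    and u: "integrable lborel (\<lambda>x. (u x)\<^sup>2)" and \<psi>: "test_function \<psi>"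
  shows "(\<lambda>n. LINT x|lborel. \<psi> x * (LINT y|lborel. u y * mollifier k (inverse (real (Suc n))) (y - x)))
    \<longlonglongrightarrow> mass * (LINT x|lborel. u x * \<psi> x)"
proof -
  define e where "e n = inverse (real (Suc n))" for n
  have e: "0 < e n" "e n \<le> 1" for n
    unfolding e_def by (auto simp: field_simps)
  have e0: "e \<longlonglongrightarrow> 0" unfolding e_def by (rule LIMSEQ_inverse_real_of_nat)
  have sm: "smooth \<psi>" using \<psi> by (simp add: test_function_iff)
  note [measurable] = smooth_measurable[OF sm]
  have \<psi>2: "integrable lborel (\<lambda>x. (\<psi> x)\<^sup>2)"
    using test_function_integrable[OF test_function_mult[OF \<psi> sm]] by (simp add: power2_eq_square)
  define I where "I s t = (LINT x|lborel. \<psi> x * u (x + s *\<^sub>R t))" for s t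
  define D where "D = (LINT x|lborel. (\<psi> x)\<^sup>2) + (LINT x|lborel. (u x)\<^sup>2)"
  have ush: "integrable lborel (\<lambda>x. (u (x + z))\<^sup>2)" for z
    using lborel_integrable_shift[OF u, of z] by (simp add: add.commute)
  have pu: "integrable lborel (\<lambda>x. \<psi> x * u (x + z))" for z
    by (rule integrable_mult_square[OF _ _ \<psi>2 ush]) measurable
  \<comment> \<open>The bound is independent of the shift \<open>z\<close> by translation
    invariance. It dominates the inner integral for all \<open>t\<close> and \<open>n\<close>, and
    the integrability in \<open>t\<close> comes from \<open>mollifier1\<close> alone.\<close>
  have J: "(LINT x|lborel. \<bar>\<psi> x * u (x + z)\<bar>) \<le> D" for z
  proof -
    have "(LINT x|lborel. \<bar>\<psi> x * u (x + z)\<bar>) \<le> (LINT x|lborel. (\<psi> x)\<^sup>2 + (u (x + z))\<^sup>2)"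
    proof (rule integral_mono)
      show "\<bar>\<psi> x * u (x + z)\<bar> \<le> (\<psi> x)\<^sup>2 + (u (x + z))\<^sup>2" for x by (rule abs_mult_le_squares)
    qed (use pu \<psi>2 ush in auto)
    also have "\<dots> = (LINT x|lborel. (\<psi> x)\<^sup>2) + (LINT x|lborel. (u (x + z))\<^sup>2)"
      by (rule Bochner_Integration.integral_add[OF \<psi>2 ush])
    also have "(LINT x|lborel. (u (x + z))\<^sup>2) = (LINT x|lborel. (u x)\<^sup>2)"
      using lborel_integral_shift[of "\<lambda>x. (u x)\<^sup>2" z] by (simp add: add.commute)
    finally show ?thesis by (simp add: D_def)
  qed
  have I_le: "\<bar>I s t\<bar> \<le> D" for s t
    using integral_abs_bound[of lborel "\<lambda>x. \<psi> x * u (x + s *\<^sub>R t)"] J[of "s *\<^sub>R t"] unfolding I_def by linarith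
  have swap: "(LINT x|lborel. \<psi> x * (LINT y|lborel. u y * mollifier k (e n) (y - x))) = (LINT t|lborel. mollifier1 k (e n) t * I (e n) t)" for n
  proof -
    have "(LINT y|lborel. u y * mollifier k (e n) (y - x)) = (LINT t|lborel. u (x + e n *\<^sub>R t) * mollifier1 k (e n) t)" for x
    proof -
      have "(LINT y|lborel. u y * mollifier k (e n) (y - x)) =
         \<bar>e n\<bar> ^ DIM(R3) * (LINT t|lborel. u (x + e n *\<^sub>R t) * mollifier k (e n) (x + e n *\<^sub>R t - x))"
        by (rule lborel_integral_affine) (use e[of n] in auto)
      also have "\<dots> = (LINT t|lborel. u (x + e n *\<^sub>R t) * (e n ^ 3 * mollifier k (e n) (e n *\<^sub>R t)))"
        using e(1)[of n]
        by (subst integral_mult_right_zero[symmetric]) (simp add: mult.left_commute)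
      finally show ?thesis by (simp add: mollifier_scale[OF e(1)])
    qed
    then have "(LINT x|lborel. \<psi> x * (LINT y|lborel. u y * mollifier k (e n) (y - x))) =
      (LINT x|lborel. (LINT t|lborel. mollifier1 k (e n) t * (\<psi> x * u (x + e n *\<^sub>R t))))"
      by (simp only: integral_mult_right_zero[symmetric] mult_ac)
    also have "\<dots> = (LINT t|lborel. (LINT x|lborel. mollifier1 k (e n) t * (\<psi> x * u (x + e n *\<^sub>R t))))"
    proof (rule lborel_pair.Fubini_integral)
      show "integrable (lborel \<Otimes>\<^sub>M lborel) (\<lambda>(t, x). mollifier1 k (e n) t * (\<psi> x * u (x + e n *\<^sub>R t)))"
      proof (rule lborel_pair.Fubini_integrable)
        show "integrable lborel (\<lambda>t. LINT x|lborel. norm (case (t, x) of (t, x) \<Rightarrow> mollifier1 k (e n) t * (\<psi> x * u (x + e n *\<^sub>R t))))"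
        proof (rule Bochner_Integration.integrable_bound)
          show "integrable lborel (\<lambda>t::R3. (4 * k + 3) * inverse (rho 1 t) ^ 4 * D)"
            by (intro integrable_mult_left integrable_mult_right integrable_rho4)
          show "AE t in lborel. norm (LINT x|lborel. norm (case (t, x) of (t, x) \<Rightarrow> mollifier1 k (e n) t * (\<psi> x * u (x + e n *\<^sub>R t)))) \<le>
             norm ((4 * k + 3) * inverse (rho 1 t) ^ 4 * D)"
          proof (intro AE_I2)
            fix t :: R3
            note b = mollifier1_bounds[OF k e(1,2)[of n], of t]
            have "(LINT x|lborel. norm (case (t, x) of (t, x) \<Rightarrow> mollifier1 k (e n) t * (\<psi> x * u (x + e n *\<^sub>R t)))) =
               mollifier1 k (e n) t * (LINT x|lborel. \<bar>\<psi> x * u (x + e n *\<^sub>R t)\<bar>)"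
              using b by (simp add: abs_mult)
            moreover have "0 \<le> (LINT x|lborel. \<bar>\<psi> x * u (x + e n *\<^sub>R t)\<bar>)" by simp
            moreover have "mollifier1 k (e n) t * (LINT x|lborel. \<bar>\<psi> x * u (x + e n *\<^sub>R t)\<bar>) \<le> (4 * k + 3) * inverse (rho 1 t) ^ 4 * D"
              using b J[of "e n *\<^sub>R t"] by (intro mult_mono) auto
            ultimately show "norm (LINT x|lborel. norm (case (t, x) of (t, x) \<Rightarrow> mollifier1 k (e n) t * (\<psi> x * u (x + e n *\<^sub>R t)))) \<le>
             norm ((4 * k + 3) * inverse (rho 1 t) ^ 4 * D)"
              using b by (simp only: real_norm_def abs_of_nonneg mult_nonneg_nonneg)
          qed
        qed measurable
        show "AE t in lborel. integrable lborel (\<lambda>x. case (t, x) of (t, x) \<Rightarrow> mollifier1 k (e n) t * (\<psi> x * u (x + e n *\<^sub>R t)))"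
          using pu by simp
      qed measurable
    qed
    also have "\<dots> = (LINT t|lborel. mollifier1 k (e n) t * I (e n) t)"
      unfolding I_def by simp
    finally show ?thesis .
  qed
  have I_lim: "(\<lambda>n. I (e n) t) \<longlonglongrightarrow> (LINT x|lborel. u x * \<psi> x)" for t
  proof -
    obtain B where B: "B > 0" "\<And>x. \<bar>\<psi> x\<bar> \<le> B" using test_function_bounded[OF \<psi>] by blast
    obtain R where R: "R > 0" "\<And>x. norm x > R \<Longrightarrow> \<psi> x = 0" using test_function_support[OF \<psi>] by blast
    have eq: "I (e n) t = (LINT y|lborel. u y * \<psi> (y - e n *\<^sub>R t))" for n
      unfolding I_def
      using lborel_integral_shift[of "\<lambda>y. u y * \<psi> (y - e n *\<^sub>R t)" "e n *\<^sub>R t"] by (simp add: mult.commute add.commute)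
    obtain a where a: "cball 0 (R + norm t) \<subseteq> cbox (- a) (a :: R3)"
      using bounded_subset_cbox_symmetric[OF bounded_cball] by blast
    show ?thesis
      unfolding eq
    proof (rule integral_dominated_convergence)
      show "integrable lborel (\<lambda>y. B * norm (indicator (cbox (- a) a) y *\<^sub>R u y))"
        using set_integrable_square[OF assms(2) u, of "- a" a] unfolding set_integrable_def
        by (intro integrable_mult_right integrable_norm)
      show "AE y in lborel. norm (u y * \<psi> (y - e n *\<^sub>R t)) \<le> B * norm (indicator (cbox (- a) a) y *\<^sub>R u y)" for n
      proof (intro AE_I2)
        fix y
        show "norm (u y * \<psi> (y - e n *\<^sub>R t)) \<le> B * norm (indicator (cbox (- a) a) y *\<^sub>R u y)"
        proof (cases "y \<in> cbox (- a) a")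
          case True
          then show ?thesis
            using mult_left_mono[OF B(2)[of "y - e n *\<^sub>R t"], of "\<bar>u y\<bar>"] by (simp add: abs_mult mult.commute)
        next
          case False
          then have "norm y > R + norm t" using a by (auto simp: not_less[symmetric])
          moreover have "norm (e n *\<^sub>R t) \<le> norm t" using e[of n] by (simp add: mult_left_le_one_le)
          moreover have "norm y \<le> norm (y - e n *\<^sub>R t) + norm (e n *\<^sub>R t)"
            using norm_triangle_ineq[of "y - e n *\<^sub>R t" "e n *\<^sub>R t"] by simp
          ultimately have "norm (y - e n *\<^sub>R t) > R" by linarith
          then show ?thesis using R False by simp
        qed
      qed
      show "AE y in lborel. (\<lambda>n. u y * \<psi> (y - e n *\<^sub>R t)) \<longlonglongrightarrow> u y * \<psi> y"
      proof (intro AE_I2 tendsto_mult tendsto_const)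
        fix y
        have "(\<lambda>n. y - e n *\<^sub>R t) \<longlonglongrightarrow> y - 0 *\<^sub>R t" by (intro tendsto_intros e0)
        then have "(\<lambda>n. y - e n *\<^sub>R t) \<longlonglongrightarrow> y" by simp
        then show "(\<lambda>n. \<psi> (y - e n *\<^sub>R t)) \<longlonglongrightarrow> \<psi> y"
          using smooth_continuous[OF sm, of UNIV] by (auto intro: continuous_on_tendsto_compose)
      qed
    qed measurable
  qed
  have A: "(\<lambda>n. LINT t|lborel. mollifier1 k (e n) t * I (e n) t) \<longlonglongrightarrow> (LINT t|lborel. (3 * inverse (rho 1 t) ^ 5) * (LINT x|lborel. u x * \<psi> x))"
  proof (rule integral_dominated_convergence)
    show "integrable lborel (\<lambda>t::R3. (4 * k + 3) * inverse (rho 1 t) ^ 4 * D)"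
      by (intro integrable_mult_left integrable_mult_right integrable_rho4)
    show "AE t in lborel. (\<lambda>n. mollifier1 k (e n) t * I (e n) t) \<longlonglongrightarrow> (3 * inverse (rho 1 t) ^ 5) * (LINT x|lborel. u x * \<psi> x)"
      by (intro AE_I2 tendsto_mult I_lim) (simp only: e_def mollifier1_tendsto)
    show "AE t in lborel. norm (mollifier1 k (e n) t * I (e n) t) \<le> (4 * k + 3) * inverse (rho 1 t) ^ 4 * D" for n
    proof (intro AE_I2)
      fix t
      have "\<bar>mollifier1 k (e n) t\<bar> * \<bar>I (e n) t\<bar> \<le> (4 * k + 3) * inverse (rho 1 t) ^ 4 * D"
        using mollifier1_bounds[OF k e(1,2)[of n], of t] I_le[of "e n" t] by (intro mult_mono) auto
      then show "norm (mollifier1 k (e n) t * I (e n) t) \<le> (4 * k + 3) * inverse (rho 1 t) ^ 4 * D"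
        by (simp add: abs_mult)
    qed
    show "(\<lambda>t. mollifier1 k (e n) t * I (e n) t) \<in> borel_measurable lborel" for n
      unfolding I_def by measurable
  qed measurable
  have B: "(LINT t|lborel. (3 * inverse (rho 1 (t::R3)) ^ 5) * (LINT x|lborel. u x * \<psi> x)) = mass * (LINT x|lborel. u x * \<psi> x)"
    unfolding mass_def by (rule integral_mult_left_zero)
  show ?thesis
    using A unfolding B swap[symmetric] unfolding e_def .
qed

lemma integrable_real_kernel:
  fixes K h :: "R3 \<Rightarrow> real"
  assumes [measurable]: "K \<in> borel_measurable borel" "h \<in> borel_measurable borel"
    and nn: "\<And>z. 0 \<le> K z" "\<And>z. 0 \<le> h z"
    and fin: "(\<integral>\<^sup>+y. ennreal (K (x - y)) * ennreal (h y) \<partial>lborel) < \<infinity>"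
  shows "integrable lborel (\<lambda>y. K (x - y) * h y)"
    "(LINT y|lborel. K (x - y) * h y) = enn2real (\<integral>\<^sup>+y. ennreal (K (x - y)) * ennreal (h y) \<partial>lborel)"
proof -
  have eq: "(\<integral>\<^sup>+y. ennreal (K (x - y)) * ennreal (h y) \<partial>lborel) = (\<integral>\<^sup>+y. ennreal (K (x - y) * h y) \<partial>lborel)"
    using nn by (simp add: ennreal_mult')
  show "integrable lborel (\<lambda>y. K (x - y) * h y)"
    by (rule integrableI_nonneg) (use nn fin eq in auto)
  show "(LINT y|lborel. K (x - y) * h y) = enn2real (\<integral>\<^sup>+y. ennreal (K (x - y)) * ennreal (h y) \<partial>lborel)"
    unfolding eq by (rule integral_eq_nn_integral) (use nn in auto)
qed

lemma integral_dominated: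
  fixes f g :: "'a \<Rightarrow> real"
  assumes [measurable]: "f \<in> borel_measurable M" and g: "integrable M g" and le: "AE y in M. \<bar>f y\<bar> \<le> g y"
  shows "integrable M f" "\<bar>LINT y|M. f y\<bar> \<le> (LINT y|M. g y)"
proof -
  show i: "integrable M f"
    by (rule Bochner_Integration.integrable_bound[OF g]) (use le in \<open>auto elim: eventually_mono\<close>)
  have "\<bar>LINT y|M. f y\<bar> \<le> (LINT y|M. \<bar>f y\<bar>)" by (rule integral_abs_bound)
  also have "\<dots> \<le> (LINT y|M. g y)" by (intro integral_mono_AE) (use i g le in auto)
  finally show "\<bar>LINT y|M. f y\<bar> \<le> (LINT y|M. g y)" .
qed

text \<open>One limit passage serves both the Sobolev estimate and the equation. The left-hand side
  of \<open>eq\<close> converges only when tested against a function \<open>\<psi>\<close>, the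
  right-hand side converges at almost every point under the majorant \<open>K (x - y) * h y\<close>;
  comparing the two against all test functions identifies the limits.\<close>

lemma mollified_representation:
  fixes u K h :: "R3 \<Rightarrow> real" and Q :: "nat \<Rightarrow> R3 \<Rightarrow> R3 \<Rightarrow> real"
  assumes k: "k > 0" and u_meas [measurable]: "u \<in> borel_measurable borel" and u: "integrable lborel (\<lambda>x. (u x)\<^sup>2)"
    and [measurable]: "K \<in> borel_measurable borel" "h \<in> borel_measurable borel"
    and nn: "\<And>z. 0 \<le> K z" "\<And>z. 0 \<le> h z"
    and K: "(\<integral>\<^sup>+z. ennreal (K z) \<partial>lborel) < \<infinity>"
    and h: "\<And>a b. \<exists>D. \<forall>z. (\<integral>\<^sup>+x. ennreal (h x) * indicator (cbox a b) (x + z) \<partial>lborel) \<le> ennreal D"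
    and [measurable]: "\<And>n. (\<lambda>(x, y). Q n x y) \<in> borel_measurable (lborel \<Otimes>\<^sub>M lborel)"
      "(\<lambda>(x, y). Q' x y) \<in> borel_measurable (lborel \<Otimes>\<^sub>M lborel)"
    and lim: "\<And>x y. x \<noteq> y \<Longrightarrow> (\<lambda>n. Q n x y) \<longlonglongrightarrow> Q' x y"
    and bd: "\<And>n x y. x \<noteq> y \<Longrightarrow> \<bar>Q n x y\<bar> \<le> K (x - y) * h y"
    and eq: "\<And>n x. (LINT y|lborel. u y * mollifier k (inverse (real (Suc n))) (y - x)) = (LINT y|lborel. Q n x y)"
  shows "AE x in lborel. mass * u x = (LINT y|lborel. Q' x y)"
    and "AE x in lborel. ennreal (mass * \<bar>u x\<bar>) \<le> (\<integral>\<^sup>+y. ennreal (K (x - y)) * ennreal (h y) \<partial>lborel)"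
proof -
  \<comment> \<open>The convolution may be infinite on a null set. Its real version \<open>F\<close>
    is locally integrable, which is what permits dominated convergence against a test
    function.\<close>
  define \<Phi> where "\<Phi> x = (\<integral>\<^sup>+y. ennreal (K (x - y)) * ennreal (h y) \<partial>lborel)" for x
  define F where "F x = enn2real (\<Phi> x)" for x
  define W where "W n x = (LINT y|lborel. Q n x y)" for n x
  define W' where "W' x = (LINT y|lborel. Q' x y)" for x
  have \<Phi>_meas [measurable]: "\<Phi> \<in> borel_measurable borel"
    unfolding \<Phi>_def by measurable
  have [measurable]: "F \<in> borel_measurable borel" "W' \<in> borel_measurable borel" "\<And>n. W n \<in> borel_measurable borel"
    unfolding F_def W_def W'_def by measurable
  have fin: "(\<integral>\<^sup>+x. \<Phi> x * indicator (cbox a b) x \<partial>lborel) < \<infinity>" for a b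
  proof -
    obtain D where "\<And>z. (\<integral>\<^sup>+x. ennreal (h x) * indicator (cbox a b) (x + z) \<partial>lborel) \<le> ennreal D"
      using h by blast
    from convolution_box_finite[OF _ _ K this] show ?thesis unfolding \<Phi>_def by simp
  qed
  have AE_fin: "AE x in lborel. \<Phi> x < \<infinity>"
    by (rule AE_less_top_if_box_integrals[OF \<Phi>_meas fin])
  have F_box: "set_integrable lborel (cbox a b) F" for a b
    unfolding set_integrable_def
  proof (rule integrableI_bounded)
    have "(\<integral>\<^sup>+x. ennreal (norm (indicat_real (cbox a b) x *\<^sub>R F x)) \<partial>lborel) \<le> (\<integral>\<^sup>+x. \<Phi> x * indicator (cbox a b) x \<partial>lborel)"
      by (intro nn_integral_mono) (auto simp: F_def indicator_def ennreal_enn2real_if)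
    then show "(\<integral>\<^sup>+x. ennreal (norm (indicat_real (cbox a b) x *\<^sub>R F x)) \<partial>lborel) < \<infinity>"
      using fin[of a b] by (rule le_less_trans)
  qed measurable
  \<comment> \<open>The kernels are singular on the diagonal, so limit and majorant are required
    only for \<open>x \<noteq> y\<close>; in the integral over \<open>y\<close> this excludes a
    single point.\<close>
  have AE_ne: "AE y in lborel. x \<noteq> y" for x :: R3
    using AE_lborel_singleton[of x] by eventually_elim auto
  have bd': "\<bar>Q' x y\<bar> \<le> K (x - y) * h y" if "x \<noteq> y" for x y
    using tendsto_rabs[OF lim[OF that]] bd[OF that] by (intro LIMSEQ_le_const2[of "\<lambda>n. \<bar>Q n x y\<bar>"]) auto
  have dom: "\<bar>W n x\<bar> \<le> F x" "\<bar>W' x\<bar> \<le> F x" "(\<lambda>n. W n x) \<longlonglongrightarrow> W' x" if fx: "\<Phi> x < \<infinity>" for x n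
  proof -
    note i = integrable_real_kernel[OF assms(4,5) nn fx[unfolded \<Phi>_def]]
    have AE1: "AE y in lborel. \<bar>Q n x y\<bar> \<le> K (x - y) * h y" for n
      using AE_ne[of x] by eventually_elim (rule bd)
    have AE2: "AE y in lborel. \<bar>Q' x y\<bar> \<le> K (x - y) * h y"
      using AE_ne[of x] by eventually_elim (rule bd')
    show "\<bar>W n x\<bar> \<le> F x"
      using integral_dominated(2)[OF _ i(1) AE1[of n]] i(2) unfolding W_def F_def \<Phi>_def by simp
    show "\<bar>W' x\<bar> \<le> F x"
      using integral_dominated(2)[OF _ i(1) AE2] i(2) unfolding W'_def F_def \<Phi>_def by simp
    show "(\<lambda>n. W n x) \<longlonglongrightarrow> W' x"
      unfolding W_def W'_def
    proof (rule integral_dominated_convergence[OF _ _ i(1)])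
      show "AE y in lborel. (\<lambda>n. Q n x y) \<longlonglongrightarrow> Q' x y"
        using AE_ne[of x] by eventually_elim (rule lim)
      show "AE y in lborel. norm (Q n x y) \<le> K (x - y) * h y" for n
        using AE1 by simp
    qed measurable
  qed
  have W'_box: "set_integrable lborel (cbox a b) W'" for a b
    unfolding set_integrable_def
  proof (rule Bochner_Integration.integrable_bound[OF F_box[unfolded set_integrable_def]])
    show "AE x in lborel. norm (indicat_real (cbox a b) x *\<^sub>R W' x) \<le> norm (indicat_real (cbox a b) x *\<^sub>R F x)"
      using AE_fin
    proof eventually_elim
      case (elim x)
      from dom(2)[OF elim] show ?case by (auto simp: indicator_def)
    qed
  qed measurable
  have "AE x in lborel. mass * u x - W' x = 0"
  proof (rule AE_zero_if_test_integrals_zero)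
    have ub: "set_integrable lborel (cbox a b) (\<lambda>x. mass * u x)" for a b
      by (intro set_integrable_mult_right set_integrable_square u) measurable
    show "set_integrable lborel (cbox a b) (\<lambda>x. mass * u x - W' x)" for a b
      by (intro set_integral_diff ub W'_box)
    show "(\<lambda>x. mass * u x - W' x) \<in> borel_measurable borel" by measurable
    fix \<psi> assume \<psi>: "test_function \<psi>"
    have [measurable]: "\<psi> \<in> borel_measurable borel"
      using \<psi> by (intro smooth_measurable) (simp add: test_function_iff)
    have "(\<lambda>n. LINT x|lborel. \<psi> x * W n x) \<longlonglongrightarrow> (LINT x|lborel. \<psi> x * W' x)"
    proof (rule integral_dominated_convergence)
      show "integrable lborel (\<lambda>x. \<bar>F x * \<psi> x\<bar>)"
        by (intro integrable_abs test_function_integrable_mult[OF \<psi> F_box]) measurable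
      show "AE x in lborel. (\<lambda>n. \<psi> x * W n x) \<longlonglongrightarrow> \<psi> x * W' x"
        using AE_fin by eventually_elim (intro tendsto_mult tendsto_const dom(3))
      show "AE x in lborel. norm (\<psi> x * W n x) \<le> \<bar>F x * \<psi> x\<bar>" for n
        using AE_fin
      proof eventually_elim
        case (elim x)
        have "\<bar>\<psi> x\<bar> * \<bar>W n x\<bar> \<le> \<bar>\<psi> x\<bar> * F x" using dom(1)[OF elim] by (intro mult_left_mono) auto
        then show ?case by (simp add: abs_mult mult.commute F_def)
      qed
    qed measurable
    moreover have "(\<lambda>n. LINT x|lborel. \<psi> x * W n x) \<longlonglongrightarrow> mass * (LINT x|lborel. u x * \<psi> x)"
      using mollifier_test_limit[OF k u_meas u \<psi>] unfolding eq W_def .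
    ultimately have "(LINT x|lborel. \<psi> x * W' x) = mass * (LINT x|lborel. u x * \<psi> x)"
      by (rule LIMSEQ_unique)
    moreover have "(LINT x|lborel. (mass * u x - W' x) * \<psi> x) = (LINT x|lborel. mass * u x * \<psi> x) - (LINT x|lborel. W' x * \<psi> x)"
      unfolding left_diff_distrib
      by (intro Bochner_Integration.integral_diff test_function_integrable_mult[OF \<psi>] ub W'_box) measurable
    moreover have "(LINT x|lborel. mass * u x * \<psi> x) = mass * (LINT x|lborel. u x * \<psi> x)"
      unfolding mult.assoc by simp
    ultimately show "(LINT x|lborel. (mass * u x - W' x) * \<psi> x) = 0"
      by (simp add: mult.commute)
  qed
  then have AE_eq: "AE x in lborel. mass * u x = W' x" by simp
  then show "AE x in lborel. mass * u x = (LINT y|lborel. Q' x y)" by (simp add: W'_def)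
  from AE_eq AE_fin
  show "AE x in lborel. ennreal (mass * \<bar>u x\<bar>) \<le> (\<integral>\<^sup>+y. ennreal (K (x - y)) * ennreal (h y) \<partial>lborel)"
  proof eventually_elim
    case (elim x)
    have "mass * \<bar>u x\<bar> \<le> F x"
      using dom(2)[OF elim(2)] mass_pos by (simp add: elim(1)[symmetric] abs_mult)
    then have "ennreal (mass * \<bar>u x\<bar>) \<le> ennreal (F x)" by (rule ennreal_leI)
    also have "\<dots> = \<Phi> x" using elim(2) by (simp add: F_def)
    finally show ?case by (simp add: \<Phi>_def)
  qed
qed

section \<open>Sobolev integrability\<close>

text \<open>The Cauchy-Schwarz inequality for the measure with density \<open>K\<close>, obtained by
  writing \<open>K\<close> as a product of square roots. A small total mass of \<open>K\<close> then
  acts as a contraction constant.\<close>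

lemma nn_integral_weighted_Cauchy_Schwarz:
  fixes K h :: "'a \<Rightarrow> real"
  assumes [measurable]: "K \<in> borel_measurable M" "h \<in> borel_measurable M"
    and nn: "\<And>z. 0 \<le> K z" "\<And>z. 0 \<le> h z"
  shows "(\<integral>\<^sup>+z. ennreal (K z) * ennreal (h z) \<partial>M)\<^sup>2 \<le> (\<integral>\<^sup>+z. ennreal (K z) \<partial>M) * (\<integral>\<^sup>+z. ennreal (K z) * ennreal ((h z)\<^sup>2) \<partial>M)"
proof -
  have "(\<integral>\<^sup>+z. ennreal (sqrt (K z)) * ennreal (sqrt (K z) * h z) \<partial>M)\<^sup>2 \<le>
    (\<integral>\<^sup>+z. (ennreal (sqrt (K z)))\<^sup>2 \<partial>M) * (\<integral>\<^sup>+z. (ennreal (sqrt (K z) * h z))\<^sup>2 \<partial>M)"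
    by (rule Cauchy_Schwarz_nn_integral) measurable
  also have "(\<lambda>z. ennreal (sqrt (K z)) * ennreal (sqrt (K z) * h z)) = (\<lambda>z. ennreal (K z) * ennreal (h z))"
  proof
    fix z
    have "ennreal (sqrt (K z)) * ennreal (sqrt (K z) * h z) = ennreal (sqrt (K z) * (sqrt (K z) * h z))"
      by (rule ennreal_mult'[symmetric]) (simp add: nn)
    also have "sqrt (K z) * (sqrt (K z) * h z) = K z * h z"
      unfolding mult.assoc[symmetric] by (simp add: nn)
    also have "ennreal (K z * h z) = ennreal (K z) * ennreal (h z)"
      by (rule ennreal_mult') (rule nn)
    finally show "ennreal (sqrt (K z)) * ennreal (sqrt (K z) * h z) = ennreal (K z) * ennreal (h z)" .
  qed
  also have "(\<lambda>z. (ennreal (sqrt (K z)))\<^sup>2) = (\<lambda>z. ennreal (K z))"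
    using nn by (simp add: ennreal_power)
  also have "(\<lambda>z. (ennreal (sqrt (K z) * h z))\<^sup>2) = (\<lambda>z. ennreal (K z) * ennreal ((h z)\<^sup>2))"
    using nn by (simp add: ennreal_power power_mult_distrib ennreal_mult')
  finally show ?thesis .
qed

lemma nn_integral_convolution:
  fixes K h :: "R3 \<Rightarrow> ennreal"
  assumes [measurable]: "K \<in> borel_measurable borel" "h \<in> borel_measurable borel"
  shows "(\<integral>\<^sup>+x. (\<integral>\<^sup>+y. K (x - y) * h y \<partial>lborel) \<partial>lborel) = (\<integral>\<^sup>+z. K z \<partial>lborel) * (\<integral>\<^sup>+y. h y \<partial>lborel)"
proof -
  have "(\<integral>\<^sup>+x. (\<integral>\<^sup>+y. K (x - y) * h y \<partial>lborel) \<partial>lborel) = (\<integral>\<^sup>+y. (\<integral>\<^sup>+x. K (x - y) * h y \<partial>lborel) \<partial>lborel)"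
    by (rule lborel_pair.Fubini') measurable
  also have "\<dots> = (\<integral>\<^sup>+y. (\<integral>\<^sup>+z. K z \<partial>lborel) * h y \<partial>lborel)"
  proof (rule nn_integral_cong)
    fix y :: R3
    have "(\<integral>\<^sup>+x. K (x - y) * h y \<partial>lborel) = (\<integral>\<^sup>+x. K (x - y) \<partial>lborel) * h y"
      by (rule nn_integral_multc) measurable
    also have "(\<integral>\<^sup>+x. K (x - y) \<partial>lborel) = (\<integral>\<^sup>+z. K z \<partial>lborel)"
      using lborel_nn_integral_shift[of K "- y"] by simp
    finally show "(\<integral>\<^sup>+x. K (x - y) * h y \<partial>lborel) = (\<integral>\<^sup>+z. K z \<partial>lborel) * h y" .
  qed
  also have "\<dots> = (\<integral>\<^sup>+z. K z \<partial>lborel) * (\<integral>\<^sup>+y. h y \<partial>lborel)"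
    by (rule nn_integral_cmult) measurable
  finally show ?thesis .
qed

lemma ennreal_square_le_imp:
  fixes a :: ennreal assumes "a\<^sup>2 \<le> ennreal (b\<^sup>2)" "0 \<le> b" shows "a \<le> ennreal b"
proof (cases a)
  case (real r)
  with assms(1) have "r\<^sup>2 \<le> b\<^sup>2" by (simp add: ennreal_power)
  then have "r \<le> b" by (rule power2_le_imp_le) (rule assms(2))
  with real show ?thesis by (simp add: ennreal_leI)
next
  case top
  with assms show ?thesis by (simp add: top_unique)
qed

text \<open>Splitting the kernel at the radius \<open>t\<close>: the outer part is bounded by \<open>t powr (- 1/2)\<close>, the inner part
  has \<open>L\<^sup>2\<close> norm at most a multiple of \<open>t\<close>. This gives the weak \<open>L\<^sup>6\<close> bound.\<close>

lemma weak_L6_bound: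
  fixes u h :: "R3 \<Rightarrow> real"
  assumes [measurable]: "u \<in> borel_measurable borel" "h \<in> borel_measurable borel"
    and h: "\<And>x. 0 \<le> h x" "(\<integral>\<^sup>+x. ennreal ((h x)\<^sup>2) \<partial>lborel) \<le> ennreal H" and H: "H > 0" and m: "m > 0"
    and uh: "AE x in lborel. ennreal (m * \<bar>u x\<bar>) \<le> (\<integral>\<^sup>+y. ennreal (norm (x - y) powr - 2) * ennreal (h y) \<partial>lborel)"
  obtains C where "C > 0" "\<And>s. s > 0 \<Longrightarrow> emeasure lborel {x. \<bar>u x\<bar> > s} \<le> ennreal (C / s ^ 6)"
proof -
  obtain C2 where C2: "C2 > 0"
    "\<And>t. t > 0 \<Longrightarrow> (\<integral>\<^sup>+z. ennreal (norm (z::R3) powr - 2) * indicator (ball 0 t) z \<partial>lborel) \<le> ennreal (C2 * t powr (3 - 2))"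
    by (rule nn_integral_ball_powr[of 2]) (simp, simp, blast)
  obtain C4 where C4: "C4 > 0"
    "\<And>t. t > 0 \<Longrightarrow> (\<integral>\<^sup>+z. ennreal (norm (z::R3) powr - 4) * indicator (- ball 0 t) z \<partial>lborel) \<le> ennreal (C4 * t powr (3 - 4))"
    by (rule nn_integral_outside_ball_powr[of 4]) (simp, blast)
  \<comment> \<open>With \<open>t = T / s\<^sup>2\<close> the Cauchy-Schwarz bound
    \<open>C4 * H / t\<close> on the squared outer part equals \<open>(m * s / 2)\<^sup>2\<close>.
    Wherever \<open>\<bar>u x\<bar> > s\<close>, the inner part must therefore supply the other half
    of \<open>m * s\<close>.\<close>
  define T where "T = 4 * C4 * H / m\<^sup>2"
  have T: "T > 0" using C4 H m by (simp add: T_def)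
  define C where "C = C2\<^sup>2 * T\<^sup>2 * H * (4 / m\<^sup>2)"
  have bound: "emeasure lborel {x. \<bar>u x\<bar> > s} \<le> ennreal (C / s ^ 6)" if s: "s > 0" for s
  proof -
    define t where "t = T / s\<^sup>2"
    have t: "t > 0" using T s by (simp add: t_def)
    define K1 where "K1 z = norm (z::R3) powr - 2 * indicator (ball 0 t) z" for z
    define K2 where "K2 z = norm (z::R3) powr - 2 * indicator (- ball 0 t) z" for z
    define N where "N x = (\<integral>\<^sup>+y. ennreal (K1 (x - y)) * ennreal (h y) \<partial>lborel)" for x
    have [measurable]: "K1 \<in> borel_measurable borel" "K2 \<in> borel_measurable borel"
      unfolding K1_def K2_def by measurable
    have [measurable]: "N \<in> borel_measurable borel" unfolding N_def by measurable
    have nn: "0 \<le> K1 z" "0 \<le> K2 z" for z by (auto simp: K1_def K2_def)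
    have far: "(\<integral>\<^sup>+y. ennreal (K2 (x - y)) * ennreal (h y) \<partial>lborel) \<le> ennreal (m * s / 2)" for x
    proof -
      have "(\<integral>\<^sup>+y. ennreal (K2 (x - y)) * ennreal (h y) \<partial>lborel)\<^sup>2 \<le>
        (\<integral>\<^sup>+y. (ennreal (K2 (x - y)))\<^sup>2 \<partial>lborel) * (\<integral>\<^sup>+y. (ennreal (h y))\<^sup>2 \<partial>lborel)"
        by (rule Cauchy_Schwarz_nn_integral) measurable
      also have "(\<integral>\<^sup>+y. (ennreal (K2 (x - y)))\<^sup>2 \<partial>lborel) = (\<integral>\<^sup>+y. (ennreal (K2 y))\<^sup>2 \<partial>lborel)"
        using lborel_nn_integral_reflect[of "\<lambda>y. (ennreal (K2 y))\<^sup>2" x] by simp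
      also have "(\<integral>\<^sup>+y. (ennreal (K2 y))\<^sup>2 \<partial>lborel) = (\<integral>\<^sup>+z. ennreal (norm (z::R3) powr - 4) * indicator (- ball 0 t) z \<partial>lborel)"
      proof (rule nn_integral_cong)
        fix z :: R3
        have "(norm z powr - 2)\<^sup>2 = norm z powr - 4"
          by (simp add: power2_eq_square powr_add[symmetric])
        then show "(ennreal (K2 z))\<^sup>2 = ennreal (norm z powr - 4) * indicator (- ball 0 t) z"
          by (auto simp: K2_def indicator_def ennreal_power)
      qed
      also have "(\<integral>\<^sup>+y. (ennreal (h y))\<^sup>2 \<partial>lborel) = (\<integral>\<^sup>+y. ennreal ((h y)\<^sup>2) \<partial>lborel)"
        using h by (simp add: ennreal_power)
      also have "(\<integral>\<^sup>+z. ennreal (norm (z::R3) powr - 4) * indicator (- ball 0 t) z \<partial>lborel) * (\<integral>\<^sup>+y. ennreal ((h y)\<^sup>2) \<partial>lborel) \<le>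
         ennreal (C4 * t powr (3 - 4)) * ennreal H"
        by (intro mult_mono C4(2) t h) auto
      also have "\<dots> = ennreal ((m * s / 2)\<^sup>2)"
        using t C4 H s m by (simp add: ennreal_mult'[symmetric] powr_minus t_def T_def field_simps power2_eq_square)
      finally show ?thesis by (rule ennreal_square_le_imp) (use m s in simp)
    qed
    have near: "(\<integral>\<^sup>+x. (N x)\<^sup>2 \<partial>lborel) \<le> ennreal (C2\<^sup>2 * t\<^sup>2 * H)"
    proof -
      have K1: "(\<integral>\<^sup>+z. ennreal (K1 z) \<partial>lborel) \<le> ennreal (C2 * t)"
        using C2(2)[OF t] t by (simp add: K1_def ennreal_mult' ennreal_indicator[symmetric] mult.commute)
      have K1x: "(\<integral>\<^sup>+y. ennreal (K1 (x - y)) \<partial>lborel) = (\<integral>\<^sup>+z. ennreal (K1 z) \<partial>lborel)" for x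
        using lborel_nn_integral_reflect[of "\<lambda>y. ennreal (K1 y)" x] by simp
      have "(\<integral>\<^sup>+x. (N x)\<^sup>2 \<partial>lborel) \<le> (\<integral>\<^sup>+x. (\<integral>\<^sup>+z. ennreal (K1 z) \<partial>lborel) * (\<integral>\<^sup>+y. ennreal (K1 (x - y)) * ennreal ((h y)\<^sup>2) \<partial>lborel) \<partial>lborel)"
      proof (rule nn_integral_mono)
        fix x
        have "(N x)\<^sup>2 \<le> (\<integral>\<^sup>+y. ennreal (K1 (x - y)) \<partial>lborel) * (\<integral>\<^sup>+y. ennreal (K1 (x - y)) * ennreal ((h y)\<^sup>2) \<partial>lborel)"
          unfolding N_def by (rule nn_integral_weighted_Cauchy_Schwarz) (use nn h in simp_all)
        then show "(N x)\<^sup>2 \<le> (\<integral>\<^sup>+z. ennreal (K1 z) \<partial>lborel) * (\<integral>\<^sup>+y. ennreal (K1 (x - y)) * ennreal ((h y)\<^sup>2) \<partial>lborel)"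
          by (simp only: K1x)
      qed
      also have "\<dots> = (\<integral>\<^sup>+z. ennreal (K1 z) \<partial>lborel) * (\<integral>\<^sup>+x. (\<integral>\<^sup>+y. ennreal (K1 (x - y)) * ennreal ((h y)\<^sup>2) \<partial>lborel) \<partial>lborel)"
        by (rule nn_integral_cmult) measurable
      also have "(\<integral>\<^sup>+x. (\<integral>\<^sup>+y. ennreal (K1 (x - y)) * ennreal ((h y)\<^sup>2) \<partial>lborel) \<partial>lborel) = (\<integral>\<^sup>+z. ennreal (K1 z) \<partial>lborel) * (\<integral>\<^sup>+y. ennreal ((h y)\<^sup>2) \<partial>lborel)"
        by (rule nn_integral_convolution) measurable
      also have "(\<integral>\<^sup>+z. ennreal (K1 z) \<partial>lborel) * ((\<integral>\<^sup>+z. ennreal (K1 z) \<partial>lborel) * (\<integral>\<^sup>+y. ennreal ((h y)\<^sup>2) \<partial>lborel)) \<le>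
         ennreal (C2 * t) * (ennreal (C2 * t) * ennreal H)"
        by (intro mult_mono K1 h) auto
      also have "\<dots> = ennreal (C2\<^sup>2 * t\<^sup>2 * H)"
        using C2 t H by (simp add: ennreal_mult'[symmetric] power2_eq_square mult_ac)
      finally show ?thesis .
    qed
    \<comment> \<open>Markov's inequality for the square of \<open>N\<close> costs
      \<open>s ^ 2\<close>, and its integral is of order \<open>t\<^sup>2\<close>, hence of order
      \<open>1 / s ^ 4\<close>; this is where the sixth power comes from.\<close>
    have "AE x in lborel. \<bar>u x\<bar> > s \<longrightarrow> 1 \<le> ennreal (4 / (m * s)\<^sup>2) * (N x)\<^sup>2"
      using uh
    proof eventually_elim
      case (elim x)
      show ?case
      proof
        assume "\<bar>u x\<bar> > s"
        then have "m * s \<le> m * \<bar>u x\<bar>" using m by simp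
        then have "ennreal (m * s) \<le> (\<integral>\<^sup>+y. ennreal (norm (x - y) powr - 2) * ennreal (h y) \<partial>lborel)"
          using elim by (meson ennreal_leI order_trans)
        also have "\<dots> = (\<integral>\<^sup>+y. ennreal (K1 (x - y)) * ennreal (h y) + ennreal (K2 (x - y)) * ennreal (h y) \<partial>lborel)"
          by (intro nn_integral_cong) (auto simp: K1_def K2_def indicator_def)
        also have "\<dots> = N x + (\<integral>\<^sup>+y. ennreal (K2 (x - y)) * ennreal (h y) \<partial>lborel)"
          unfolding N_def by (rule nn_integral_add) measurable
        also have "\<dots> \<le> N x + ennreal (m * s / 2)" by (intro add_left_mono far)
        finally have le: "ennreal (m * s) \<le> N x + ennreal (m * s / 2)" .
        have N: "ennreal (m * s / 2) \<le> N x"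
        proof (cases "N x")
          case (real r)
          with le have "m * s \<le> r + m * s / 2"
            using m s by (simp add: ennreal_plus[symmetric] del: ennreal_plus)
          with real show ?thesis by (simp add: ennreal_leI)
        qed simp
        have "1 = ennreal (4 / (m * s)\<^sup>2) * (ennreal (m * s / 2))\<^sup>2"
          using m s by (simp add: ennreal_power ennreal_mult'[symmetric] field_simps power2_eq_square)
        also have "\<dots> \<le> ennreal (4 / (m * s)\<^sup>2) * (N x)\<^sup>2"
          using N by (intro mult_left_mono power_mono) auto
        finally show "1 \<le> ennreal (4 / (m * s)\<^sup>2) * (N x)\<^sup>2" .
      qed
    qed
    then have "emeasure lborel {x. \<bar>u x\<bar> > s} \<le> emeasure lborel ({x\<in>space lborel. 1 \<le> ennreal (4 / (m * s)\<^sup>2) * (N x)\<^sup>2})"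
      by (intro emeasure_mono_AE) auto
    also have "\<dots> \<le> ennreal (4 / (m * s)\<^sup>2) * (\<integral>\<^sup>+x. (N x)\<^sup>2 * indicator (space lborel) x \<partial>lborel)"
      using nn_integral_Markov_inequality[where u = "\<lambda>x. (N x)\<^sup>2" and A = "space lborel" and M = lborel and c = "ennreal (4 / (m * s)\<^sup>2)"] by simp
    also have "\<dots> \<le> ennreal (4 / (m * s)\<^sup>2) * ennreal (C2\<^sup>2 * t\<^sup>2 * H)"
      using near by (intro mult_left_mono) auto
    also have "\<dots> = ennreal (C / s ^ 6)"
    proof -
      have "4 / (m * s)\<^sup>2 * (C2\<^sup>2 * t\<^sup>2 * H) = C / s ^ 6"
        using m s by (simp add: C_def t_def field_simps eval_nat_numeral)
      then show ?thesis by (simp flip: ennreal_mult')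
    qed
    finally show ?thesis .
  qed
  have "C > 0" using C2 T H m by (simp add: C_def)
  then show thesis using bound by (rule that)
qed

text \<open>Small values are controlled by the square because \<open>q \<ge> 2\<close>. Large values
  are sliced into dyadic levels whose contributions have ratio \<open>2 powr (q - 6)\<close>, so the
  endpoint 6 is out of reach.\<close>

lemma weak_L6_imp_Lq:
  fixes u :: "R3 \<Rightarrow> real"
  assumes [measurable]: "u \<in> borel_measurable borel" and u2: "integrable lborel (\<lambda>x. (u x)\<^sup>2)"
    and C: "C > 0" "\<And>s. s > 0 \<Longrightarrow> emeasure lborel {x. \<bar>u x\<bar> > s} \<le> ennreal (C / s ^ 6)"
    and q: "2 \<le> q" "q < 6"
  shows "integrable lborel (\<lambda>x. \<bar>u x\<bar> powr q)"
proof (rule integrableI_bounded)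
  let ?x = "2 powr (q - 6) :: real"
  have x1: "?x < 1" using q by (subst powr_less_one) auto
  let ?g = "\<lambda>k. (2 ^ Suc k) powr q"
  \<comment> \<open>The weak bound is stated for strict superlevel sets; half the level guarantees
    that a point with \<open>2 ^ k \<le> \<bar>u x\<bar>\<close> belongs to the set.\<close>
  let ?A = "\<lambda>k. {x. \<bar>u x\<bar> > 2 ^ k / 2}"
  have pt: "ennreal (norm (\<bar>u x\<bar> powr q)) \<le> ennreal ((u x)\<^sup>2) + (\<Sum>k. ennreal (?g k) * indicator (?A k) x)" for x
  proof (cases "\<bar>u x\<bar> \<le> 1")
    case True
    have "\<bar>u x\<bar> powr q \<le> \<bar>u x\<bar> powr 2"
      using powr_mono'[of 2 q "\<bar>u x\<bar>"] True q by (cases "u x = 0") auto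
    also have "\<dots> = (u x)\<^sup>2" by (cases "u x = 0") auto
    finally have "ennreal (norm (\<bar>u x\<bar> powr q)) \<le> ennreal ((u x)\<^sup>2)" by (simp add: ennreal_leI)
    then show ?thesis by (rule order_trans) simp
  next
    case False
    then have "1 \<le> \<bar>u x\<bar>" by simp
    then obtain k where k: "2 ^ k \<le> \<bar>u x\<bar>" "\<bar>u x\<bar> < 2 ^ Suc k" using ex_dyadic by blast
    have "(2::real) ^ k / 2 < 2 ^ k" by simp
    then have "x \<in> ?A k" using k(1) unfolding mem_Collect_eq by linarith
    moreover have "\<bar>u x\<bar> powr q \<le> ?g k" using k q by (intro powr_mono2) auto
    ultimately have "ennreal (norm (\<bar>u x\<bar> powr q)) \<le> ennreal (?g k) * indicator (?A k) x"
      by (simp add: ennreal_leI del: power_Suc)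
    also have "\<dots> \<le> (\<Sum>k. ennreal (?g k) * indicator (?A k) x)"
      by (rule ennreal_suminf_ge[of "\<lambda>k. ennreal (?g k) * indicator (?A k) x"])
    finally show ?thesis by (rule order_trans) simp
  qed
  have tm: "ennreal (?g k) * emeasure lborel (?A k) \<le> ennreal (2 powr q * 64 * C * ?x ^ k)" for k
  proof -
    have "ennreal (?g k) * emeasure lborel (?A k) \<le> ennreal (?g k) * ennreal (C / (2 ^ k / 2) ^ 6)"
      by (intro mult_left_mono C) auto
    also have "\<dots> = ennreal (?g k * (C / (2 ^ k / 2) ^ 6))"
      by (rule ennreal_mult'[symmetric]) simp
    also have "?g k * (C / (2 ^ k / 2) ^ 6) = 2 powr q * 64 * C * ((2 powr q) ^ k / (2 ^ k) ^ 6)"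
      by (simp add: powr_mult two_power_powr power_divide)
    also have "(2 powr q) ^ k / (2 ^ k) ^ 6 = ?x ^ k"
    proof -
      have "((2::real) ^ k) ^ 6 = 64 ^ k"
        by (induction k) (simp_all add: power_mult_distrib)
      moreover have "?x = 2 powr q / 64" by (simp add: powr_diff)
      ultimately show ?thesis by (simp only: power_divide)
    qed
    finally show ?thesis .
  qed
  have "(\<integral>\<^sup>+x. (\<Sum>k. ennreal (?g k) * indicator (?A k) x) \<partial>lborel) = (\<Sum>k. (\<integral>\<^sup>+x. ennreal (?g k) * indicator (?A k) x \<partial>lborel))"
    by (rule nn_integral_suminf) measurable
  also have "\<dots> = (\<Sum>k. ennreal (?g k) * emeasure lborel (?A k))"
    by (intro suminf_cong nn_integral_cmult_indicator) measurable
  also have "\<dots> \<le> (\<Sum>k. ennreal (2 powr q * 64 * C * ?x ^ k))"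
    by (intro suminf_le tm) auto
  also have "\<dots> = ennreal (2 powr q * 64 * C * (1 / (1 - ?x)))"
    using C(1) x1 by (intro suminf_ennreal_eq sums_mult geometric_sums) auto
  finally have series: "(\<integral>\<^sup>+x. (\<Sum>k. ennreal (?g k) * indicator (?A k) x) \<partial>lborel) \<le> ennreal (2 powr q * 64 * C * (1 / (1 - ?x)))" .
  have "(\<integral>\<^sup>+x. ennreal (norm (\<bar>u x\<bar> powr q)) \<partial>lborel) \<le> (\<integral>\<^sup>+x. ennreal ((u x)\<^sup>2) + (\<Sum>k. ennreal (?g k) * indicator (?A k) x) \<partial>lborel)"
    by (intro nn_integral_mono pt)
  also have "\<dots> = (\<integral>\<^sup>+x. ennreal ((u x)\<^sup>2) \<partial>lborel) + (\<integral>\<^sup>+x. (\<Sum>k. ennreal (?g k) * indicator (?A k) x) \<partial>lborel)"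
    by (rule nn_integral_add) measurable
  also have "\<dots> < \<infinity>"
    using u2 le_less_trans[OF series ennreal_less_top] by (simp add: integrable_iff_bounded)
  finally show "(\<integral>\<^sup>+x. ennreal (norm (\<bar>u x\<bar> powr q)) \<partial>lborel) < \<infinity>" .
qed measurable

section \<open>Kernel bounds uniform in the regularization, and integrability in
  \<open>H1\<close>\<close>

lemma yukawa_measurable' [measurable]:
  "yukawa k \<epsilon> \<in> borel_measurable borel" "yukawa' k \<epsilon> i \<in> borel_measurable borel"
proof -
  have [measurable]: "rho \<epsilon> \<in> borel_measurable borel" unfolding rho_def[abs_def] by measurable
  have [measurable]: "(\<lambda>z::R3. z $ i) \<in> borel_measurable borel" by (rule smooth_measurable[OF smooth_coord])
  show "yukawa k \<epsilon> \<in> borel_measurable borel" "yukawa' k \<epsilon> i \<in> borel_measurable borel"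
    unfolding yukawa_def[abs_def] yukawa'_def[abs_def] by measurable
qed

lemma yukawa_norm_le:
  assumes "k > 0" "\<epsilon> > 0" "z \<noteq> 0"
  shows "\<bar>yukawa k \<epsilon> z\<bar> \<le> inverse (norm z) * exp (- k * norm z)"
    and "\<bar>yukawa' k \<epsilon> i z\<bar> \<le> (k * inverse (norm z) + inverse (norm z) ^ 2) * exp (- k * norm z)"
proof -
  have r: "inverse (rho \<epsilon> z) \<le> inverse (norm z)" "0 < inverse (rho \<epsilon> z)"
    using rho_ge_norm[of z \<epsilon>] assms rho_pos[OF assms(1,2), of z] by (auto intro!: le_imp_inverse_le)
  note E = exp_rho_le[OF assms(1,2), of z]
  have "inverse (rho \<epsilon> z) * exp (- k * rho \<epsilon> z) \<le> inverse (norm z) * exp (- k * norm z)"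
    using r E by (intro mult_mono) auto
  then show "\<bar>yukawa k \<epsilon> z\<bar> \<le> inverse (norm z) * exp (- k * norm z)"
    using yukawa_nonneg[OF assms(1,2), of z] by (simp add: yukawa_def mult.commute)
  have "(k * inverse (rho \<epsilon> z) + inverse (rho \<epsilon> z) ^ 2) * exp (- k * rho \<epsilon> z) \<le> (k * inverse (norm z) + inverse (norm z) ^ 2) * exp (- k * norm z)"
    using assms r E by (intro mult_mono add_mono mult_left_mono power_mono) auto
  with yukawa'_le'[OF assms(1,2), of i z] show "\<bar>yukawa' k \<epsilon> i z\<bar> \<le> (k * inverse (norm z) + inverse (norm z) ^ 2) * exp (- k * norm z)"
    by (rule order_trans)
qed

lemma rho_0: "rho 0 z = norm z"
  by (simp add: rho_def norm_eq_sqrt_inner)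

lemma yukawa_tendsto:
  assumes "z \<noteq> 0"
  shows "(\<lambda>n. yukawa k (inverse (real (Suc n))) z) \<longlonglongrightarrow> yukawa k 0 z"
    and "(\<lambda>n. yukawa' k (inverse (real (Suc n))) i z) \<longlonglongrightarrow> yukawa' k 0 i z"
proof -
  have r: "(\<lambda>n. rho (inverse (real (Suc n))) z) \<longlonglongrightarrow> rho 0 z"
    unfolding rho_def by (intro tendsto_intros LIMSEQ_inverse_real_of_nat)
  have r0: "rho 0 z \<noteq> 0" using assms by (simp add: rho_0)
  show "(\<lambda>n. yukawa k (inverse (real (Suc n))) z) \<longlonglongrightarrow> yukawa k 0 z"
    unfolding yukawa_def by (intro tendsto_intros r r0)
  show "(\<lambda>n. yukawa' k (inverse (real (Suc n))) i z) \<longlonglongrightarrow> yukawa' k 0 i z"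
    unfolding yukawa'_def by (intro tendsto_intros r r0)
qed

lemma square_integrable_add:
  fixes f g :: "'a \<Rightarrow> real"
  assumes [measurable]: "f \<in> borel_measurable M" "g \<in> borel_measurable M"
    and fg: "integrable M (\<lambda>x. (f x)\<^sup>2)" "integrable M (\<lambda>x. (g x)\<^sup>2)"
  shows "integrable M (\<lambda>x. (f x + g x)\<^sup>2)"
proof -
  have "integrable M (\<lambda>x. (f x)\<^sup>2 + (g x)\<^sup>2 + 2 * (f x * g x))"
    by (intro Bochner_Integration.integrable_add integrable_mult_right integrable_mult_square fg) measurable
  moreover have "(\<lambda>x. (f x)\<^sup>2 + (g x)\<^sup>2 + 2 * (f x * g x)) = (\<lambda>x. (f x + g x)\<^sup>2)"
    by (simp add: power2_sum mult.assoc)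
  ultimately show ?thesis by simp
qed

lemma square_integrable_sum:
  fixes f :: "'i \<Rightarrow> 'a \<Rightarrow> real"
  assumes "\<And>i. i \<in> I \<Longrightarrow> f i \<in> borel_measurable M" "\<And>i. i \<in> I \<Longrightarrow> integrable M (\<lambda>x. (f i x)\<^sup>2)"
  shows "integrable M (\<lambda>x. (\<Sum>i\<in>I. f i x)\<^sup>2)"
  using assms
proof (induction I rule: infinite_finite_induct)
  case (insert i I)
  then show ?case by (simp, intro square_integrable_add) (auto intro: borel_measurable_sum)
qed auto

text \<open>By \<open>y \<le> y\<^sup>2 + 1\<close> the integral over a translated box is at most
  the full integral of the square plus the volume of the box, and neither depends on the
  translation.\<close>

lemma nn_integral_square_local:
  fixes h :: "R3 \<Rightarrow> real"
  assumes [measurable]: "h \<in> borel_measurable borel" and h: "integrable lborel (\<lambda>x. (h x)\<^sup>2)"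
  shows "\<exists>D. \<forall>z. (\<integral>\<^sup>+x. ennreal (h x) * indicator (cbox a b) (x + z) \<partial>lborel) \<le> ennreal D"
proof (intro exI allI)
  fix z
  have le: "y \<le> y\<^sup>2 + 1" for y :: real
    using sum_squares_bound[of y 1] zero_le_power2[of y] unfolding power_one mult_1_right by linarith
  have "(\<integral>\<^sup>+x. ennreal (h x) * indicator (cbox a b) (x + z) \<partial>lborel) \<le> (\<integral>\<^sup>+x. ennreal ((h x)\<^sup>2) + indicator (cbox a b) (z + x) \<partial>lborel)"
  proof (rule nn_integral_mono)
    fix x
    have "ennreal (h x) \<le> ennreal ((h x)\<^sup>2) + 1"
      using ennreal_leI[OF le[of "h x"]] by simp
    then show "ennreal (h x) * indicator (cbox a b) (x + z) \<le> ennreal ((h x)\<^sup>2) + indicator (cbox a b) (z + x)"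
      by (auto simp: indicator_def add.commute)
  qed
  also have "\<dots> = (\<integral>\<^sup>+x. ennreal ((h x)\<^sup>2) \<partial>lborel) + (\<integral>\<^sup>+x. indicator (cbox a b) (z + x) \<partial>lborel)"
    by (rule nn_integral_add) measurable
  also have "(\<integral>\<^sup>+x. ennreal ((h x)\<^sup>2) \<partial>lborel) = ennreal (LINT x|lborel. (h x)\<^sup>2)"
    using h by (intro nn_integral_eq_integral) auto
  also have "(\<integral>\<^sup>+x. indicator (cbox a b) (z + x) \<partial>lborel) = emeasure lborel (cbox a b)"
    by (subst lborel_nn_integral_shift) (simp_all add: nn_integral_indicator)
  also have "\<dots> = ennreal (measure lborel (cbox a b))"
    using emeasure_lborel_cbox_finite[of a b] by (intro emeasure_eq_ennreal_measure) auto
  also have "ennreal (LINT x|lborel. (h x)\<^sup>2) + ennreal (measure lborel (cbox a b)) = ennreal ((LINT x|lborel. (h x)\<^sup>2) + measure lborel (cbox a b))"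
    by (intro ennreal_plus[symmetric]) auto
  finally show "(\<integral>\<^sup>+x. ennreal (h x) * indicator (cbox a b) (x + z) \<partial>lborel) \<le> ennreal ((LINT x|lborel. (h x)\<^sup>2) + measure lborel (cbox a b))" .
qed

text \<open>The weaker singularity \<open>inverse r\<close> is turned into \<open>r powr - 2\<close>
  at the price of a factor \<open>r\<close>, which half of the exponential absorbs with constant 2;
  the stronger singularity adds 1.\<close>

lemma yukawa_gradient_kernel:
  fixes r :: real
  assumes "r > 0"
  shows "(inverse r + inverse r ^ 2) * exp (- r) \<le> 3 * (r powr - 2 * exp (- (1 / 2) * r))"
proof -
  have "r / 2 \<le> exp (r / 2)" using exp_ge_add_one_self[of "r / 2"] by linarith
  then have 1: "r * exp (- (r / 2)) \<le> 2" by (simp add: exp_minus field_simps)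
  have 2: "exp (- (r / 2)) \<le> 1" using assms by simp
  have p: "r powr - 2 = inverse r ^ 2" using assms by (simp add: powr_neg_numeral power_divide inverse_eq_divide)
  have e: "exp (- r) = exp (- (r / 2)) * exp (- (r / 2))" by (simp flip: exp_add)
  have "(inverse r + inverse r ^ 2) * exp (- r) = inverse r ^ 2 * (r * exp (- (r / 2)) + exp (- (r / 2))) * exp (- (r / 2))"
    unfolding e using assms by (simp add: field_simps power2_eq_square)
  also have "\<dots> \<le> inverse r ^ 2 * (2 + 1) * exp (- (r / 2))"
    using 1 2 assms by (intro mult_right_mono mult_left_mono add_mono) auto
  finally show ?thesis by (simp add: p)
qed

text \<open>The kernel bound first keeps an exponential, because
  \<open>mollified_representation\<close> asks for a kernel of finite total mass. It is dropped
  afterwards, since the splitting at a radius \<open>t\<close> relies on the homogeneity of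
  \<open>norm z powr - 2\<close>.\<close>

lemma H1_Lq:
  assumes "u \<in> H1" "2 \<le> q" "q < 6"
  shows "integrable lborel (\<lambda>x. \<bar>u x\<bar> powr q)"
proof -
  obtain g where g: "weak_gradient u g" using assms(1) by (auto simp: H1_def)
  have u_meas [measurable]: "u \<in> borel_measurable borel" and u2: "integrable lborel (\<lambda>x. (u x)\<^sup>2)"
    using assms(1) by (auto simp: H1_def)
  note g_meas [measurable] = weak_gradient_component(1)[OF g]
  define h where "h y = \<bar>u y\<bar> + (\<Sum>i\<in>UNIV. \<bar>g y $ i\<bar>)" for y
  have h_meas [measurable]: "h \<in> borel_measurable borel" unfolding h_def by measurable
  have h0: "0 \<le> h y" for y by (simp add: h_def sum_nonneg)
  have h2: "integrable lborel (\<lambda>y. (h y)\<^sup>2)"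
    unfolding h_def
    by (intro square_integrable_add square_integrable_sum) (use u2 weak_gradient_component[OF g] in auto)
  define K where "K z = 3 * (norm (z::R3) powr - 2 * exp (- (1 / 2) * norm z))" for z
  have K_meas [measurable]: "K \<in> borel_measurable borel" unfolding K_def by measurable
  have K0: "0 \<le> K z" for z by (simp add: K_def)
  have K_fin: "(\<integral>\<^sup>+z. ennreal (K z) \<partial>lborel) < \<infinity>"
    using kernel_finite[of 2 "1 / 2"] unfolding K_def
    by (subst ennreal_mult') (simp_all add: nn_integral_cmult ennreal_mult_less_top)
  define Q where "Q e x y = 1\<^sup>2 * (u y * yukawa 1 e (y - x)) + (\<Sum>i\<in>UNIV. g y $ i * yukawa' 1 e i (y - x))" for e x y
  have rep: "AE x in lborel. ennreal (mass * \<bar>u x\<bar>) \<le> (\<integral>\<^sup>+y. ennreal (K (x - y)) * ennreal (h y) \<partial>lborel)"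
  proof (rule mollified_representation(2)[where k = 1 and u = u and Q = "\<lambda>n. Q (inverse (real (Suc n)))" and Q' = "Q 0", OF _ u_meas u2 K_meas h_meas K0 h0 K_fin])
    show "\<exists>D. \<forall>z. (\<integral>\<^sup>+x. ennreal (h x) * indicator (cbox a b) (x + z) \<partial>lborel) \<le> ennreal D" for a b
      by (rule nn_integral_square_local[OF h_meas h2])
    have Q_meas: "(\<lambda>(x, y). Q e x y) \<in> borel_measurable (lborel \<Otimes>\<^sub>M lborel)" for e
      unfolding Q_def by measurable
    show "(\<lambda>(x, y). Q (inverse (real (Suc n))) x y) \<in> borel_measurable (lborel \<Otimes>\<^sub>M lborel)" for n
      by (rule Q_meas)
    show "(\<lambda>(x, y). Q 0 x y) \<in> borel_measurable (lborel \<Otimes>\<^sub>M lborel)"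
      by (rule Q_meas)
    show "(\<lambda>n. Q (inverse (real (Suc n))) x y) \<longlonglongrightarrow> Q 0 x y" if "x \<noteq> y" for x y
      unfolding Q_def by (intro tendsto_add tendsto_mult tendsto_sum tendsto_const yukawa_tendsto) (use that in auto)
    show "(LINT y|lborel. u y * mollifier 1 (inverse (real (Suc n))) (y - x)) = (LINT y|lborel. Q (inverse (real (Suc n))) x y)" for n x
      unfolding Q_def by (rule yukawa_weak_gradient[OF _ _ g u_meas u2]) auto
    show "\<bar>Q (inverse (real (Suc n))) x y\<bar> \<le> K (x - y) * h y" if "x \<noteq> y" for n x y
    proof -
      define z where "z = y - x"
      have z: "z \<noteq> 0" "norm z > 0" using that by (auto simp: z_def)
      define e where "e = inverse (real (Suc n))"
      have e: "e > 0" by (simp add: e_def)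
      define A where "A = (inverse (norm z) + inverse (norm z) ^ 2) * exp (- norm z)"
      have y1: "\<bar>yukawa 1 e z\<bar> \<le> A"
        using yukawa_norm_le(1)[of 1 e z] e z by (intro order_trans[OF yukawa_norm_le(1)[of 1 e z]]) (auto simp: A_def)
      have y2: "\<bar>yukawa' 1 e i z\<bar> \<le> A" for i
        using yukawa_norm_le(2)[of 1 e z i] e z by (simp add: A_def)
      have A: "A \<le> K (x - y)"
        using yukawa_gradient_kernel[OF z(2)] by (simp add: A_def K_def z_def norm_minus_commute)
      have "\<bar>Q e x y\<bar> \<le> \<bar>u y * yukawa 1 e z\<bar> + (\<Sum>i\<in>UNIV. \<bar>g y $ i * yukawa' 1 e i z\<bar>)"
        unfolding Q_def z_def[symmetric] power_one mult_1
        using abs_triangle_ineq[of "u y * yukawa 1 e z" "\<Sum>i\<in>UNIV. g y $ i * yukawa' 1 e i z"]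
          sum_abs[of "\<lambda>i. g y $ i * yukawa' 1 e i z" UNIV] by linarith
      also have "\<dots> \<le> \<bar>u y\<bar> * A + (\<Sum>i\<in>UNIV. \<bar>g y $ i\<bar> * A)"
        unfolding abs_mult by (intro add_mono sum_mono mult_left_mono y1 y2) auto
      also have "\<dots> = A * h y" unfolding h_def sum_distrib_right[symmetric] by (simp add: distrib_left mult.commute)
      also have "\<dots> \<le> K (x - y) * h y" by (intro mult_right_mono A h0)
      finally show ?thesis by (simp add: e_def)
    qed
  qed simp
  define H where "H = (LINT y|lborel. (h y)\<^sup>2) + 1"
  have H: "H > 0" by (simp add: H_def add_nonneg_pos)
  have "(\<integral>\<^sup>+y. ennreal ((h y)\<^sup>2) \<partial>lborel) = ennreal (LINT y|lborel. (h y)\<^sup>2)"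
    using h2 by (intro nn_integral_eq_integral) auto
  then have hH: "(\<integral>\<^sup>+y. ennreal ((h y)\<^sup>2) \<partial>lborel) \<le> ennreal H"
    by (simp add: H_def ennreal_leI)
  \<comment> \<open>The factor 3 of \<open>K\<close> is moved into the constant in front of
    \<open>u\<close>, and the exponential is estimated by 1.\<close>
  have "AE x in lborel. ennreal (mass / 3 * \<bar>u x\<bar>) \<le> (\<integral>\<^sup>+y. ennreal (norm (x - y) powr - 2) * ennreal (h y) \<partial>lborel)"
    using rep
  proof eventually_elim
    case (elim x)
    have "ennreal (mass / 3 * \<bar>u x\<bar>) = ennreal (1 / 3) * ennreal (mass * \<bar>u x\<bar>)"
      by (subst ennreal_mult'[symmetric]) auto
    also have "\<dots> \<le> ennreal (1 / 3) * (\<integral>\<^sup>+y. ennreal (K (x - y)) * ennreal (h y) \<partial>lborel)"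
      by (intro mult_left_mono elim) auto
    also have "\<dots> = (\<integral>\<^sup>+y. ennreal (1 / 3) * (ennreal (K (x - y)) * ennreal (h y)) \<partial>lborel)"
      by (rule nn_integral_cmult[symmetric]) measurable
    also have "\<dots> \<le> (\<integral>\<^sup>+y. ennreal (norm (x - y) powr - 2) * ennreal (h y) \<partial>lborel)"
    proof (rule nn_integral_mono)
      fix y
      have "ennreal (1 / 3) * ennreal (K (x - y)) = ennreal (1 / 3 * K (x - y))"
        by (rule ennreal_mult'[symmetric]) simp
      also have "\<dots> \<le> ennreal (norm (x - y) powr - 2)"
        by (intro ennreal_leI) (simp add: K_def mult_left_le)
      finally show "ennreal (1 / 3) * (ennreal (K (x - y)) * ennreal (h y)) \<le> ennreal (norm (x - y) powr - 2) * ennreal (h y)"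
        unfolding mult.assoc[symmetric] by (rule mult_right_mono) simp
    qed
    finally show ?case .
  qed
  from weak_L6_bound[OF u_meas h_meas h0 hH H _ this] mass_pos
  obtain C where "C > 0" "\<And>s. s > 0 \<Longrightarrow> emeasure lborel {x. \<bar>u x\<bar> > s} \<le> ennreal (C / s ^ 6)"
    by (metis zero_less_divide_iff zero_less_numeral)
  from weak_L6_imp_Lq[OF u_meas u2 this assms(2,3)] show ?thesis .
qed

section \<open>The Coulomb potential\<close>

text \<open>Dominated convergence, since the indicators of \<open>E n\<close> tend to 0 pointwise.
  It is applied to complements of balls for the Coulomb potential, and to the sets where
  \<open>w\<close> or \<open>norm y\<close> is large for the contraction.\<close>

lemma exists_small_tail:
  fixes f :: "'a \<Rightarrow> real" and E :: "nat \<Rightarrow> 'a set"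
  assumes f: "integrable M f" "\<And>x. 0 \<le> f x" and E: "\<And>n. E n \<in> sets M"
    and ev: "\<And>x. eventually (\<lambda>n. x \<notin> E n) sequentially" and e: "e > 0"
  shows "eventually (\<lambda>n. (\<integral>\<^sup>+x. ennreal (f x) * indicator (E n) x \<partial>M) \<le> ennreal e) sequentially"
proof -
  have i: "integrable M (\<lambda>x. f x * indicator (E n) x)" for n
    using f(1) E by (rule integrable_real_mult_indicator[rotated])
  have "(\<lambda>n. LINT x|M. f x * indicator (E n) x) \<longlonglongrightarrow> (LINT x|M. 0)"
  proof (rule integral_dominated_convergence[OF _ _ f(1)])
    show "AE x in M. (\<lambda>n. f x * indicator (E n) x) \<longlonglongrightarrow> 0"
    proof (intro AE_I2)
      fix x
      have "eventually (\<lambda>n. 0 = f x * indicator (E n) x) sequentially"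
        using ev[of x] by eventually_elim simp
      then show "(\<lambda>n. f x * indicator (E n) x) \<longlonglongrightarrow> 0"
        by (rule Lim_transform_eventually[OF tendsto_const])
    qed
    show "AE x in M. norm (f x * indicator (E n) x) \<le> f x" for n
      using f(2) by (auto simp: indicator_def)
    show "(\<lambda>x. f x * indicator (E n) x) \<in> borel_measurable M" for n
      using i by (rule borel_measurable_integrable)
  qed simp
  then have "eventually (\<lambda>n. (LINT x|M. f x * indicator (E n) x) < e) sequentially"
    using e by (intro order_tendstoD(2)) auto
  then show ?thesis
  proof eventually_elim
    case (elim n)
    have "(\<integral>\<^sup>+x. ennreal (f x) * indicator (E n) x \<partial>M) = (\<integral>\<^sup>+x. ennreal (f x * indicator (E n) x) \<partial>M)"
      by (intro nn_integral_cong) (auto simp: indicator_def)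
    also have "\<dots> = ennreal (LINT x|M. f x * indicator (E n) x)"
      using i f(2) by (intro nn_integral_eq_integral) auto
    also have "\<dots> \<le> ennreal e" using elim by (intro ennreal_leI) simp
    finally show ?case .
  qed
qed

text \<open>Young's inequality with a parameter replaces Hoelder's inequality near the singularity.\<close>

lemma newton_kernel_bound:
  obtains C where "C > 0"
    "\<And>(f :: R3 \<Rightarrow> real) A x d. f \<in> borel_measurable borel \<Longrightarrow> (\<And>y. 0 \<le> f y) \<Longrightarrow> A \<in> sets borel \<Longrightarrow> d > 0 \<Longrightarrow>
      (\<integral>\<^sup>+y. ennreal (f y / norm (x - y)) * indicator A y \<partial>lborel) \<le>
      ennreal (1 / d) * (\<integral>\<^sup>+y. ennreal ((f y)\<^sup>2) * indicator A y \<partial>lborel) + ennreal (d * C) + (\<integral>\<^sup>+y. ennreal (f y) * indicator A y \<partial>lborel)"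
proof -
  obtain C where C: "C > 0"
    "\<And>t. t > 0 \<Longrightarrow> (\<integral>\<^sup>+z. ennreal (norm (z::R3) powr - 2) * indicator (ball 0 t) z \<partial>lborel) \<le> ennreal (C * t powr (3 - 2))"
    by (rule nn_integral_ball_powr[of 2]) (simp, simp, blast)
  show thesis
  proof (rule that[OF C(1)])
    fix f :: "R3 \<Rightarrow> real" and A :: "R3 set" and x :: R3 and d :: real
    assume [measurable]: "f \<in> borel_measurable borel" "A \<in> sets borel" and f: "\<And>y. 0 \<le> f y" and d: "d > 0"
    have pt: "ennreal (f y / norm (x - y)) * indicator A y \<le>
       (ennreal (1 / d) * (ennreal ((f y)\<^sup>2) * indicator A y) + ennreal d * (ennreal (norm (x - y) powr - 2) * indicator (ball 0 1) (x - y)))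
         + ennreal (f y) * indicator A y" for y
    proof (cases "y \<in> A")
      case True
      show ?thesis
      proof (cases "norm (x - y) < 1")
        case near: True
        \<comment> \<open>For \<open>y = x\<close> the quotient is 0 because division by 0 gives 0,
          and the estimate is trivial; otherwise it is the square inequality for
          \<open>f y / d\<close> and \<open>inverse (norm (x - y))\<close>.\<close>
        have "f y / norm (x - y) \<le> (1 / d) * (f y)\<^sup>2 + d * norm (x - y) powr - 2"
        proof (cases "x = y")
          case False
          define b where "b = inverse (norm (x - y))"
          have b: "b > 0" "norm (x - y) powr - 2 = b\<^sup>2"
            using False by (auto simp: b_def powr_neg_numeral power_divide inverse_eq_divide)
          have "2 * (f y / d) * b \<le> (f y / d)\<^sup>2 + b\<^sup>2" by (rule sum_squares_bound)
          then have "d * (2 * (f y / d) * b) \<le> d * ((f y / d)\<^sup>2 + b\<^sup>2)" using d by (intro mult_left_mono) auto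
          also have "\<dots> = (1 / d) * (f y)\<^sup>2 + d * b\<^sup>2" using d by (simp add: field_simps power2_eq_square)
          finally have "2 * (f y * b) \<le> (1 / d) * (f y)\<^sup>2 + d * b\<^sup>2" using d by simp
          moreover have "0 \<le> f y * b" using f[of y] b by simp
          ultimately show ?thesis unfolding b(2) by (simp add: b_def divide_inverse)
        qed (use d in simp)
        then have "ennreal (f y / norm (x - y)) \<le> ennreal (1 / d) * ennreal ((f y)\<^sup>2) + ennreal d * ennreal (norm (x - y) powr - 2)"
          using d by (subst (1 2) ennreal_mult'[symmetric]) (auto simp: ennreal_plus[symmetric] simp del: ennreal_plus intro: ennreal_leI)
        then have "ennreal (f y / norm (x - y)) \<le> ennreal (1 / d) * ennreal ((f y)\<^sup>2) + ennreal d * ennreal (norm (x - y) powr - 2) + ennreal (f y)"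
          by (rule order_trans) simp
        then show ?thesis using True near by simp
      next
        case far: False
        then have "f y / norm (x - y) \<le> f y / 1" using f[of y] by (intro divide_left_mono) auto
        then have "ennreal (f y / norm (x - y)) \<le> ennreal (f y)" by (intro ennreal_leI) simp
        then have "ennreal (f y / norm (x - y)) \<le> ennreal (1 / d) * ennreal ((f y)\<^sup>2) + ennreal (f y)"
          by (rule order_trans) simp
        then show ?thesis using True far by simp
      qed
    qed simp
    have "(\<integral>\<^sup>+y. ennreal (f y / norm (x - y)) * indicator A y \<partial>lborel) \<le>
      (\<integral>\<^sup>+y. (ennreal (1 / d) * (ennreal ((f y)\<^sup>2) * indicator A y) + ennreal d * (ennreal (norm (x - y) powr - 2) * indicator (ball 0 1) (x - y)))
         + ennreal (f y) * indicator A y \<partial>lborel)"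
      by (intro nn_integral_mono pt)
    also have "\<dots> = (\<integral>\<^sup>+y. ennreal (1 / d) * (ennreal ((f y)\<^sup>2) * indicator A y) + ennreal d * (ennreal (norm (x - y) powr - 2) * indicator (ball 0 1) (x - y)) \<partial>lborel)
         + (\<integral>\<^sup>+y. ennreal (f y) * indicator A y \<partial>lborel)"
      by (rule nn_integral_add) measurable
    also have "(\<integral>\<^sup>+y. ennreal (1 / d) * (ennreal ((f y)\<^sup>2) * indicator A y) + ennreal d * (ennreal (norm (x - y) powr - 2) * indicator (ball 0 1) (x - y)) \<partial>lborel) =
       (\<integral>\<^sup>+y. ennreal (1 / d) * (ennreal ((f y)\<^sup>2) * indicator A y) \<partial>lborel) + (\<integral>\<^sup>+y. ennreal d * (ennreal (norm (x - y) powr - 2) * indicator (ball 0 1) (x - y)) \<partial>lborel)"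
      by (rule nn_integral_add) measurable
    also have "(\<integral>\<^sup>+y. ennreal (1 / d) * (ennreal ((f y)\<^sup>2) * indicator A y) \<partial>lborel) = ennreal (1 / d) * (\<integral>\<^sup>+y. ennreal ((f y)\<^sup>2) * indicator A y \<partial>lborel)"
      by (rule nn_integral_cmult) measurable
    also have "(\<integral>\<^sup>+y. ennreal d * (ennreal (norm (x - y) powr - 2) * indicator (ball 0 1) (x - y)) \<partial>lborel) = ennreal d * (\<integral>\<^sup>+z. ennreal (norm (z::R3) powr - 2) * indicator (ball 0 1) z \<partial>lborel)"
    proof -
      have "(\<integral>\<^sup>+y. ennreal d * (ennreal (norm (x - y) powr - 2) * indicator (ball 0 1) (x - y)) \<partial>lborel) =
         (\<integral>\<^sup>+z. ennreal d * (ennreal (norm (z::R3) powr - 2) * indicator (ball 0 1) z) \<partial>lborel)"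
        by (rule lborel_nn_integral_reflect[of "\<lambda>z. ennreal d * (ennreal (norm z powr - 2) * indicator (ball 0 1) z)" x]) measurable
      also have "\<dots> = ennreal d * (\<integral>\<^sup>+z. ennreal (norm (z::R3) powr - 2) * indicator (ball 0 1) z \<partial>lborel)"
        by (rule nn_integral_cmult) measurable
      finally show ?thesis .
    qed
    finally have le: "(\<integral>\<^sup>+y. ennreal (f y / norm (x - y)) * indicator A y \<partial>lborel) \<le>
      ennreal (1 / d) * (\<integral>\<^sup>+y. ennreal ((f y)\<^sup>2) * indicator A y \<partial>lborel) + ennreal d * (\<integral>\<^sup>+z. ennreal (norm (z::R3) powr - 2) * indicator (ball 0 1) z \<partial>lborel)
       + (\<integral>\<^sup>+y. ennreal (f y) * indicator A y \<partial>lborel)" .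
    have "ennreal d * (\<integral>\<^sup>+z. ennreal (norm (z::R3) powr - 2) * indicator (ball 0 1) z \<partial>lborel) \<le> ennreal d * ennreal C"
      using C(2)[of 1] by (intro mult_left_mono) auto
    also have "\<dots> = ennreal (d * C)" using d by (intro ennreal_mult'[symmetric]) simp
    finally have "ennreal d * (\<integral>\<^sup>+z. ennreal (norm (z::R3) powr - 2) * indicator (ball 0 1) z \<partial>lborel) \<le> ennreal (d * C)" .
    then have "ennreal (1 / d) * (\<integral>\<^sup>+y. ennreal ((f y)\<^sup>2) * indicator A y \<partial>lborel) + ennreal d * (\<integral>\<^sup>+z. ennreal (norm (z::R3) powr - 2) * indicator (ball 0 1) z \<partial>lborel)
       + (\<integral>\<^sup>+y. ennreal (f y) * indicator A y \<partial>lborel) \<le>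
      ennreal (1 / d) * (\<integral>\<^sup>+y. ennreal ((f y)\<^sup>2) * indicator A y \<partial>lborel) + ennreal (d * C) + (\<integral>\<^sup>+y. ennreal (f y) * indicator A y \<partial>lborel)"
      by (intro add_mono order_refl)
    with le show "(\<integral>\<^sup>+y. ennreal (f y / norm (x - y)) * indicator A y \<partial>lborel) \<le>
      ennreal (1 / d) * (\<integral>\<^sup>+y. ennreal ((f y)\<^sup>2) * indicator A y \<partial>lborel) + ennreal (d * C) + (\<integral>\<^sup>+y. ennreal (f y) * indicator A y \<partial>lborel)"
      by (rule order_trans)
  qed
qed

section \<open>Boundedness and decay of the potential of an \<open>H1\<close> pair\<close>

lemma H1D: "u \<in> H1 \<Longrightarrow> u \<in> borel_measurable borel" "u \<in> H1 \<Longrightarrow> integrable lborel (\<lambda>x. (u x)\<^sup>2)"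
  by (auto simp: H1_def)

lemma H1_power4: assumes "u \<in> H1" shows "integrable lborel (\<lambda>x. (u x) ^ 4)"
proof -
  have "(\<lambda>x. \<bar>u x\<bar> powr 4) = (\<lambda>x. (u x) ^ 4)" by (auto simp: fun_eq_iff)
  with H1_Lq[OF assms, of 4] show ?thesis by simp
qed

lemma density_square_integrable:
  assumes "u \<in> H1" "v \<in> H1" shows "integrable lborel (\<lambda>x. ((u x)\<^sup>2 + (v x)\<^sup>2)\<^sup>2)"
proof -
  note [measurable] = H1D(1)[OF assms(1)] H1D(1)[OF assms(2)]
  show ?thesis
    by (rule square_integrable_add) (use H1_power4 assms in \<open>auto simp: power_mult[symmetric]\<close>)
qed

lemma coulomb_nonneg: "0 \<le> coulomb u v x"
  unfolding coulomb_def by (intro Bochner_Integration.integral_nonneg) simp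

lemma coulomb_commute: "coulomb u v = coulomb v u"
  by (simp add: coulomb_def[abs_def] add.commute)

lemma coulomb_measurable [measurable]:
  assumes "u \<in> H1" "v \<in> H1" shows "coulomb u v \<in> borel_measurable borel"
proof -
  note [measurable] = H1D(1)[OF assms(1)] H1D(1)[OF assms(2)]
  show ?thesis unfolding coulomb_def[abs_def] by measurable
qed

lemma coulomb_le:
  assumes "u \<in> H1" "v \<in> H1" "(\<integral>\<^sup>+y. ennreal (((u y)\<^sup>2 + (v y)\<^sup>2) / norm (x - y)) \<partial>lborel) \<le> ennreal B" "0 \<le> B"
  shows "coulomb u v x \<le> B"
proof -
  note [measurable] = H1D(1)[OF assms(1)] H1D(1)[OF assms(2)]
  have "coulomb u v x = enn2real (\<integral>\<^sup>+y. ennreal (((u y)\<^sup>2 + (v y)\<^sup>2) / norm (x - y)) \<partial>lborel)"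
    unfolding coulomb_def by (rule integral_eq_nn_integral) auto
  also have "\<dots> \<le> B" using assms(3,4) by (intro enn2real_leI) auto
  finally show ?thesis .
qed

text \<open>The density \<open>(u y)\<^sup>2 + (v y)\<^sup>2\<close> is integrable, and square
  integrable thanks to \<open>H1_Lq\<close> with exponent 4. The square tames the singularity of the
  Newton kernel, the first power tames the rest.\<close>

lemma coulomb_bounded:
  assumes "u \<in> H1" "v \<in> H1" obtains B where "B > 0" "\<And>x. coulomb u v x \<le> B"
proof -
  note [measurable] = H1D(1)[OF assms(1)] H1D(1)[OF assms(2)]
  let ?f = "\<lambda>y. (u y)\<^sup>2 + (v y)\<^sup>2"
  obtain C where C: "C > 0" "\<And>(f :: R3 \<Rightarrow> real) A x d. f \<in> borel_measurable borel \<Longrightarrow> (\<And>y. 0 \<le> f y) \<Longrightarrow> A \<in> sets borel \<Longrightarrow> d > 0 \<Longrightarrow>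
      (\<integral>\<^sup>+y. ennreal (f y / norm (x - y)) * indicator A y \<partial>lborel) \<le>
      ennreal (1 / d) * (\<integral>\<^sup>+y. ennreal ((f y)\<^sup>2) * indicator A y \<partial>lborel) + ennreal (d * C) + (\<integral>\<^sup>+y. ennreal (f y) * indicator A y \<partial>lborel)"
    using newton_kernel_bound by blast
  define I where "I = (LINT y|lborel. (?f y)\<^sup>2)"
  define J where "J = (LINT y|lborel. ?f y)"
  have IJ: "(\<integral>\<^sup>+y. ennreal ((?f y)\<^sup>2) \<partial>lborel) = ennreal I" "(\<integral>\<^sup>+y. ennreal (?f y) \<partial>lborel) = ennreal J" "0 \<le> I" "0 \<le> J"
    unfolding I_def J_def using density_square_integrable[OF assms] H1D(2)[OF assms(1)] H1D(2)[OF assms(2)]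
    by (intro nn_integral_eq_integral; simp)+ simp_all
  have "coulomb u v x \<le> I + C + J" for x
  proof (rule coulomb_le[OF assms])
    show "(\<integral>\<^sup>+y. ennreal (?f y / norm (x - y)) \<partial>lborel) \<le> ennreal (I + C + J)"
      using C(2)[of ?f UNIV 1 x] C(1) IJ by (simp add: ennreal_plus)
  qed (use C IJ in simp)
  then show thesis using C IJ by (intro that[of "I + C + J"]) auto
qed

lemma coulomb_small:
  assumes "u \<in> H1" "v \<in> H1" "e > 0" obtains R where "\<And>x. norm x > R \<Longrightarrow> coulomb u v x \<le> e"
proof -
  note [measurable] = H1D(1)[OF assms(1)] H1D(1)[OF assms(2)]
  let ?f = "\<lambda>y. (u y)\<^sup>2 + (v y)\<^sup>2"
  obtain C where C: "C > 0" "\<And>(f :: R3 \<Rightarrow> real) A x d. f \<in> borel_measurable borel \<Longrightarrow> (\<And>y. 0 \<le> f y) \<Longrightarrow> A \<in> sets borel \<Longrightarrow> d > 0 \<Longrightarrow>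
      (\<integral>\<^sup>+y. ennreal (f y / norm (x - y)) * indicator A y \<partial>lborel) \<le>
      ennreal (1 / d) * (\<integral>\<^sup>+y. ennreal ((f y)\<^sup>2) * indicator A y \<partial>lborel) + ennreal (d * C) + (\<integral>\<^sup>+y. ennreal (f y) * indicator A y \<partial>lborel)"
    using newton_kernel_bound by blast
  define J where "J = (LINT y|lborel. ?f y)"
  have fi: "integrable lborel ?f" using H1D(2) assms by auto
  have J: "(\<integral>\<^sup>+y. ennreal (?f y) \<partial>lborel) = ennreal J" "0 \<le> J"
    unfolding J_def by (rule nn_integral_eq_integral[OF fi]) simp_all
  \<comment> \<open>With this \<open>d\<close>, each of the three terms of the Newton kernel bound
    over \<open>E n\<close> is at most \<open>e / 4\<close>; the last quarter is reserved for the
    sources inside the ball.\<close>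
  define d where "d = e / (4 * C)"
  have d: "d > 0" using assms C by (simp add: d_def)
  define E where "E n = {y::R3. norm y > real n}" for n
  have [measurable]: "E n \<in> sets borel" for n unfolding E_def by measurable
  have ev: "eventually (\<lambda>n. x \<notin> E n) sequentially" for x
    unfolding E_def mem_Collect_eq not_less by (rule eventually_ge_at_top[THEN eventually_mono, of "nat \<lceil>norm x\<rceil>"]) linarith
  have "eventually (\<lambda>n. (\<integral>\<^sup>+y. ennreal ((?f y)\<^sup>2) * indicator (E n) y \<partial>lborel) \<le> ennreal (d * e / 4) \<and>
      (\<integral>\<^sup>+y. ennreal (?f y) * indicator (E n) y \<partial>lborel) \<le> ennreal (e / 4)) sequentially"
    by (intro eventually_conj exists_small_tail density_square_integrable assms fi ev) (use d assms in auto)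
  then obtain n where n: "(\<integral>\<^sup>+y. ennreal ((?f y)\<^sup>2) * indicator (E n) y \<partial>lborel) \<le> ennreal (d * e / 4)"
      "(\<integral>\<^sup>+y. ennreal (?f y) * indicator (E n) y \<partial>lborel) \<le> ennreal (e / 4)"
    using eventually_happens'[OF sequentially_bot] by blast
  \<comment> \<open>Sources in the ball of radius \<open>n\<close> are at distance at least
    \<open>norm x - n\<close> from \<open>x\<close>, and the threshold makes
    \<open>J / (norm x - n)\<close> at most \<open>e / 4\<close>.\<close>
  have "coulomb u v x \<le> e" if x: "norm x > real n + 4 * J / e" for x
  proof (rule coulomb_le[OF assms(1,2)])
    have n1: "norm x > real n" using x J assms by (smt (verit) divide_nonneg_pos)
    have near: "(\<integral>\<^sup>+y. ennreal (?f y / norm (x - y)) * indicator (- E n) y \<partial>lborel) \<le> ennreal (e / 4)"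
    proof -
      have "(\<integral>\<^sup>+y. ennreal (?f y / norm (x - y)) * indicator (- E n) y \<partial>lborel) \<le> (\<integral>\<^sup>+y. ennreal (1 / (norm x - real n)) * ennreal (?f y) \<partial>lborel)"
      proof (rule nn_integral_mono)
        fix y
        show "ennreal (?f y / norm (x - y)) * indicator (- E n) y \<le> ennreal (1 / (norm x - real n)) * ennreal (?f y)"
        proof (cases "y \<in> E n")
          case False
          then have "norm y \<le> real n" by (simp add: E_def)
          then have "norm x - real n \<le> norm (x - y)" using norm_triangle_ineq2[of x y] by linarith
          then have "?f y / norm (x - y) \<le> ?f y / (norm x - real n)" using n1 by (intro divide_left_mono mult_pos_pos) auto
          then have "ennreal (?f y / norm (x - y)) \<le> ennreal (1 / (norm x - real n) * ?f y)" by (intro ennreal_leI) simp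
          also have "\<dots> = ennreal (1 / (norm x - real n)) * ennreal (?f y)" using n1 by (intro ennreal_mult') simp
          finally show ?thesis using False by simp
        qed simp
      qed
      also have "\<dots> = ennreal (1 / (norm x - real n)) * ennreal J"
        by (subst nn_integral_cmult, measurable, simp only: J)
      also have "\<dots> = ennreal (J / (norm x - real n))" using n1 by (subst ennreal_mult'[symmetric]) auto
      also have "\<dots> \<le> ennreal (e / 4)"
      proof (intro ennreal_leI)
        have "4 * J / e \<le> norm x - real n" using x by linarith
        then have "4 * J \<le> e * (norm x - real n)" using assms by (simp add: pos_divide_le_eq mult.commute)
        then show "J / (norm x - real n) \<le> e / 4" using n1 by (simp add: field_simps)
      qed
      finally show ?thesis .
    qed
    have "(\<integral>\<^sup>+y. ennreal (?f y / norm (x - y)) * indicator (E n) y \<partial>lborel) \<le>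
      ennreal (1 / d) * (\<integral>\<^sup>+y. ennreal ((?f y)\<^sup>2) * indicator (E n) y \<partial>lborel) + ennreal (d * C) + (\<integral>\<^sup>+y. ennreal (?f y) * indicator (E n) y \<partial>lborel)"
      by (rule C(2)) (use d in auto)
    also have "\<dots> \<le> ennreal (1 / d) * ennreal (d * e / 4) + ennreal (d * C) + ennreal (e / 4)"
      by (intro add_mono mult_left_mono n) auto
    also have "\<dots> = ennreal (3 * e / 4)"
      using d C(1) assms(3) by (subst ennreal_mult'[symmetric]) (simp_all add: ennreal_plus[symmetric] d_def del: ennreal_plus)
    finally have far: "(\<integral>\<^sup>+y. ennreal (?f y / norm (x - y)) * indicator (E n) y \<partial>lborel) \<le> ennreal (3 * e / 4)" .
    have "(\<integral>\<^sup>+y. ennreal (?f y / norm (x - y)) \<partial>lborel) =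
      (\<integral>\<^sup>+y. ennreal (?f y / norm (x - y)) * indicator (E n) y + ennreal (?f y / norm (x - y)) * indicator (- E n) y \<partial>lborel)"
      by (intro nn_integral_cong) (auto simp: indicator_def)
    also have "\<dots> = (\<integral>\<^sup>+y. ennreal (?f y / norm (x - y)) * indicator (E n) y \<partial>lborel) + (\<integral>\<^sup>+y. ennreal (?f y / norm (x - y)) * indicator (- E n) y \<partial>lborel)"
      by (rule nn_integral_add) measurable
    also have "\<dots> \<le> ennreal (3 * e / 4) + ennreal (e / 4)" by (intro add_mono near far)
    also have "\<dots> = ennreal e" using assms by (simp add: ennreal_plus[symmetric] del: ennreal_plus)
    finally show "(\<integral>\<^sup>+y. ennreal (?f y / norm (x - y)) \<partial>lborel) \<le> ennreal e" .
  qed (use assms in simp)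
  then show thesis by (rule that)
qed

section \<open>The equation as a convolution\<close>

lemma H1_sum_Lq:
  assumes "u \<in> H1" "v \<in> H1" "2 \<le> q" "q < 6"
  shows "integrable lborel (\<lambda>x. (\<bar>u x\<bar> + \<bar>v x\<bar>) powr q)"
proof (rule Bochner_Integration.integrable_bound)
  note [measurable] = H1D(1)[OF assms(1)] H1D(1)[OF assms(2)]
  show "integrable lborel (\<lambda>x. 2 powr q * (\<bar>u x\<bar> powr q + \<bar>v x\<bar> powr q))"
    by (intro integrable_mult_right Bochner_Integration.integrable_add H1_Lq assms)
  show "AE x in lborel. norm ((\<bar>u x\<bar> + \<bar>v x\<bar>) powr q) \<le> norm (2 powr q * (\<bar>u x\<bar> powr q + \<bar>v x\<bar> powr q))"
  proof (intro AE_I2)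
    fix x
    have "(\<bar>u x\<bar> + \<bar>v x\<bar>) powr q \<le> (2 * max \<bar>u x\<bar> \<bar>v x\<bar>) powr q"
      using assms by (intro powr_mono2) auto
    also have "\<dots> = 2 powr q * max \<bar>u x\<bar> \<bar>v x\<bar> powr q" by (simp add: powr_mult)
    also have "\<dots> \<le> 2 powr q * (\<bar>u x\<bar> powr q + \<bar>v x\<bar> powr q)"
      by (intro mult_left_mono) (auto simp: max_def)
    finally show "norm ((\<bar>u x\<bar> + \<bar>v x\<bar>) powr q) \<le> norm (2 powr q * (\<bar>u x\<bar> powr q + \<bar>v x\<bar> powr q))"
      by simp
  qed
  show "(\<lambda>x. (\<bar>u x\<bar> + \<bar>v x\<bar>) powr q) \<in> borel_measurable lborel" by measurable
qed

text \<open>For \<open>p < 4\<close> the exponent \<open>p / 2 - 2\<close> is negative and not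
  monotone in the right direction. Absorbing the extra factor \<open>\<bar>a\<bar>\<close> raises it
  to \<open>p / 2 - 1 > 0\<close>, after which every modulus may be replaced by the sum.\<close>

lemma nonlinearity_bound:
  fixes a b p \<beta> :: real
  assumes "p > 2" "\<beta> > 0"
  shows "\<bar>\<bar>a\<bar> powr (p - 2) * a + \<beta> * \<bar>b\<bar> powr (p / 2) * \<bar>a\<bar> powr (p / 2 - 2) * a\<bar> \<le> (1 + \<beta>) * (\<bar>a\<bar> + \<bar>b\<bar>) powr (p - 1)"
proof (cases "a = 0")
  case False
  let ?w = "\<bar>a\<bar> + \<bar>b\<bar>"
  have a: "\<bar>a\<bar> > 0" "?w > 0" using False by auto
  have s: "\<bar>a\<bar> powr t * \<bar>a\<bar> = \<bar>a\<bar> powr (t + 1)" for t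
    using a by (simp add: powr_add)
  have 1: "\<bar>a\<bar> powr (p - 2) * \<bar>a\<bar> \<le> ?w powr (p - 1)"
    unfolding s using assms by (auto intro!: powr_mono2)
  have "\<bar>b\<bar> powr (p / 2) * (\<bar>a\<bar> powr (p / 2 - 2) * \<bar>a\<bar>) \<le> ?w powr (p / 2) * ?w powr (p / 2 - 1)"
    unfolding s using assms by (intro mult_mono) (auto intro!: powr_mono2)
  also have "\<dots> = ?w powr (p - 1)" by (simp flip: powr_add)
  finally have 2: "\<bar>b\<bar> powr (p / 2) * (\<bar>a\<bar> powr (p / 2 - 2) * \<bar>a\<bar>) \<le> ?w powr (p - 1)" .
  have "\<bar>\<bar>a\<bar> powr (p - 2) * a + \<beta> * \<bar>b\<bar> powr (p / 2) * \<bar>a\<bar> powr (p / 2 - 2) * a\<bar> \<le>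
    \<bar>\<bar>a\<bar> powr (p - 2) * a\<bar> + \<bar>\<beta> * \<bar>b\<bar> powr (p / 2) * \<bar>a\<bar> powr (p / 2 - 2) * a\<bar>"
    by (rule abs_triangle_ineq)
  also have "\<dots> = \<bar>a\<bar> powr (p - 2) * \<bar>a\<bar> + \<beta> * (\<bar>b\<bar> powr (p / 2) * (\<bar>a\<bar> powr (p / 2 - 2) * \<bar>a\<bar>))"
    using assms by (simp add: abs_mult)
  also have "\<dots> \<le> ?w powr (p - 1) + \<beta> * ?w powr (p - 1)"
    using assms by (intro add_mono 1 mult_left_mono 2) auto
  finally show ?thesis by (simp add: algebra_simps)
qed (use assms in simp)

lemma weak_solution_commute:
  "weak_solution p \<gamma> \<beta> lam u v \<Longrightarrow> weak_solution p \<gamma> \<beta> lam v u"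
  unfolding weak_solution_def coulomb_commute[of v u] by blast

text \<open>Testing the equation with the regularized Yukawa kernels turns it into \<open>mass * u = G * F\<close>, where \<open>G\<close>
  is the Yukawa kernel and \<open>F\<close> collects all terms other than \<open>- \<Delta>u + lam u\<close>.\<close>

lemma weak_solution_representation:
  assumes sol: "weak_solution p \<gamma> \<beta> lam u v" and p: "10 / 3 \<le> p" "p < 6"
    and pos: "\<gamma> > 0" "\<beta> > 0" "lam > 0"
  obtains F where "F \<in> borel_measurable borel"
    "\<And>y. \<bar>F y\<bar> \<le> (1 + \<beta>) * (\<bar>u y\<bar> + \<bar>v y\<bar>) powr (p - 1) + \<gamma> * coulomb u v y * (\<bar>u y\<bar> + \<bar>v y\<bar>)"
    "AE x in lborel. mass * u x = (LINT y|lborel. F y * yukawa (sqrt lam) 0 (y - x))"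
    "AE x in lborel. ennreal (mass * \<bar>u x\<bar>) \<le>
       (\<integral>\<^sup>+y. ennreal (norm (x - y) powr - 1 * exp (- sqrt lam * norm (x - y))) * ennreal \<bar>F y\<bar> \<partial>lborel)"
proof -
  have H: "u \<in> H1" "v \<in> H1" using sol by (auto simp: weak_solution_def)
  note u_meas [measurable] = H1D(1)[OF H(1)] and v_meas [measurable] = H1D(1)[OF H(2)]
  note u2 = H1D(2)[OF H(1)]
  note \<phi>_meas [measurable] = coulomb_measurable[OF H]
  let ?\<phi> = "coulomb u v"
  obtain P where P: "P > 0" "\<And>x. ?\<phi> x \<le> P" using coulomb_bounded[OF H] by blast
  note P0 = coulomb_nonneg[of u v]
  define f where "f y = \<bar>u y\<bar> powr (p - 2) * u y + \<beta> * \<bar>v y\<bar> powr (p / 2) * \<bar>u y\<bar> powr (p / 2 - 2) * u y" for y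
  define F where "F y = f y - \<gamma> * ?\<phi> y * u y" for y
  let ?w = "\<lambda>y. \<bar>u y\<bar> + \<bar>v y\<bar>"
  have f_meas [measurable]: "f \<in> borel_measurable borel" unfolding f_def by measurable
  have F_meas [measurable]: "F \<in> borel_measurable borel" unfolding F_def by measurable
  have f_le: "\<bar>f y\<bar> \<le> (1 + \<beta>) * ?w y powr (p - 1)" for y
    unfolding f_def using p pos by (intro nonlinearity_bound) auto
  \<comment> \<open>The exponent \<open>p - 1\<close> lies between \<open>7 / 3\<close> and 5,
    inside the range of \<open>H1_sum_Lq\<close>. Since \<open>f\<close> is not known to be in
    \<open>L\<^sup>2\<close>, its products with the kernels are integrated using the boundedness of
    the regularized kernel.\<close>
  have f_int: "integrable lborel f"
  proof (rule Bochner_Integration.integrable_bound)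
    show "integrable lborel (\<lambda>y. (1 + \<beta>) * ?w y powr (p - 1))"
      using p by (intro integrable_mult_right H1_sum_Lq H) auto
    show "AE y in lborel. norm (f y) \<le> norm ((1 + \<beta>) * ?w y powr (p - 1))"
      using f_le pos by (auto simp: abs_mult)
  qed measurable
  have F_le: "\<bar>F y\<bar> \<le> \<bar>f y\<bar> + \<gamma> * P * \<bar>u y\<bar>" for y
  proof -
    have "\<bar>\<gamma> * ?\<phi> y * u y\<bar> \<le> \<gamma> * P * \<bar>u y\<bar>"
      unfolding abs_mult using pos P P0 by (intro mult_right_mono mult_mono) auto
    then show ?thesis unfolding F_def by linarith
  qed
  let ?k = "sqrt lam"
  have k: "?k > 0" "?k\<^sup>2 = lam" using pos by auto
  have eq: "(LINT y|lborel. u y * mollifier ?k e (y - x)) = (LINT y|lborel. F y * yukawa ?k e (y - x))" if e: "e > 0" for e x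
  proof -
    define \<eta> where "\<eta> y = yukawa ?k e (y - x)" for y
    have \<eta>_meas [measurable]: "\<eta> \<in> borel_measurable borel" unfolding \<eta>_def by measurable
    have \<eta>H: "\<eta> \<in> H1" and grad\<eta>: "AE y in lborel. grad \<eta> y = (\<chi> i. yukawa' ?k e i (y - x))"
      using yukawa_shift_H1[OF k(1) e, of x] unfolding \<eta>_def by auto
    have \<eta>2: "integrable lborel (\<lambda>y. (\<eta> y)\<^sup>2)" unfolding \<eta>_def by (rule yukawa_square_integrable[OF k(1) e])
    have \<eta>_le: "\<bar>\<eta> y\<bar> \<le> inverse e" for y
    proof -
      have "\<bar>\<eta> y\<bar> \<le> inverse e * exp (- ?k * norm (y - x))" unfolding \<eta>_def by (rule yukawa_le[OF k(1) e])
      also have "\<dots> \<le> inverse e * 1" using k e by (intro mult_left_mono) auto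
      finally show ?thesis by simp
    qed
    have gu: "weak_gradient u (grad u)" by (rule weak_gradient_grad[OF H(1)])
    note gu_meas [measurable] = weak_gradient_component(1)[OF gu]
    have grad_meas [measurable]: "grad u \<in> borel_measurable borel" "grad \<eta> \<in> borel_measurable borel"
      using gu weak_gradient_grad[OF \<eta>H] by (auto simp: weak_gradient_def)
    have i1: "integrable lborel (\<lambda>y. u y * \<eta> y)"
      by (intro integrable_mult_square u2 \<eta>2) measurable
    have i2: "integrable lborel (\<lambda>y. grad u y $ i * yukawa' ?k e i (y - x))" for i
      by (intro integrable_mult_square weak_gradient_component[OF gu] yukawa_square_integrable[OF k(1) e]) measurable
    have i3: "integrable lborel (\<lambda>y. \<gamma> * ?\<phi> y * u y * \<eta> y)"
    proof (rule Bochner_Integration.integrable_bound)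
      show "integrable lborel (\<lambda>y. \<gamma> * P * (u y * \<eta> y))" by (intro integrable_mult_right i1)
      have "\<bar>\<gamma> * ?\<phi> y\<bar> * \<bar>u y * \<eta> y\<bar> \<le> \<bar>\<gamma> * P\<bar> * \<bar>u y * \<eta> y\<bar>" for y
        using P P0 pos by (intro mult_right_mono) (auto simp: abs_mult)
      then show "AE y in lborel. norm (\<gamma> * ?\<phi> y * u y * \<eta> y) \<le> norm (\<gamma> * P * (u y * \<eta> y))"
        by (auto simp: abs_mult mult_ac)
    qed measurable
    have i4: "integrable lborel (\<lambda>y. f y * \<eta> y)"
    proof (rule Bochner_Integration.integrable_bound)
      show "integrable lborel (\<lambda>y. inverse e * f y)" by (intro integrable_mult_right f_int)
      have "\<bar>f y\<bar> * \<bar>\<eta> y\<bar> \<le> \<bar>f y\<bar> * inverse e" for y by (intro mult_left_mono \<eta>_le) auto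
      then show "AE y in lborel. norm (f y * \<eta> y) \<le> norm (inverse e * f y)"
        using e by (auto simp: abs_mult mult.commute)
    qed measurable
    have "(LINT y|lborel. f y * \<eta> y) = (LINT y|lborel. grad u y \<bullet> grad \<eta> y + lam * u y * \<eta> y + \<gamma> * ?\<phi> y * u y * \<eta> y)"
      using sol \<eta>H unfolding weak_solution_def f_def by auto
    also have "\<dots> = (LINT y|lborel. (?k\<^sup>2 * (u y * \<eta> y) + (\<Sum>i\<in>UNIV. grad u y $ i * yukawa' ?k e i (y - x))) + \<gamma> * ?\<phi> y * u y * \<eta> y)"
    proof (rule integral_cong_AE)
      show "AE y in lborel. grad u y \<bullet> grad \<eta> y + lam * u y * \<eta> y + \<gamma> * ?\<phi> y * u y * \<eta> y =
        (?k\<^sup>2 * (u y * \<eta> y) + (\<Sum>i\<in>UNIV. grad u y $ i * yukawa' ?k e i (y - x))) + \<gamma> * ?\<phi> y * u y * \<eta> y"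
        using grad\<eta> by eventually_elim (simp only: k(2), simp add: inner_vec_def)
    qed measurable
    also have "\<dots> = (LINT y|lborel. ?k\<^sup>2 * (u y * \<eta> y) + (\<Sum>i\<in>UNIV. grad u y $ i * yukawa' ?k e i (y - x))) + (LINT y|lborel. \<gamma> * ?\<phi> y * u y * \<eta> y)"
      by (intro Bochner_Integration.integral_add Bochner_Integration.integrable_add Bochner_Integration.integrable_sum integrable_mult_right i1 i2 i3)
    also have "(LINT y|lborel. ?k\<^sup>2 * (u y * \<eta> y) + (\<Sum>i\<in>UNIV. grad u y $ i * yukawa' ?k e i (y - x))) = (LINT y|lborel. u y * mollifier ?k e (y - x))"
      unfolding \<eta>_def by (rule yukawa_weak_gradient[OF k(1) e gu u_meas u2, symmetric])
    finally have "(LINT y|lborel. u y * mollifier ?k e (y - x)) = (LINT y|lborel. f y * \<eta> y) - (LINT y|lborel. \<gamma> * ?\<phi> y * u y * \<eta> y)"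
      by simp
    also have "\<dots> = (LINT y|lborel. f y * \<eta> y - \<gamma> * ?\<phi> y * u y * \<eta> y)"
      by (rule Bochner_Integration.integral_diff[symmetric, OF i4 i3])
    finally show ?thesis by (simp add: F_def \<eta>_def left_diff_distrib)
  qed
  define K where "K z = norm (z::R3) powr - 1 * exp (- ?k * norm z)" for z
  have K_meas [measurable]: "K \<in> borel_measurable borel" unfolding K_def by measurable
  have K0: "0 \<le> K z" for z by (simp add: K_def)
  have K_fin: "(\<integral>\<^sup>+z. ennreal (K z) \<partial>lborel) < \<infinity>"
    unfolding K_def by (rule kernel_finite) (use k in auto)
  have F_abs_meas [measurable]: "(\<lambda>y. \<bar>F y\<bar>) \<in> borel_measurable borel" by measurable
  have F0: "0 \<le> \<bar>F y\<bar>" for y by simp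
  \<comment> \<open>\<open>F\<close> is dominated by an integrable function plus a square integrable
    one, the case for which uniform local integrability was formulated. The \<open>max\<close> is
    needed because \<open>ennreal\<close> truncates a negative \<open>D\<close> to 0.\<close>
  have F_loc: "\<exists>D. \<forall>z. (\<integral>\<^sup>+x. ennreal \<bar>F x\<bar> * indicator (cbox a b) (x + z) \<partial>lborel) \<le> ennreal D" for a b
  proof -
    have h2: "integrable lborel (\<lambda>x. (\<gamma> * P * \<bar>u x\<bar>)\<^sup>2)"
      unfolding power_mult_distrib power2_abs by (intro integrable_mult_right u2)
    obtain D where D: "\<And>z. (\<integral>\<^sup>+x. ennreal (\<gamma> * P * \<bar>u x\<bar>) * indicator (cbox a b) (x + z) \<partial>lborel) \<le> ennreal D"
      using nn_integral_square_local[OF _ h2, of a b] by auto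
    have "(\<integral>\<^sup>+x. ennreal \<bar>F x\<bar> * indicator (cbox a b) (x + z) \<partial>lborel) \<le> ennreal ((LINT x|lborel. \<bar>f x\<bar>) + max 0 D)" for z
    proof -
      have "(\<integral>\<^sup>+x. ennreal \<bar>F x\<bar> * indicator (cbox a b) (x + z) \<partial>lborel) \<le>
        (\<integral>\<^sup>+x. ennreal \<bar>f x\<bar> + ennreal (\<gamma> * P * \<bar>u x\<bar>) * indicator (cbox a b) (x + z) \<partial>lborel)"
      proof (rule nn_integral_mono)
        fix x
        have "ennreal \<bar>F x\<bar> \<le> ennreal \<bar>f x\<bar> + ennreal (\<gamma> * P * \<bar>u x\<bar>)"
          using ennreal_leI[OF F_le[of x]] P pos by simp
        then show "ennreal \<bar>F x\<bar> * indicator (cbox a b) (x + z) \<le> ennreal \<bar>f x\<bar> + ennreal (\<gamma> * P * \<bar>u x\<bar>) * indicator (cbox a b) (x + z)"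
          by (auto simp: indicator_def)
      qed
      also have "\<dots> = (\<integral>\<^sup>+x. ennreal \<bar>f x\<bar> \<partial>lborel) + (\<integral>\<^sup>+x. ennreal (\<gamma> * P * \<bar>u x\<bar>) * indicator (cbox a b) (x + z) \<partial>lborel)"
        by (rule nn_integral_add) measurable
      also have "\<dots> \<le> ennreal (LINT x|lborel. \<bar>f x\<bar>) + ennreal (max 0 D)"
        using f_int by (intro add_mono order_trans[OF D]) (auto simp: nn_integral_eq_integral ennreal_leI)
      also have "\<dots> = ennreal ((LINT x|lborel. \<bar>f x\<bar>) + max 0 D)"
        by (intro ennreal_plus[symmetric]) auto
      finally show ?thesis .
    qed
    then show ?thesis by blast
  qed
  have Q_meas: "(\<lambda>(x, y). F y * yukawa ?k e (y - x)) \<in> borel_measurable (lborel \<Otimes>\<^sub>M lborel)" for e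
    by measurable
  have lim: "(\<lambda>n. F y * yukawa ?k (inverse (real (Suc n))) (y - x)) \<longlonglongrightarrow> F y * yukawa ?k 0 (y - x)" if "x \<noteq> y" for x y
    by (intro tendsto_mult tendsto_const yukawa_tendsto) (use that in auto)
  have bd: "\<bar>F y * yukawa ?k (inverse (real (Suc n))) (y - x)\<bar> \<le> K (x - y) * \<bar>F y\<bar>" if "x \<noteq> y" for n x y
  proof -
    have "\<bar>yukawa ?k (inverse (real (Suc n))) (y - x)\<bar> \<le> inverse (norm (y - x)) * exp (- ?k * norm (y - x))"
      by (rule yukawa_norm_le) (use k that in auto)
    also have "\<dots> = K (x - y)" using that by (simp add: K_def norm_minus_commute powr_neg_one inverse_eq_divide)
    finally show ?thesis unfolding abs_mult by (subst mult.commute) (intro mult_right_mono abs_ge_zero)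
  qed
  have eq': "(LINT y|lborel. u y * mollifier ?k (inverse (real (Suc n))) (y - x)) = (LINT y|lborel. F y * yukawa ?k (inverse (real (Suc n))) (y - x))" for n x
    by (rule eq) simp
  note rep = mollified_representation[where u = u and h = "\<lambda>y. \<bar>F y\<bar>" and K = K
      and Q = "\<lambda>n x y. F y * yukawa ?k (inverse (real (Suc n))) (y - x)" and Q' = "\<lambda>x y. F y * yukawa ?k 0 (y - x)",
      OF k(1) u_meas u2 K_meas F_abs_meas K0 F0 K_fin F_loc Q_meas Q_meas lim bd eq']
  show thesis
  proof (rule that[OF F_meas])
    fix y
    have "\<bar>\<gamma> * ?\<phi> y * u y\<bar> \<le> \<gamma> * ?\<phi> y * ?w y"
      unfolding abs_mult using pos P0[of y] by (intro mult_mono) auto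
    then show "\<bar>F y\<bar> \<le> (1 + \<beta>) * ?w y powr (p - 1) + \<gamma> * ?\<phi> y * ?w y"
      using f_le[of y] unfolding F_def by linarith
  qed (use rep in \<open>auto simp: K_def\<close>)
qed

section \<open>Exponential decay\<close>

text \<open>The limit kernel \<open>yukawa k 0\<close>, written with \<open>powr\<close> so that
  \<open>kernel_finite\<close> applies to it and to its powers. At the origin both versions take the
  default value 0.\<close>

definition yukawa_bound :: "real \<Rightarrow> R3 \<Rightarrow> real" where
  "yukawa_bound k z = norm z powr - 1 * exp (- k * norm z)"

lemma yukawa_bound_measurable [measurable]: "yukawa_bound k \<in> borel_measurable borel"
  unfolding yukawa_bound_def[abs_def] by measurable

lemma yukawa_bound_nonneg: "0 \<le> yukawa_bound k z"
  by (simp add: yukawa_bound_def)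

lemma yukawa_bound_commute: "yukawa_bound k (x - y) = yukawa_bound k (y - x)"
  by (simp add: yukawa_bound_def norm_minus_commute)

lemma yukawa_bound_finite: "k > 0 \<Longrightarrow> (\<integral>\<^sup>+z. ennreal (yukawa_bound k z) \<partial>lborel) < \<infinity>"
  unfolding yukawa_bound_def by (rule kernel_finite) auto

lemma yukawa_bound_mono: "k' \<le> k \<Longrightarrow> yukawa_bound k z \<le> yukawa_bound k' z"
  unfolding yukawa_bound_def by (intro mult_left_mono) (simp_all add: mult_right_mono)

lemma yukawa_0: "yukawa k 0 z = yukawa_bound k z"
  by (simp add: yukawa_def yukawa_bound_def rho_0 powr_neg_one' divide_inverse mult.commute)

text \<open>By the triangle inequality the weight at \<open>y\<close> exceeds the weight at
  \<open>x\<close> by at most a factor \<open>exp (k / 2 * norm (x - y))\<close>, which costs half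
  the decay rate of the kernel.\<close>

lemma yukawa_bound_shift:
  assumes "k > 0"
  shows "yukawa_bound k (x - y) * exp (- (k / 2) * norm y) \<le> yukawa_bound (k / 2) (x - y) * exp (- (k / 2) * norm x)"
proof -
  have "norm x \<le> norm (x - y) + norm y" using norm_triangle_ineq[of "x - y" y] by simp
  then have "(k / 2) * norm x \<le> (k / 2) * (norm (x - y) + norm y)" using assms by (intro mult_left_mono) auto
  then have "- k * norm (x - y) + - (k / 2) * norm y \<le> - (k / 2) * norm (x - y) + - (k / 2) * norm x"
    by (simp add: algebra_simps)
  then have "exp (- k * norm (x - y)) * exp (- (k / 2) * norm y) \<le> exp (- (k / 2) * norm (x - y)) * exp (- (k / 2) * norm x)"
    unfolding exp_add[symmetric] by simp
  then show ?thesis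
    unfolding yukawa_bound_def mult.assoc by (rule mult_left_mono) simp
qed

lemma nn_integral_ennreal_cmult:
  assumes "0 \<le> c" "f \<in> borel_measurable M"
  shows "(\<integral>\<^sup>+y. ennreal (c * f y) \<partial>M) = ennreal c * (\<integral>\<^sup>+y. ennreal (f y) \<partial>M)"
  using assms by (simp add: ennreal_mult' nn_integral_cmult)

text \<open>Off \<open>E\<close> the right-hand side is a convolution with a bounded compactly supported function, on \<open>E\<close> it is
  a contraction both for the weight \<open>exp (- (k / 2) * norm x)\<close> and for \<open>L\<^sup>2 (V dx)\<close>. The excess \<open>d\<close> of \<open>w\<close> over
  a multiple of the weight is subinvariant under the contraction, hence zero.\<close>

lemma exponential_decay_from_kernel:
  fixes w V :: "R3 \<Rightarrow> real"
  assumes k: "k > 0" and w_meas [measurable]: "w \<in> borel_measurable borel" and V_meas [measurable]: "V \<in> borel_measurable borel"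
    and E_meas [measurable]: "E \<in> sets borel" and w0: "\<And>x. 0 \<le> w x" and V0: "\<And>x. 0 \<le> V x"
    and w: "AE x in lborel. ennreal (w x) \<le> (\<integral>\<^sup>+y. ennreal (yukawa_bound k (x - y) * (V y * w y)) \<partial>lborel)"
    and small: "\<And>x. (\<integral>\<^sup>+y. ennreal (yukawa_bound (k / 2) (x - y) * (V y * indicator E y)) \<partial>lborel) \<le> ennreal (1 / 2)"
    and off: "\<And>y. y \<notin> E \<Longrightarrow> V y * w y \<le> B \<and> norm y \<le> R"
    and fin: "integrable lborel (\<lambda>y. V y * (w y)\<^sup>2)"
  obtains A where "A > 0" "AE x in lborel. w x \<le> A * exp (- (k / 2) * norm x)"
proof -
  let ?z = "k / 2"
  define g where "g x = exp (- ?z * norm (x::R3))" for x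
  have g0: "0 < g x" for x by (simp add: g_def)
  have [measurable]: "g \<in> borel_measurable borel" unfolding g_def by measurable
  let ?K = "yukawa_bound k" and ?L = "yukawa_bound ?z"
  note K0 = yukawa_bound_nonneg
  have KL: "?K z \<le> ?L z" for z by (rule yukawa_bound_mono) (use k in simp)
  have shift: "?K (x - y) * g y \<le> ?L (x - y) * g x" for x y
    unfolding g_def by (rule yukawa_bound_shift[OF k])
  obtain I where I: "(\<integral>\<^sup>+z. ennreal (?L z) \<partial>lborel) = ennreal I" "0 \<le> I"
    using yukawa_bound_finite[of ?z] k by (cases "\<integral>\<^sup>+z. ennreal (?L z) \<partial>lborel") auto
  define VE where "VE y = V y * indicator E y" for y
  have [measurable]: "VE \<in> borel_measurable borel" unfolding VE_def by measurable
  have VE0: "0 \<le> VE y" "VE y \<le> V y" for y using V0 by (auto simp: VE_def indicator_def)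
  \<comment> \<open>The factor converts the bound \<open>B\<close>, valid only where
    \<open>norm y \<le> R\<close>, into a multiple of the weight \<open>g\<close>, which is at least
    \<open>exp (- (k / 2) * \<bar>R\<bar>)\<close> there.\<close>
  define b where "b = \<bar>B\<bar> * exp (?z * \<bar>R\<bar>)"
  have b: "b \<ge> 0" by (simp add: b_def)
  define A where "A = b * I + 1"
  have A: "A > 0" using b I by (simp add: A_def add_nonneg_pos)
  have outer: "(\<integral>\<^sup>+y. ennreal (?K (x - y) * (V y * indicator (- E) y * w y)) \<partial>lborel) \<le> ennreal (A * g x)" for x
  proof -
    have "(\<integral>\<^sup>+y. ennreal (?K (x - y) * (V y * indicator (- E) y * w y)) \<partial>lborel) \<le> (\<integral>\<^sup>+y. ennreal ((b * g x) * ?L (x - y)) \<partial>lborel)"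
    proof (intro nn_integral_mono ennreal_leI)
      fix y
      show "?K (x - y) * (V y * indicator (- E) y * w y) \<le> (b * g x) * ?L (x - y)"
      proof (cases "y \<in> E")
        case True
        then show ?thesis using b g0[of x] K0[of ?z "x - y"] by simp
      next
        case False
        have "1 \<le> exp (?z * \<bar>R\<bar>) * g y"
        proof -
          have "?z * norm y \<le> ?z * \<bar>R\<bar>" using off[OF False] k by (intro mult_left_mono) auto
          then show ?thesis by (simp add: g_def flip: exp_add)
        qed
        then have "\<bar>B\<bar> * 1 \<le> \<bar>B\<bar> * (exp (?z * \<bar>R\<bar>) * g y)" by (intro mult_left_mono) auto
        then have "V y * w y \<le> b * g y" using off[OF False] unfolding b_def by linarith
        then have "?K (x - y) * (V y * w y) \<le> ?K (x - y) * (b * g y)" by (intro mult_left_mono K0)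
        also have "\<dots> = b * (?K (x - y) * g y)" by simp
        also have "\<dots> \<le> b * (?L (x - y) * g x)" by (intro mult_left_mono shift b)
        finally show ?thesis using False by (simp add: mult_ac)
      qed
    qed
    also have "\<dots> = ennreal (b * g x) * (\<integral>\<^sup>+y. ennreal (?L (x - y)) \<partial>lborel)"
      by (rule nn_integral_ennreal_cmult) (use b g0[of x] in \<open>auto simp: less_imp_le\<close>)
    also have "(\<integral>\<^sup>+y. ennreal (?L (x - y)) \<partial>lborel) = ennreal I"
      unfolding I(1)[symmetric] by (rule lborel_nn_integral_reflect[of "\<lambda>z. ennreal (?L z)"]) measurable
    also have "ennreal (b * g x) * ennreal I = ennreal (b * g x * I)"
      using b g0[of x] by (intro ennreal_mult'[symmetric]) (auto simp: less_imp_le)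
    also have "\<dots> \<le> ennreal (A * g x)"
      using g0[of x] by (intro ennreal_leI) (simp add: A_def algebra_simps less_imp_le)
    finally show ?thesis .
  qed
  \<comment> \<open>The multiple \<open>2 * A\<close> reproduces itself: \<open>outer\<close>
    contributes \<open>A * g x\<close>, and the contraction turns \<open>2 * A * g\<close> into
    another \<open>A * g x\<close>. Subtracting leaves a homogeneous inequality for the
    excess.\<close>
  define d where "d x = max 0 (w x - 2 * A * g x)" for x
  have [measurable]: "d \<in> borel_measurable borel" unfolding d_def by measurable
  have d0: "0 \<le> d x" "d x \<le> w x" "w x \<le> 2 * A * g x + d x" for x
    using w0[of x] A g0[of x] by (auto simp: d_def max_def mult_nonneg_nonneg less_imp_le)
  have inner: "(\<integral>\<^sup>+y. ennreal (?K (x - y) * (VE y * (2 * A * g y))) \<partial>lborel) \<le> ennreal (A * g x)" for x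
  proof -
    have "(\<integral>\<^sup>+y. ennreal (?K (x - y) * (VE y * (2 * A * g y))) \<partial>lborel) \<le> (\<integral>\<^sup>+y. ennreal ((2 * A * g x) * (?L (x - y) * VE y)) \<partial>lborel)"
    proof (intro nn_integral_mono ennreal_leI)
      fix y
      have "(2 * A * VE y) * (?K (x - y) * g y) \<le> (2 * A * VE y) * (?L (x - y) * g x)"
        using A VE0[of y] by (intro mult_left_mono shift) auto
      then show "?K (x - y) * (VE y * (2 * A * g y)) \<le> (2 * A * g x) * (?L (x - y) * VE y)" by (simp add: mult_ac)
    qed
    also have "\<dots> = ennreal (2 * A * g x) * (\<integral>\<^sup>+y. ennreal (?L (x - y) * VE y) \<partial>lborel)"
      by (rule nn_integral_ennreal_cmult) (use A g0[of x] in \<open>auto simp: less_imp_le\<close>)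
    also have "\<dots> \<le> ennreal (2 * A * g x) * ennreal (1 / 2)"
      by (intro mult_left_mono small[folded VE_def]) auto
    also have "\<dots> = ennreal (A * g x)"
      using A g0[of x] by (subst ennreal_mult'[symmetric]) (auto simp: less_imp_le)
    finally show ?thesis .
  qed
  define T where "T x = (\<integral>\<^sup>+y. ennreal (?K (x - y) * VE y) * ennreal (d y) \<partial>lborel)" for x
  have [measurable]: "T \<in> borel_measurable borel" unfolding T_def by measurable
  have dT: "AE x in lborel. ennreal (d x) \<le> T x"
    using w
  proof eventually_elim
    case (elim x)
    have "ennreal (w x) \<le> (\<integral>\<^sup>+y. ennreal (?K (x - y) * (V y * w y)) \<partial>lborel)" by (rule elim)
    also have "\<dots> \<le> (\<integral>\<^sup>+y. (ennreal (?K (x - y) * (V y * indicator (- E) y * w y)) + ennreal (?K (x - y) * (VE y * (2 * A * g y)))) + ennreal (?K (x - y) * VE y) * ennreal (d y) \<partial>lborel)"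
    proof (rule nn_integral_mono)
      fix y
      show "ennreal (?K (x - y) * (V y * w y)) \<le> (ennreal (?K (x - y) * (V y * indicator (- E) y * w y)) + ennreal (?K (x - y) * (VE y * (2 * A * g y)))) + ennreal (?K (x - y) * VE y) * ennreal (d y)"
      proof (cases "y \<in> E")
        case True
        have "?K (x - y) * (V y * w y) \<le> ?K (x - y) * (V y * (2 * A * g y + d y))"
          using d0[of y] V0[of y] by (intro mult_left_mono K0) auto
        also have "\<dots> = ?K (x - y) * (V y * (2 * A * g y)) + ?K (x - y) * V y * d y" by (simp add: algebra_simps)
        finally have "ennreal (?K (x - y) * (V y * w y)) \<le> ennreal (?K (x - y) * (V y * (2 * A * g y)) + ?K (x - y) * V y * d y)"
          by (rule ennreal_leI)
        also have "\<dots> = ennreal (?K (x - y) * (V y * (2 * A * g y))) + ennreal (?K (x - y) * V y * d y)"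
          using A g0[of y] V0[of y] K0[of k "x - y"] d0[of y] by (intro ennreal_plus mult_nonneg_nonneg) (auto simp: less_imp_le)
        also have "ennreal (?K (x - y) * V y * d y) = ennreal (?K (x - y) * V y) * ennreal (d y)"
          using V0[of y] K0[of k "x - y"] by (intro ennreal_mult') auto
        finally show ?thesis using True by (simp add: VE_def)
      next
        case False
        then show ?thesis by (simp add: VE_def)
      qed
    qed
    also have "\<dots> = (\<integral>\<^sup>+y. ennreal (?K (x - y) * (V y * indicator (- E) y * w y)) + ennreal (?K (x - y) * (VE y * (2 * A * g y))) \<partial>lborel) + T x"
      unfolding T_def by (rule nn_integral_add) measurable
    also have "(\<integral>\<^sup>+y. ennreal (?K (x - y) * (V y * indicator (- E) y * w y)) + ennreal (?K (x - y) * (VE y * (2 * A * g y))) \<partial>lborel) =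
      (\<integral>\<^sup>+y. ennreal (?K (x - y) * (V y * indicator (- E) y * w y)) \<partial>lborel) + (\<integral>\<^sup>+y. ennreal (?K (x - y) * (VE y * (2 * A * g y))) \<partial>lborel)"
      by (rule nn_integral_add) measurable
    finally have le1: "ennreal (w x) \<le> (\<integral>\<^sup>+y. ennreal (?K (x - y) * (V y * indicator (- E) y * w y)) \<partial>lborel) + (\<integral>\<^sup>+y. ennreal (?K (x - y) * (VE y * (2 * A * g y))) \<partial>lborel) + T x" .
    have le2: "(\<integral>\<^sup>+y. ennreal (?K (x - y) * (V y * indicator (- E) y * w y)) \<partial>lborel) + (\<integral>\<^sup>+y. ennreal (?K (x - y) * (VE y * (2 * A * g y))) \<partial>lborel) + T x \<le> ennreal (A * g x) + ennreal (A * g x) + T x"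
      by (intro add_mono outer inner order_refl)
    have eq: "ennreal (A * g x) + ennreal (A * g x) = ennreal (2 * A * g x)"
      using A g0[of x] by (subst ennreal_plus[symmetric]) (auto simp: less_imp_le)
    have le: "ennreal (w x) \<le> ennreal (2 * A * g x) + T x"
      using order_trans[OF le1 le2] unfolding eq .
    show "ennreal (d x) \<le> T x"
    proof (cases "T x")
      case (real r)
      have "ennreal (w x) \<le> ennreal (2 * A * g x + r)"
        using le A g0[of x] real by (simp add: less_imp_le)
      then have "w x \<le> 2 * A * g x + r"
        using A g0[of x] real by (subst (asm) ennreal_le_iff) (auto simp: less_imp_le)
      then have "d x \<le> r" using real by (simp add: d_def)
      with real show ?thesis by (simp add: ennreal_leI)
    qed simp
  qed
  \<comment> \<open>Weighting with \<open>VE\<close> makes the kernel operator symmetric. After the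
    order of integration is exchanged, the other variable again meets an integral of at most
    \<open>1 / 2\<close>; with the factor from Cauchy-Schwarz this gives
    \<open>1 / 4\<close>.\<close>
  define L where "L = (\<integral>\<^sup>+x. ennreal (VE x) * ennreal ((d x)\<^sup>2) \<partial>lborel)"
  have half: "(\<integral>\<^sup>+y. ennreal (?K (x - y) * VE y) \<partial>lborel) \<le> ennreal (1 / 2)" for x
  proof -
    have "(\<integral>\<^sup>+y. ennreal (?K (x - y) * VE y) \<partial>lborel) \<le> (\<integral>\<^sup>+y. ennreal (?L (x - y) * VE y) \<partial>lborel)"
      by (intro nn_integral_mono ennreal_leI mult_right_mono KL VE0)
    also have "\<dots> \<le> ennreal (1 / 2)" by (rule small[folded VE_def])
    finally show ?thesis .
  qed
  have "L \<le> ennreal (1 / 4) * L"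
  proof -
    have "L \<le> (\<integral>\<^sup>+x. ennreal (VE x) * (ennreal (1 / 2) * (\<integral>\<^sup>+y. ennreal (?K (x - y) * VE y) * ennreal ((d y)\<^sup>2) \<partial>lborel)) \<partial>lborel)"
      unfolding L_def
    proof (rule nn_integral_mono_AE, use dT in eventually_elim)
      case (elim x)
      have "ennreal ((d x)\<^sup>2) = (ennreal (d x))\<^sup>2" using d0 by (simp add: ennreal_power)
      also have "\<dots> \<le> (T x)\<^sup>2" using elim by (intro power_mono) auto
      also have "\<dots> \<le> (\<integral>\<^sup>+y. ennreal (?K (x - y) * VE y) \<partial>lborel) * (\<integral>\<^sup>+y. ennreal (?K (x - y) * VE y) * ennreal ((d y)\<^sup>2) \<partial>lborel)"
        unfolding T_def by (rule nn_integral_weighted_Cauchy_Schwarz) (use K0 VE0 d0 in auto)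
      also have "\<dots> \<le> ennreal (1 / 2) * (\<integral>\<^sup>+y. ennreal (?K (x - y) * VE y) * ennreal ((d y)\<^sup>2) \<partial>lborel)"
        by (intro mult_right_mono half) auto
      finally show ?case by (rule mult_left_mono) simp
    qed
    also have "\<dots> = (\<integral>\<^sup>+x. (\<integral>\<^sup>+y. ennreal (1 / 2) * ennreal (VE x) * (ennreal (?K (x - y) * VE y) * ennreal ((d y)\<^sup>2)) \<partial>lborel) \<partial>lborel)"
      by (subst nn_integral_cmult) (simp_all add: mult_ac)
    also have "\<dots> = (\<integral>\<^sup>+y. (\<integral>\<^sup>+x. ennreal (1 / 2) * ennreal (VE x) * (ennreal (?K (x - y) * VE y) * ennreal ((d y)\<^sup>2)) \<partial>lborel) \<partial>lborel)"
      by (rule lborel_pair.Fubini') measurable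
    also have "\<dots> = (\<integral>\<^sup>+y. (\<integral>\<^sup>+x. (ennreal (1 / 2) * (ennreal (VE y) * ennreal ((d y)\<^sup>2))) * ennreal (?K (y - x) * VE x) \<partial>lborel) \<partial>lborel)"
    proof (intro nn_integral_cong)
      fix x y :: R3
      have "ennreal (VE x) * ennreal (?K (x - y) * VE y) = ennreal (VE x * (?K (x - y) * VE y))"
        by (rule ennreal_mult'[symmetric]) (rule VE0)
      also have "VE x * (?K (x - y) * VE y) = VE y * (?K (y - x) * VE x)"
        by (simp only: yukawa_bound_commute[of k x y] mult_ac)
      also have "ennreal \<dots> = ennreal (VE y) * ennreal (?K (y - x) * VE x)"
        by (rule ennreal_mult') (rule VE0)
      finally have eq: "ennreal (VE x) * ennreal (?K (x - y) * VE y) = ennreal (VE y) * ennreal (?K (y - x) * VE x)" .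
      have "ennreal (1 / 2) * ennreal (VE x) * (ennreal (?K (x - y) * VE y) * ennreal ((d y)\<^sup>2)) =
        ennreal (1 / 2) * (ennreal (VE x) * ennreal (?K (x - y) * VE y)) * ennreal ((d y)\<^sup>2)"
        by (simp only: mult.assoc)
      also have "\<dots> = (ennreal (1 / 2) * (ennreal (VE y) * ennreal ((d y)\<^sup>2))) * ennreal (?K (y - x) * VE x)"
        unfolding eq by (simp only: mult_ac)
      finally show "ennreal (1 / 2) * ennreal (VE x) * (ennreal (?K (x - y) * VE y) * ennreal ((d y)\<^sup>2)) =
        (ennreal (1 / 2) * (ennreal (VE y) * ennreal ((d y)\<^sup>2))) * ennreal (?K (y - x) * VE x)" .
    qed
    also have "\<dots> = (\<integral>\<^sup>+y. (ennreal (1 / 2) * (ennreal (VE y) * ennreal ((d y)\<^sup>2))) * (\<integral>\<^sup>+x. ennreal (?K (y - x) * VE x) \<partial>lborel) \<partial>lborel)"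
      by (intro nn_integral_cong nn_integral_cmult) measurable
    also have "\<dots> \<le> (\<integral>\<^sup>+y. (ennreal (1 / 2) * (ennreal (VE y) * ennreal ((d y)\<^sup>2))) * ennreal (1 / 2) \<partial>lborel)"
      by (intro nn_integral_mono mult_left_mono half) auto
    also have "\<dots> = (\<integral>\<^sup>+y. ennreal (1 / 4) * (ennreal (VE y) * ennreal ((d y)\<^sup>2)) \<partial>lborel)"
    proof (rule nn_integral_cong)
      fix y
      have "ennreal (1 / 2) * ennreal (1 / 2) = ennreal (1 / 4)" by (subst ennreal_mult'[symmetric]) auto
      moreover have "(ennreal (1 / 2) * (ennreal (VE y) * ennreal ((d y)\<^sup>2))) * ennreal (1 / 2) =
        (ennreal (1 / 2) * ennreal (1 / 2)) * (ennreal (VE y) * ennreal ((d y)\<^sup>2))"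
        by (simp only: mult_ac)
      ultimately show "(ennreal (1 / 2) * (ennreal (VE y) * ennreal ((d y)\<^sup>2))) * ennreal (1 / 2) = ennreal (1 / 4) * (ennreal (VE y) * ennreal ((d y)\<^sup>2))"
        by simp
    qed
    also have "\<dots> = ennreal (1 / 4) * L" unfolding L_def by (rule nn_integral_cmult) measurable
    finally show ?thesis .
  qed
  \<comment> \<open>Absorption requires finiteness, which is inherited from \<open>w\<close> because
    \<open>d\<close> does not exceed it; this is the purpose of the hypothesis
    \<open>fin\<close>.\<close>
  moreover have "L < \<infinity>"
  proof -
    have "L \<le> (\<integral>\<^sup>+x. ennreal (V x * (w x)\<^sup>2) \<partial>lborel)"
      unfolding L_def
    proof (rule nn_integral_mono)
      fix x
      have "VE x * (d x)\<^sup>2 \<le> V x * (w x)\<^sup>2" using VE0[of x] V0[of x] d0[of x] by (intro mult_mono power_mono) auto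
      then show "ennreal (VE x) * ennreal ((d x)\<^sup>2) \<le> ennreal (V x * (w x)\<^sup>2)"
        using VE0[of x] by (subst ennreal_mult'[symmetric]) (auto intro: ennreal_leI)
    qed
    also have "\<dots> = ennreal (LINT x|lborel. V x * (w x)\<^sup>2)"
      using V0 by (intro nn_integral_eq_integral fin) auto
    finally show ?thesis by (rule le_less_trans) simp
  qed
  ultimately have L: "L = 0"
  proof (cases L)
    case (real r)
    have "r \<le> 1 / 4 * r"
      using \<open>L \<le> ennreal (1 / 4) * L\<close> real by (simp flip: ennreal_mult')
    then show ?thesis using real by simp
  qed simp
  then have "AE x in lborel. ennreal (VE x) * ennreal ((d x)\<^sup>2) = 0"
    unfolding L_def by (subst (asm) nn_integral_0_iff_AE) auto
  then have VEd: "AE y in lborel. VE y = 0 \<or> d y = 0"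
    by eventually_elim (use VE0 in \<open>auto simp: ennreal_eq_0_iff order.antisym\<close>)
  \<comment> \<open>So far \<open>d\<close> vanishes only where \<open>VE\<close> does not. But
    \<open>T\<close> sees \<open>d\<close> through \<open>VE\<close> alone, so it is 0 at every
    point, and \<open>dT\<close> carries this over to \<open>d\<close> also off
    \<open>E\<close>.\<close>
  have T0: "T x = 0" for x
  proof -
    have "T x = (\<integral>\<^sup>+(y::R3). 0 \<partial>lborel)"
      unfolding T_def by (rule nn_integral_cong_AE, use VEd in eventually_elim) auto
    then show ?thesis by simp
  qed
  from dT have "AE x in lborel. w x \<le> (2 * A) * exp (- (k / 2) * norm x)"
  proof eventually_elim
    case (elim x)
    then have "d x = 0" using d0(1)[of x] by (simp add: T0 ennreal_eq_0_iff)
    with d0(3)[of x] show ?case by (simp add: g_def)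
  qed
  then show thesis using A by (intro that[of "2 * A"]) auto
qed

text \<open>The singular kernel is an \<open>L\<^sup>1\<close> limit of the smooth ones, and
  \<open>F\<close> is bounded. The error is at most \<open>C * \<delta> n\<close> independently of
  \<open>x\<close>, so the potential is a uniform limit of continuous functions. Its decay follows
  from the weight estimate \<open>yukawa_bound_shift\<close>.\<close>

lemma yukawa_potential:
  fixes F :: "R3 \<Rightarrow> real"
  assumes k: "k > 0" and F_meas [measurable]: "F \<in> borel_measurable borel" and C0: "0 \<le> C"
    and F: "AE y in lborel. \<bar>F y\<bar> \<le> C * exp (- (k / 2) * norm y)"
  shows "continuous_on UNIV (\<lambda>x. LINT y|lborel. F y * yukawa k 0 (y - x))"
    and "\<exists>D. \<forall>x. \<bar>LINT y|lborel. F y * yukawa k 0 (y - x)\<bar> \<le> D * exp (- (k / 2) * norm x)"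
proof -
  let ?e = "\<lambda>n. inverse (real (Suc n))"
  have L_int: "integrable lborel (\<lambda>y. yukawa_bound a (x - y))" if "a > 0" for a x
  proof (rule integrableI_nonneg)
    show "(\<integral>\<^sup>+y. ennreal (yukawa_bound a (x - y)) \<partial>lborel) < \<infinity>"
      using yukawa_bound_finite[OF that] lborel_nn_integral_reflect[of "\<lambda>z. ennreal (yukawa_bound a z)" x] by simp
  qed (auto simp: yukawa_bound_nonneg)
  have F1: "AE y in lborel. \<bar>F y\<bar> \<le> C"
    using F
  proof eventually_elim
    case (elim y)
    have "C * exp (- (k / 2) * norm y) \<le> C * 1" using k C0 by (intro mult_left_mono) auto
    with elim show ?case by simp
  qed
  have F_int: "integrable lborel F"
  proof (rule Bochner_Integration.integrable_bound)
    show "integrable lborel (\<lambda>y::R3. C * exp (- (k / 2) * norm y))"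
      using k by (intro integrable_mult_right integrable_exp_minus_norm) simp
    show "AE y in lborel. norm (F y) \<le> norm (C * exp (- (k / 2) * norm y))"
      using F by eventually_elim simp
  qed measurable
  have AE_ne: "AE y in lborel. y \<noteq> x" for x :: R3 by (rule AE_lborel_singleton)
  have le: "\<bar>yukawa k (?e n) (y - x)\<bar> \<le> yukawa_bound k (x - y)" if "y \<noteq> x" for n x y
  proof -
    have "\<bar>yukawa k (?e n) (y - x)\<bar> \<le> inverse (norm (y - x)) * exp (- k * norm (y - x))"
      by (rule yukawa_norm_le) (use k that in auto)
    then show ?thesis by (simp add: yukawa_bound_def norm_minus_commute powr_neg_one' divide_inverse)
  qed
  define U where "U n x = (LINT y|lborel. F y * yukawa k (?e n) (y - x))" for n x
  define U' where "U' x = (LINT y|lborel. F y * yukawa k 0 (y - x))" for x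
  have U_cont: "continuous_on UNIV (U n)" for n
    unfolding continuous_on_sequentially
  proof (intro allI ballI impI)
    fix X and a :: R3 assume "(\<forall>m. X m \<in> UNIV) \<and> X \<longlonglongrightarrow> a"
    then have X: "X \<longlonglongrightarrow> a" by simp
    have "(\<lambda>m. U n (X m)) \<longlonglongrightarrow> U n a"
      unfolding U_def
    proof (rule integral_dominated_convergence)
      show "integrable lborel (\<lambda>y. inverse (?e n) * \<bar>F y\<bar>)" using F_int by auto
      show "AE y in lborel. (\<lambda>m. F y * yukawa k (?e n) (y - X m)) \<longlonglongrightarrow> F y * yukawa k (?e n) (y - a)"
      proof (intro AE_I2 tendsto_mult tendsto_const)
        fix y
        have "(\<lambda>m. y - X m) \<longlonglongrightarrow> y - a" by (intro tendsto_intros X)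
        with smooth_continuous[OF smooth_yukawa[OF k], of "?e n" UNIV]
        show "(\<lambda>m. yukawa k (?e n) (y - X m)) \<longlonglongrightarrow> yukawa k (?e n) (y - a)"
          by (auto intro: continuous_on_tendsto_compose simp del: of_nat_Suc)
      qed
      show "AE y in lborel. norm (F y * yukawa k (?e n) (y - X m)) \<le> inverse (?e n) * \<bar>F y\<bar>" for m
      proof (intro AE_I2)
        fix y
        have "\<bar>yukawa k (?e n) (y - X m)\<bar> \<le> inverse (?e n) * exp (- k * norm (y - X m))"
          by (rule yukawa_le) (use k in auto)
        also have "\<dots> \<le> inverse (?e n) * 1" using k by (intro mult_left_mono) auto
        finally have "\<bar>F y\<bar> * \<bar>yukawa k (?e n) (y - X m)\<bar> \<le> \<bar>F y\<bar> * inverse (?e n)" by (intro mult_left_mono) auto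
        then show "norm (F y * yukawa k (?e n) (y - X m)) \<le> inverse (?e n) * \<bar>F y\<bar>"
          by (simp only: real_norm_def abs_mult mult.commute)
      qed
    qed measurable
    then show "(U n \<circ> X) \<longlonglongrightarrow> U n a" by (simp add: comp_def)
  qed
  define \<delta> where "\<delta> n = (LINT z|lborel. \<bar>yukawa k (?e n) z - yukawa k 0 z\<bar>)" for n
  have diff_le: "\<bar>yukawa k (?e n) (y - x) - yukawa k 0 (y - x)\<bar> \<le> 2 * yukawa_bound k (x - y)" if "y \<noteq> x" for n x y
    using le[OF that, of n] by (simp add: yukawa_0 yukawa_bound_commute[of k x y])
  have \<delta>: "\<delta> \<longlonglongrightarrow> 0"
  proof -
    have "\<delta> \<longlonglongrightarrow> (LINT (z::R3)|lborel. 0)"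
      unfolding \<delta>_def
    proof (rule integral_dominated_convergence)
      show "integrable lborel (\<lambda>z. 2 * yukawa_bound k (0 - z))" by (intro integrable_mult_right L_int k)
      show "AE z in lborel. (\<lambda>n. \<bar>yukawa k (?e n) z - yukawa k 0 z\<bar>) \<longlonglongrightarrow> 0"
        using AE_ne[of 0]
      proof eventually_elim
        case (elim z)
        have "(\<lambda>n. \<bar>yukawa k (?e n) z - yukawa k 0 z\<bar>) \<longlonglongrightarrow> \<bar>yukawa k 0 z - yukawa k 0 z\<bar>"
          by (intro tendsto_intros yukawa_tendsto elim)
        then show ?case by simp
      qed
      show "AE z in lborel. norm \<bar>yukawa k (?e n) z - yukawa k 0 z\<bar> \<le> 2 * yukawa_bound k (0 - z)" for n
        using AE_ne[of 0] by eventually_elim (use diff_le[of _ 0 n] in simp)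
    qed measurable
    then show ?thesis by simp
  qed
  have FK: "integrable lborel (\<lambda>y. F y * yukawa k e (y - x))" if "e = 0 \<or> (\<exists>n. e = ?e n)" for e x
  proof (rule integral_dominated(1)[where g = "\<lambda>y. C * yukawa_bound k (x - y)"])
    show "integrable lborel (\<lambda>y. C * yukawa_bound k (x - y))" by (intro integrable_mult_right L_int k)
    show "AE y in lborel. \<bar>F y * yukawa k e (y - x)\<bar> \<le> C * yukawa_bound k (x - y)"
      using F1 AE_ne[of x]
    proof eventually_elim
      case (elim y)
      have "\<bar>yukawa k e (y - x)\<bar> \<le> yukawa_bound k (x - y)"
        using that le[OF elim(2)] yukawa_bound_nonneg by (auto simp: yukawa_0 yukawa_bound_commute[of k x y] simp del: of_nat_Suc)
      then show ?case unfolding abs_mult using C0 by (intro mult_mono elim(1)) auto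
    qed
  qed measurable
  have unif: "\<bar>U n x - U' x\<bar> \<le> C * \<delta> n" for n x
  proof -
    have "U n x - U' x = (LINT y|lborel. F y * yukawa k (?e n) (y - x) - F y * yukawa k 0 (y - x))"
      unfolding U_def U'_def by (rule Bochner_Integration.integral_diff[symmetric]) (use FK in auto)
    also have "\<bar>\<dots>\<bar> \<le> (LINT y|lborel. C * \<bar>yukawa k (?e n) (y - x) - yukawa k 0 (y - x)\<bar>)"
    proof (rule integral_dominated(2))
      show "integrable lborel (\<lambda>y. C * \<bar>yukawa k (?e n) (y - x) - yukawa k 0 (y - x)\<bar>)"
      proof (rule integral_dominated(1)[where g = "\<lambda>y. C * (2 * yukawa_bound k (x - y))"])
        show "integrable lborel (\<lambda>y. C * (2 * yukawa_bound k (x - y)))" by (intro integrable_mult_right L_int k)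
        show "AE y in lborel. \<bar>C * \<bar>yukawa k (?e n) (y - x) - yukawa k 0 (y - x)\<bar>\<bar> \<le> C * (2 * yukawa_bound k (x - y))"
          using AE_ne[of x]
        proof eventually_elim
          case (elim y)
          show ?case using mult_left_mono[OF diff_le[OF elim, of n] C0] C0 by (simp add: abs_mult del: of_nat_Suc)
        qed
      qed measurable
      show "AE y in lborel. \<bar>F y * yukawa k (?e n) (y - x) - F y * yukawa k 0 (y - x)\<bar> \<le> C * \<bar>yukawa k (?e n) (y - x) - yukawa k 0 (y - x)\<bar>"
        using F1
      proof eventually_elim
        case (elim y)
        show ?case unfolding right_diff_distrib[symmetric] abs_mult by (intro mult_right_mono elim) simp
      qed
    qed measurable
    also have "\<dots> = C * (LINT y|lborel. \<bar>yukawa k (?e n) (y - x) - yukawa k 0 (y - x)\<bar>)" by simp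
    also have "(LINT y|lborel. \<bar>yukawa k (?e n) (y - x) - yukawa k 0 (y - x)\<bar>) = \<delta> n"
      unfolding \<delta>_def using lborel_integral_shift[of "\<lambda>z. \<bar>yukawa k (?e n) z - yukawa k 0 z\<bar>" "- x"] by simp
    finally show ?thesis .
  qed
  have "uniform_limit UNIV U U' sequentially"
    unfolding uniform_limit_iff
  proof (intro allI impI)
    fix e :: real assume e: "e > 0"
    have "(\<lambda>n. C * \<delta> n) \<longlonglongrightarrow> C * 0" by (intro tendsto_intros \<delta>)
    then have "\<forall>\<^sub>F n in sequentially. C * \<delta> n < e" using e by (intro order_tendstoD(2)) auto
    then show "\<forall>\<^sub>F n in sequentially. \<forall>x\<in>UNIV. dist (U n x) (U' x) < e"
      by eventually_elim (use unif in \<open>auto simp: dist_real_def intro: le_less_trans\<close>)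
  qed
  then have "continuous_on UNIV U'"
    by (rule uniform_limit_theorem[rotated]) (use U_cont in auto)
  then show "continuous_on UNIV (\<lambda>x. LINT y|lborel. F y * yukawa k 0 (y - x))"
    unfolding U'_def .
  define I where "I = (LINT z|lborel. yukawa_bound (k / 2) (0 - z))"
  show "\<exists>D. \<forall>x. \<bar>LINT y|lborel. F y * yukawa k 0 (y - x)\<bar> \<le> D * exp (- (k / 2) * norm x)"
  proof (intro exI allI)
    fix x :: R3
    have "\<bar>LINT y|lborel. F y * yukawa k 0 (y - x)\<bar> \<le> (LINT y|lborel. C * exp (- (k / 2) * norm x) * yukawa_bound (k / 2) (x - y))"
    proof (rule integral_dominated(2))
      show "integrable lborel (\<lambda>y. C * exp (- (k / 2) * norm x) * yukawa_bound (k / 2) (x - y))"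
        using k by (intro integrable_mult_right L_int) simp
      show "AE y in lborel. \<bar>F y * yukawa k 0 (y - x)\<bar> \<le> C * exp (- (k / 2) * norm x) * yukawa_bound (k / 2) (x - y)"
        using F
      proof eventually_elim
        case (elim y)
        have "\<bar>F y * yukawa k 0 (y - x)\<bar> = \<bar>F y\<bar> * yukawa_bound k (x - y)"
          using yukawa_bound_nonneg[of k "y - x"] by (simp add: abs_mult yukawa_0 yukawa_bound_commute[of k x y])
        also have "\<dots> \<le> C * exp (- (k / 2) * norm y) * yukawa_bound k (x - y)"
          by (intro mult_right_mono elim yukawa_bound_nonneg)
        also have "\<dots> = C * (yukawa_bound k (x - y) * exp (- (k / 2) * norm y))" by simp
        also have "\<dots> \<le> C * (yukawa_bound (k / 2) (x - y) * exp (- (k / 2) * norm x))"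
          by (intro mult_left_mono yukawa_bound_shift k C0)
        finally show ?case by (simp add: mult_ac)
      qed
    qed measurable
    also have "\<dots> = C * exp (- (k / 2) * norm x) * (LINT y|lborel. yukawa_bound (k / 2) (x - y))" by simp
    also have "(LINT y|lborel. yukawa_bound (k / 2) (x - y)) = I"
      using lborel_integral_affine[of "\<lambda>y. yukawa_bound (k / 2) (x - y)" "1" x] by (simp add: I_def)
    finally show "\<bar>LINT y|lborel. F y * yukawa k 0 (y - x)\<bar> \<le> (C * I) * exp (- (k / 2) * norm x)"
      by (simp add: mult_ac)
  qed
qed

text \<open>Rescaling the factors by \<open>d powr (1 / m')\<close> and its inverse makes the first
  term as small as desired; the factors \<open>1 / m'\<close> and \<open>1 / m\<close> are
  discarded. The large constant on the second term is harmless where that term can be made small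
  independently.\<close>

lemma Youngs_inequality_scaled:
  fixes a b d m m' :: real
  assumes "m > 1" "m' > 1" "1 / m' + 1 / m = 1" "0 \<le> a" "0 \<le> b" "d > 0"
  shows "a * b \<le> d * a powr m' + d powr (- m / m') * b powr m"
proof -
  define s where "s = d powr (1 / m')"
  have s: "s > 0" using assms by (simp add: s_def)
  have "a * b = (s * a) * (inverse s * b)" using s by (simp add: field_simps)
  also have "\<dots> \<le> (s * a) powr m' / m' + (inverse s * b) powr m / m"
    using assms s by (intro Youngs_inequality) auto
  also have "\<dots> \<le> (s * a) powr m' / 1 + (inverse s * b) powr m / 1"
    using assms by (intro add_mono divide_left_mono) auto
  also have "(s * a) powr m' = d * a powr m'"
    using assms s by (simp add: powr_mult s_def powr_powr)
  also have "(inverse s * b) powr m = d powr (- m / m') * b powr m"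
    using assms s by (simp add: powr_mult s_def powr_minus[symmetric] powr_powr)
  finally show ?thesis by simp
qed

lemma weak_solution_exponential_decay:
  assumes sol: "weak_solution p \<gamma> \<beta> lam u v" and p: "10 / 3 \<le> p" "p < 6"
    and pos: "\<gamma> > 0" "\<beta> > 0" "lam > 0"
  shows "exponential_decay u v"
proof -
  have H: "u \<in> H1" "v \<in> H1" using sol by (auto simp: weak_solution_def)
  note [measurable] = H1D(1)[OF H(1)] H1D(1)[OF H(2)] coulomb_measurable[OF H]
  define k where "k = sqrt lam"
  have k: "k > 0" using pos by (simp add: k_def)
  let ?\<phi> = "coulomb u v"
  note P0 = coulomb_nonneg[of u v]
  obtain P where P: "P > 0" "\<And>x. ?\<phi> x \<le> P" using coulomb_bounded[OF H] by blast
  define w where "w y = \<bar>u y\<bar> + \<bar>v y\<bar>" for y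
  have w_meas [measurable]: "w \<in> borel_measurable borel" unfolding w_def by measurable
  have w0: "0 \<le> w y" for y by (simp add: w_def)
  have w_Lq: "integrable lborel (\<lambda>y. w y powr q)" if "2 \<le> q" "q < 6" for q
    unfolding w_def by (rule H1_sum_Lq[OF H that])
  have powr_eq: "w y powr (t - 1) = w y powr (t - 2) * w y" for t y
    using w0[of y] by (cases "w y = 0") (auto simp: powr_diff power2_eq_square)
  obtain F1 where F1: "F1 \<in> borel_measurable borel"
    "\<And>y. \<bar>F1 y\<bar> \<le> (1 + \<beta>) * w y powr (p - 1) + \<gamma> * ?\<phi> y * w y"
    "AE x in lborel. mass * u x = (LINT y|lborel. F1 y * yukawa k 0 (y - x))"
    "AE x in lborel. ennreal (mass * \<bar>u x\<bar>) \<le> (\<integral>\<^sup>+y. ennreal (yukawa_bound k (x - y)) * ennreal \<bar>F1 y\<bar> \<partial>lborel)"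
    unfolding w_def k_def yukawa_bound_def by (rule weak_solution_representation[OF sol p pos]) blast
  obtain F2 where F2: "F2 \<in> borel_measurable borel"
    "\<And>y. \<bar>F2 y\<bar> \<le> (1 + \<beta>) * w y powr (p - 1) + \<gamma> * ?\<phi> y * w y"
    "AE x in lborel. mass * v x = (LINT y|lborel. F2 y * yukawa k 0 (y - x))"
    "AE x in lborel. ennreal (mass * \<bar>v x\<bar>) \<le> (\<integral>\<^sup>+y. ennreal (yukawa_bound k (x - y)) * ennreal \<bar>F2 y\<bar> \<partial>lborel)"
    unfolding w_def k_def yukawa_bound_def coulomb_commute[of u v] add.commute[of "\<bar>u y\<bar>" "\<bar>v y\<bar>" for y]
    by (rule weak_solution_representation[OF weak_solution_commute[OF sol] p pos]) blast
  note [measurable] = F1(1) F2(1)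
  note mp = mass_pos
  \<comment> \<open>The 2 accounts for adding the two equations, whose right-hand sides obey the
    same bound, and \<open>mass\<close> is the normalization of the representation formula.\<close>
  define a1 where "a1 = 2 / mass * (1 + \<beta>)"
  define a2 where "a2 = 2 / mass * \<gamma>"
  have a: "a1 > 0" "a2 > 0" using mp pos by (auto simp: a1_def a2_def)
  define V where "V y = a1 * w y powr (p - 2) + a2 * ?\<phi> y" for y
  have V_meas [measurable]: "V \<in> borel_measurable borel" unfolding V_def by measurable
  have V0: "0 \<le> V y" for y using a P0[of y] by (simp add: V_def)
  have F12: "\<bar>F1 y\<bar> + \<bar>F2 y\<bar> \<le> mass * (V y * w y)" for y
  proof -
    have "mass * (V y * w y) = 2 * ((1 + \<beta>) * (w y powr (p - 2) * w y) + \<gamma> * ?\<phi> y * w y)"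
      using mp by (simp add: V_def a1_def a2_def field_simps)
    then show ?thesis using add_mono[OF F1(2)[of y] F2(2)[of y]] unfolding powr_eq mult_2 by (simp only:)
  qed
  have ineq: "AE x in lborel. ennreal (w x) \<le> (\<integral>\<^sup>+y. ennreal (yukawa_bound k (x - y) * (V y * w y)) \<partial>lborel)"
    using F1(4) F2(4)
  proof eventually_elim
    case (elim x)
    let ?K = "\<lambda>y. yukawa_bound k (x - y)"
    have "ennreal (mass * w x) = ennreal (mass * \<bar>u x\<bar>) + ennreal (mass * \<bar>v x\<bar>)"
      using mp by (simp add: w_def distrib_left)
    also have "\<dots> \<le> (\<integral>\<^sup>+y. ennreal (?K y) * ennreal \<bar>F1 y\<bar> \<partial>lborel) + (\<integral>\<^sup>+y. ennreal (?K y) * ennreal \<bar>F2 y\<bar> \<partial>lborel)"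
      by (intro add_mono elim)
    also have "\<dots> = (\<integral>\<^sup>+y. ennreal (?K y) * ennreal \<bar>F1 y\<bar> + ennreal (?K y) * ennreal \<bar>F2 y\<bar> \<partial>lborel)"
      by (rule nn_integral_add[symmetric]) measurable
    also have "\<dots> \<le> (\<integral>\<^sup>+y. ennreal (mass * (?K y * (V y * w y))) \<partial>lborel)"
    proof (rule nn_integral_mono)
      fix y
      have "ennreal (?K y) * ennreal \<bar>F1 y\<bar> + ennreal (?K y) * ennreal \<bar>F2 y\<bar> = ennreal (?K y) * ennreal (\<bar>F1 y\<bar> + \<bar>F2 y\<bar>)"
        by (simp add: distrib_left)
      also have "\<dots> = ennreal (?K y * (\<bar>F1 y\<bar> + \<bar>F2 y\<bar>))"
        by (rule ennreal_mult'[symmetric]) (rule yukawa_bound_nonneg)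
      also have "\<dots> \<le> ennreal (?K y * (mass * (V y * w y)))"
        by (intro ennreal_leI mult_left_mono F12 yukawa_bound_nonneg)
      finally show "ennreal (?K y) * ennreal \<bar>F1 y\<bar> + ennreal (?K y) * ennreal \<bar>F2 y\<bar> \<le> ennreal (mass * (?K y * (V y * w y)))"
        by (simp only: mult.left_commute)
    qed
    also have "\<dots> = ennreal mass * (\<integral>\<^sup>+y. ennreal (?K y * (V y * w y)) \<partial>lborel)"
      by (rule nn_integral_ennreal_cmult) (use mp in auto)
    finally have le: "ennreal (mass * w x) \<le> ennreal mass * (\<integral>\<^sup>+y. ennreal (?K y * (V y * w y)) \<partial>lborel)" .
    have one: "ennreal (1 / mass) * ennreal mass = 1"
      using mp by (subst ennreal_mult'[symmetric]) auto
    have "ennreal (w x) = ennreal (1 / mass) * ennreal (mass * w x)"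
      using mp by (subst ennreal_mult'[symmetric]) auto
    also have "\<dots> \<le> ennreal (1 / mass) * (ennreal mass * (\<integral>\<^sup>+y. ennreal (?K y * (V y * w y)) \<partial>lborel))"
      by (intro mult_left_mono le) simp
    finally show ?case unfolding mult.assoc[symmetric] one by simp
  qed
  text \<open>The exponent \<open>m\<close> is chosen between \<open>3 / 2\<close>, the integrability of \<open>V\<close> needed to pair it with the Yukawa
    kernel, and \<open>6 / (p - 2)\<close>, the integrability available from the Sobolev bound.\<close>
  define m where "m = 3 / 4 + 3 / (p - 2)"
  define m' where "m' = m / (m - 1)"
  define q where "q = m * (p - 2)"
  have m: "m > 3 / 2" using p by (simp add: m_def field_simps)
  \<comment> \<open>The conjugate exponent is below 3 exactly because \<open>m > 3 / 2\<close>, so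
    the power \<open>m'\<close> of the Yukawa singularity stays integrable.\<close>
  have m': "1 < m'" "m' < 3" "1 / m' + 1 / m = 1" using m by (auto simp: m'_def field_simps)
  have q_eq: "q = 3 / 4 * (p - 2) + 3" using p by (simp add: q_def m_def field_simps)
  have q: "2 \<le> q" "q < 6" using p by (auto simp: q_eq)
  let ?L = "yukawa_bound (k / 2)"
  obtain I where I: "(\<integral>\<^sup>+z. ennreal (?L z) \<partial>lborel) = ennreal I" "0 \<le> I"
    using yukawa_bound_finite[of "k / 2"] k by (cases "\<integral>\<^sup>+z. ennreal (?L z) \<partial>lborel") auto
  have L_powr: "?L z powr m' = norm z powr - m' * exp (- (k / 2 * m') * norm z)" for z
  proof -
    have "?L z powr m' = (norm z powr - 1) powr m' * exp (- (k / 2) * norm z) powr m'"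
      unfolding yukawa_bound_def by (rule powr_mult)
    also have "\<dots> = norm z powr - m' * exp (- (k / 2 * m') * norm z)"
      unfolding powr_powr exp_powr_real by simp
    finally show ?thesis .
  qed
  have "(\<integral>\<^sup>+z. ennreal (?L z powr m') \<partial>lborel) < \<infinity>"
    unfolding L_powr by (rule kernel_finite) (use m' k in auto)
  then obtain M where M: "(\<integral>\<^sup>+z. ennreal (?L z powr m') \<partial>lborel) = ennreal M" "0 \<le> M"
    by (cases "\<integral>\<^sup>+z. ennreal (?L z powr m') \<partial>lborel") auto
  define c where "c = a1 + a2 * P"
  have c: "c > 0" using a P by (simp add: c_def add_pos_pos)
  \<comment> \<open>The contraction constant \<open>1 / 2\<close> is divided into three sixths:
    \<open>\<delta>\<close> for the power of the kernel, \<open>e\<close> for the Coulomb potential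
    at infinity, \<open>\<tau>\<close> for the tail of \<open>w\<close>. The order matters, as
    \<open>D\<close> depends on \<open>\<delta>\<close> and \<open>\<tau>\<close> on
    \<open>D\<close>; the truncation \<open>n\<close> comes last. The added ones only keep the
    denominators positive.\<close>
  define \<delta> where "\<delta> = 1 / (6 * (M + 1))"
  have \<delta>: "\<delta> > 0" "\<delta> * M \<le> 1 / 6" using M by (auto simp: \<delta>_def field_simps)
  define D where "D = \<delta> powr (- m / m') * c powr m"
  have D: "D \<ge> 0" by (simp add: D_def)
  define e where "e = 1 / (6 * (a2 * I + 1))"
  have "a2 * I \<ge> 0" using a I by simp
  then have e: "e > 0" "a2 * e * I \<le> 1 / 6" by (auto simp: e_def field_simps)
  obtain R0 where R0: "\<And>x. norm x > R0 \<Longrightarrow> ?\<phi> x \<le> e" using coulomb_small[OF H e(1)] by blast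
  define \<tau> where "\<tau> = 1 / (6 * (D + 1))"
  have \<tau>: "\<tau> > 0" "D * \<tau> \<le> 1 / 6" using D by (auto simp: \<tau>_def field_simps)
  define E where "E n = {y. w y > real n \<or> norm y > real n}" for n
  have E_meas [measurable]: "E n \<in> sets borel" for n unfolding E_def by measurable
  have ev: "eventually (\<lambda>n. y \<notin> E n) sequentially" for y
  proof (rule eventually_sequentiallyI[of "nat \<lceil>max (w y) (norm y)\<rceil>"])
    fix n assume "nat \<lceil>max (w y) (norm y)\<rceil> \<le> n"
    then have "max (w y) (norm y) \<le> real n" by linarith
    then show "y \<notin> E n" by (auto simp: E_def)
  qed
  have "eventually (\<lambda>n. (\<integral>\<^sup>+y. ennreal (w y powr q) * indicator (E n) y \<partial>lborel) \<le> ennreal \<tau>) sequentially"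
    by (rule exists_small_tail[OF w_Lq[OF q]]) (use ev \<tau> in auto)
  moreover have "eventually (\<lambda>n. n \<ge> max 1 (nat \<lceil>R0\<rceil>)) sequentially" by (rule eventually_ge_at_top)
  ultimately have "eventually (\<lambda>n. (\<integral>\<^sup>+y. ennreal (w y powr q) * indicator (E n) y \<partial>lborel) \<le> ennreal \<tau> \<and> n \<ge> max 1 (nat \<lceil>R0\<rceil>)) sequentially"
    by (rule eventually_conj)
  then obtain n where n: "(\<integral>\<^sup>+y. ennreal (w y powr q) * indicator (E n) y \<partial>lborel) \<le> ennreal \<tau>" "n \<ge> 1" "R0 \<le> real n"
    using eventually_happens'[OF sequentially_bot] by fastforce
  \<comment> \<open>On \<open>E n\<close> the Coulomb potential is either below \<open>e\<close>,
    because \<open>norm y\<close> is large, or, where only \<open>w\<close> is large, bounded by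
    \<open>P * w y powr (p - 2)\<close>, because there \<open>w y \<ge> 1\<close>. Thus it need not
    be small on the bounded part of \<open>E n\<close>.\<close>
  have V_le: "V y \<le> c * w y powr (p - 2) + a2 * e" if "y \<in> E n" for y
  proof (cases "norm y > real n")
    case True
    then have "a2 * ?\<phi> y \<le> a2 * e" using a n by (intro mult_left_mono R0) auto
    moreover have "a1 * w y powr (p - 2) \<le> c * w y powr (p - 2)" using a P by (intro mult_right_mono) (auto simp: c_def)
    ultimately show ?thesis by (simp add: V_def)
  next
    case False
    then have "w y \<ge> 1" using that n by (auto simp: E_def)
    then have "1 \<le> w y powr (p - 2)" using p by (intro ge_one_powr_ge_zero) auto
    then have "a2 * ?\<phi> y \<le> a2 * P * w y powr (p - 2)"
      using a P P0[of y] mult_mono[of "a2 * ?\<phi> y" "a2 * P" 1 "w y powr (p - 2)"] by (simp add: mult_left_mono)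
    then show ?thesis using a e by (simp add: V_def c_def distrib_right add_increasing2)
  qed
  have small: "(\<integral>\<^sup>+y. ennreal (?L (x - y) * (V y * indicator (E n) y)) \<partial>lborel) \<le> ennreal (1 / 2)" for x
  proof -
    let ?K = "\<lambda>y. ?L (x - y)"
    have refl: "(\<integral>\<^sup>+y. ennreal (?K y) \<partial>lborel) = ennreal I" "(\<integral>\<^sup>+y. ennreal (?K y powr m') \<partial>lborel) = ennreal M"
      using lborel_nn_integral_reflect[of "\<lambda>z. ennreal (?L z)" x] lborel_nn_integral_reflect[of "\<lambda>z. ennreal (?L z powr m')" x]
      by (simp_all add: I M)
    have "(\<integral>\<^sup>+y. ennreal (?K y * (V y * indicator (E n) y)) \<partial>lborel) \<le>
      (\<integral>\<^sup>+y. (ennreal (\<delta> * ?K y powr m') + ennreal (a2 * e * ?K y)) + ennreal D * (ennreal (w y powr q) * indicator (E n) y) \<partial>lborel)"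
    proof (rule nn_integral_mono)
      fix y
      show "ennreal (?K y * (V y * indicator (E n) y)) \<le> (ennreal (\<delta> * ?K y powr m') + ennreal (a2 * e * ?K y)) + ennreal D * (ennreal (w y powr q) * indicator (E n) y)"
      proof (cases "y \<in> E n")
        case True
        have "?K y * (c * w y powr (p - 2)) \<le> \<delta> * ?K y powr m' + \<delta> powr (- m / m') * (c * w y powr (p - 2)) powr m"
          using m m' \<delta> c yukawa_bound_nonneg by (intro Youngs_inequality_scaled) auto
        also have "(c * w y powr (p - 2)) powr m = c powr m * w y powr q"
          using c by (simp add: powr_mult powr_powr q_def mult.commute)
        finally have 1: "?K y * (c * w y powr (p - 2)) \<le> \<delta> * ?K y powr m' + D * w y powr q" by (simp add: D_def)
        have "?K y * V y \<le> ?K y * (c * w y powr (p - 2) + a2 * e)"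
          by (intro mult_left_mono V_le True yukawa_bound_nonneg)
        also have "\<dots> \<le> (\<delta> * ?K y powr m' + a2 * e * ?K y) + D * w y powr q"
          using 1 by (simp add: algebra_simps)
        finally have "ennreal (?K y * V y) \<le> ennreal ((\<delta> * ?K y powr m' + a2 * e * ?K y) + D * w y powr q)" by (rule ennreal_leI)
        also have "\<dots> = (ennreal (\<delta> * ?K y powr m') + ennreal (a2 * e * ?K y)) + ennreal (D * w y powr q)"
          using \<delta> a e D yukawa_bound_nonneg by simp
        also have "ennreal (D * w y powr q) = ennreal D * ennreal (w y powr q)" by (rule ennreal_mult') (rule D)
        finally show ?thesis using True by simp
      qed simp
    qed
    also have "\<dots> = (\<integral>\<^sup>+y. ennreal (\<delta> * ?K y powr m') + ennreal (a2 * e * ?K y) \<partial>lborel) + (\<integral>\<^sup>+y. ennreal D * (ennreal (w y powr q) * indicator (E n) y) \<partial>lborel)"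
      by (rule nn_integral_add) measurable
    also have "(\<integral>\<^sup>+y. ennreal (\<delta> * ?K y powr m') + ennreal (a2 * e * ?K y) \<partial>lborel) = (\<integral>\<^sup>+y. ennreal (\<delta> * ?K y powr m') \<partial>lborel) + (\<integral>\<^sup>+y. ennreal (a2 * e * ?K y) \<partial>lborel)"
      by (rule nn_integral_add) measurable
    also have "(\<integral>\<^sup>+y. ennreal (\<delta> * ?K y powr m') \<partial>lborel) = ennreal (\<delta> * M)"
      using \<delta> by (subst nn_integral_ennreal_cmult) (auto simp: refl ennreal_mult')
    also have "(\<integral>\<^sup>+y. ennreal (a2 * e * ?K y) \<partial>lborel) = ennreal (a2 * e * I)"
      using a e by (subst nn_integral_ennreal_cmult) (auto simp: refl ennreal_mult' mult.assoc)
    also have "(\<integral>\<^sup>+y. ennreal D * (ennreal (w y powr q) * indicator (E n) y) \<partial>lborel) = ennreal D * (\<integral>\<^sup>+y. ennreal (w y powr q) * indicator (E n) y \<partial>lborel)"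
      by (rule nn_integral_cmult) measurable
    finally have le: "(\<integral>\<^sup>+y. ennreal (?K y * (V y * indicator (E n) y)) \<partial>lborel) \<le>
      ennreal (\<delta> * M) + ennreal (a2 * e * I) + ennreal D * (\<integral>\<^sup>+y. ennreal (w y powr q) * indicator (E n) y \<partial>lborel)" .
    have "ennreal D * (\<integral>\<^sup>+y. ennreal (w y powr q) * indicator (E n) y \<partial>lborel) \<le> ennreal D * ennreal \<tau>"
      by (intro mult_left_mono n) simp
    also have "\<dots> = ennreal (D * \<tau>)" by (rule ennreal_mult'[symmetric]) (rule D)
    also have "\<dots> \<le> ennreal (1 / 6)" by (intro ennreal_leI \<tau>)
    finally have "ennreal (\<delta> * M) + ennreal (a2 * e * I) + ennreal D * (\<integral>\<^sup>+y. ennreal (w y powr q) * indicator (E n) y \<partial>lborel) \<le>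
      ennreal (1 / 6) + ennreal (1 / 6) + ennreal (1 / 6)"
      by (intro add_mono ennreal_leI \<delta> e)
    also have "\<dots> = ennreal (1 / 2)" by (simp flip: ennreal_plus)
    finally show ?thesis by (rule order_trans[OF le])
  qed
  \<comment> \<open>Off \<open>E n\<close> both \<open>w\<close> and the norm are at most
    \<open>n\<close>, so boundedness of \<open>V * w\<close> is immediate there, before any
    boundedness of \<open>w\<close> is known.\<close>
  have off: "V y * w y \<le> (a1 * real n powr (p - 2) + a2 * P) * real n \<and> norm y \<le> real n" if "y \<notin> E n" for y
  proof -
    have y: "w y \<le> real n" "norm y \<le> real n" using that by (auto simp: E_def)
    have "V y \<le> a1 * real n powr (p - 2) + a2 * P"
      unfolding V_def using a P p w0[of y] y by (intro add_mono mult_left_mono powr_mono2) auto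
    then have "V y * w y \<le> (a1 * real n powr (p - 2) + a2 * P) * real n"
      using y w0[of y] a P by (intro mult_mono) auto
    with y show ?thesis by simp
  qed
  \<comment> \<open>The potential is bounded, so only the exponents \<open>p\<close> and 2 occur;
    both lie in the range where the integrability of \<open>w\<close> is established.\<close>
  have fin: "integrable lborel (\<lambda>y. V y * (w y)\<^sup>2)"
  proof (rule Bochner_Integration.integrable_bound)
    show "integrable lborel (\<lambda>y. a1 * w y powr p + a2 * P * w y powr 2)"
      using p by (intro Bochner_Integration.integrable_add integrable_mult_right w_Lq) auto
    show "AE y in lborel. norm (V y * (w y)\<^sup>2) \<le> norm (a1 * w y powr p + a2 * P * w y powr 2)"
    proof (intro AE_I2)
      fix y
      have w2: "(w y)\<^sup>2 = w y powr 2" using w0[of y] by (cases "w y = 0") auto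
      have "V y * (w y)\<^sup>2 = a1 * w y powr p + a2 * ?\<phi> y * w y powr 2"
        unfolding V_def w2 by (simp add: distrib_right mult.assoc powr_add[symmetric])
      also have "\<dots> \<le> a1 * w y powr p + a2 * P * w y powr 2"
        using a P by (intro add_left_mono mult_right_mono mult_left_mono) auto
      finally show "norm (V y * (w y)\<^sup>2) \<le> norm (a1 * w y powr p + a2 * P * w y powr 2)"
        using V0[of y] by simp
    qed
  qed measurable
  obtain A where A: "A > 0" "AE x in lborel. w x \<le> A * exp (- (k / 2) * norm x)"
    using exponential_decay_from_kernel[OF k w_meas V_meas E_meas w0 V0 ineq small off fin] by blast
  \<comment> \<open>One factor \<open>w\<close> keeps the exponential weight; in the remaining
    powers \<open>w\<close> is bounded by \<open>A\<close>, since the weight is at most 1.\<close>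
  define CF where "CF = ((1 + \<beta>) * A powr (p - 2) + \<gamma> * P) * A"
  have CF: "0 \<le> CF" using A P pos by (simp add: CF_def)
  have F_le: "AE y in lborel. \<bar>F y\<bar> \<le> CF * exp (- (k / 2) * norm y)"
    if F: "\<And>y. \<bar>F y\<bar> \<le> (1 + \<beta>) * w y powr (p - 1) + \<gamma> * ?\<phi> y * w y" for F
    using A(2)
  proof eventually_elim
    case (elim y)
    let ?g = "exp (- (k / 2) * norm y)"
    have "A * ?g \<le> A * 1" using k A by (intro mult_left_mono) auto
    then have wA: "w y \<le> A" using elim by simp
    have "\<bar>F y\<bar> \<le> ((1 + \<beta>) * w y powr (p - 2) + \<gamma> * ?\<phi> y) * w y"
      using F[of y] unfolding powr_eq by (simp add: algebra_simps)
    also have "\<dots> \<le> ((1 + \<beta>) * A powr (p - 2) + \<gamma> * P) * (A * ?g)"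
      using w0[of y] wA elim pos P P0[of y] p A by (intro mult_mono add_mono mult_left_mono powr_mono2) auto
    finally show ?case by (simp add: CF_def mult.assoc)
  qed
  note pot1 = yukawa_potential[OF k F1(1) CF F_le[OF F1(2)]]
  note pot2 = yukawa_potential[OF k F2(1) CF F_le[OF F2(2)]]
  obtain D1 where D1: "\<And>x. \<bar>LINT y|lborel. F1 y * yukawa k 0 (y - x)\<bar> \<le> D1 * exp (- (k / 2) * norm x)" using pot1(2) by blast
  obtain D2 where D2: "\<And>x. \<bar>LINT y|lborel. F2 y * yukawa k 0 (y - x)\<bar> \<le> D2 * exp (- (k / 2) * norm x)" using pot2(2) by blast
  define u' where "u' x = (LINT y|lborel. F1 y * yukawa k 0 (y - x)) / mass" for x
  define v' where "v' x = (LINT y|lborel. F2 y * yukawa k 0 (y - x)) / mass" for x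
  \<comment> \<open>\<open>D1\<close> and \<open>D2\<close> carry no sign; absolute values and the
    added 1 make one positive constant that serves both functions.\<close>
  define C where "C = (\<bar>D1\<bar> + \<bar>D2\<bar> + 1) / mass"
  have le: "\<bar>r / mass\<bar> \<le> C * exp (- (k / 2) * norm x)" if "\<bar>r\<bar> \<le> d * exp (- (k / 2) * norm x)" "d \<le> \<bar>D1\<bar> + \<bar>D2\<bar> + 1" for r d and x :: R3
  proof -
    have "\<bar>r\<bar> \<le> (\<bar>D1\<bar> + \<bar>D2\<bar> + 1) * exp (- (k / 2) * norm x)"
      using that(2) by (intro order_trans[OF that(1)] mult_right_mono) auto
    then have "\<bar>r\<bar> / mass \<le> (\<bar>D1\<bar> + \<bar>D2\<bar> + 1) * exp (- (k / 2) * norm x) / mass" using mp by (intro divide_right_mono) auto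
    then show ?thesis using mp by (simp add: C_def)
  qed
  show ?thesis
    unfolding exponential_decay_def
  proof (rule exI[of _ u'], rule exI[of _ v'], intro conjI)
    show "continuous_on UNIV u'" "continuous_on UNIV v'"
      unfolding u'_def v'_def using mp by (intro continuous_on_divide pot1(1) pot2(1) continuous_on_const; simp)+
    show "AE x in lborel. u' x = u x" using F1(3) mp by (auto simp: u'_def field_simps elim!: eventually_mono)
    show "AE x in lborel. v' x = v x" using F2(3) mp by (auto simp: v'_def field_simps elim!: eventually_mono)
    show "\<exists>C>0. \<exists>\<zeta>>0. \<forall>x. \<bar>u' x\<bar> \<le> C * exp (- \<zeta> * norm x) \<and> \<bar>v' x\<bar> \<le> C * exp (- \<zeta> * norm x)"
    proof (intro exI conjI allI)
      show "C > 0" using mp by (simp add: C_def)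
      show "k / 2 > 0" using k by simp
      show "\<bar>u' x\<bar> \<le> C * exp (- (k / 2) * norm x)" "\<bar>v' x\<bar> \<le> C * exp (- (k / 2) * norm x)" for x
        unfolding u'_def v'_def by (rule le[OF D1], simp) (rule le[OF D2], simp)
    qed
  qed
qed

theorem proposition1p12:
  fixes p \<gamma> \<beta> c lam :: real and u v :: "R3 \<Rightarrow> real"
  assumes "(p = 10 / 3 \<and> \<gamma> > 0 \<and> \<beta> > 0 \<and> c_lower \<gamma> \<beta> < c \<and> c < c_upper p \<gamma> \<beta>)
         \<or> (10 / 3 < p \<and> p < 4 \<and> \<gamma> > 0 \<and> \<beta> > 0 \<and> 0 < c \<and> c < c_upper p \<gamma> \<beta>)
         \<or> (4 \<le> p \<and> p < 6 \<and> \<gamma> > 0 \<and> \<beta> > 2 powr ((p - 2) / 2) \<and> 0 < c \<and> c < c_upper p \<gamma> \<beta>)"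
    and "energy_ground_state p \<gamma> \<beta> c u v"
    and "vectorial u v"
    and "weak_solution p \<gamma> \<beta> lam u v"
    and "lam > 0"
  shows "exponential_decay u v"
proof -
  \<comment> \<open>In the last of the three cases positivity comes from the lower bound
    \<open>2 powr ((p - 2) / 2)\<close>.\<close>
  have "\<beta> > 0" using assms(1) less_trans[of 0 "2 powr ((p - 2) / 2)" \<beta>] by auto
  then show ?thesis
    using weak_solution_exponential_decay[OF assms(4)] assms(1,5) by auto
qed

end
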